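(* A surface $(M^2,g)$ carries a hexagonal geodesic 3-web if and only if the geodesic flow on $(M^2,g)$ admits a cubic first integral with 3 distinct real roots.
   Context: All considerations are local: $(M^2,g)$ is a smooth two-dimensional surface with a Riemannian metric, understood as a sufficiently small neighbourhood of a point, and all objects are smooth. A 3-web is a configuration of three one-dimensional foliations, pairwise transverse at every point. It is geodesic if every leaf of each foliation is an unparametrized geodesic of $g$. It is hexagonal if near each point there exist smooth functions $u,v,w$ with nowhere vanishing differentials, constant along the leaves of the first, second and third foliation respectively, such that $u+v+w\equiv 0$. In local coordinates $(x,y)$ with conjugate momenta $(p,q)$, and $g=E\,dx^2+2F\,dx\,dy+G\,dy^2$, the geodesic flow is the Hamiltonian flow on $T^*M$ of $H=\frac{Gp^2-2Fpq+Eq^2}{2(EG-F^2)}$. A cubic first integral is a smooth function $I$ on $T^*M$ which is a homogeneous polynomial of degree 3 in the momenta (with coefficients smooth functions on $M$) satisfying $\{I,H\}=0$ for the canonical Poisson bracket. A real root of $I$ at a point of $M$ is a direction $[p:q]\in\mathbb{RP}^1$ with $I(p,q)=0$; "3 distinct real roots" means that at each point of $M$ the binary cubic form $I$ has three distinct real roots. *)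

theory Defs
  imports "HOL-Analysis.Analysis"
begin

section \<open>Smooth functions\<close>

(* Only used on open sets S, where the derivatives depend on the values of f on S alone. *)
fun higher_differentiable_on ::
  "'a::real_normed_vector set \<Rightarrow> ('a \<Rightarrow> 'b::real_normed_vector) \<Rightarrow> nat \<Rightarrow> bool" where
  "higher_differentiable_on S f 0 \<longleftrightarrow> continuous_on S f"
| "higher_differentiable_on S f (Suc n) \<longleftrightarrow>
     (\<forall>x\<in>S. f differentiable (at x)) \<and>
     (\<forall>v. higher_differentiable_on S (\<lambda>x. frechet_derivative f (at x) v) n)"

definition smooth_on ::
  "'a::real_normed_vector set \<Rightarrow> ('a \<Rightarrow> 'b::real_normed_vector) \<Rightarrow> bool" where
  "smooth_on S f \<longleftrightarrow> (\<forall>n. higher_differentiable_on S f n)"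

definition diffeomorphic_chart ::
  "'a::real_normed_vector set \<Rightarrow> 'b::real_normed_vector set \<Rightarrow> ('a \<Rightarrow> 'b) \<Rightarrow> bool" where
  "diffeomorphic_chart S T \<phi> \<longleftrightarrow>
     open S \<and> open T \<and> smooth_on S \<phi> \<and> (\<exists>\<psi>. homeomorphism S T \<phi> \<psi> \<and> smooth_on T \<psi>)"

section \<open>Metrics and geodesics in local coordinates\<close>

type_synonym point = "real \<times> real"
type_synonym scalar_field = "point \<Rightarrow> real"

definition dx :: "scalar_field \<Rightarrow> scalar_field" where
  "dx f z = frechet_derivative f (at z) (1, 0)"

definition dy :: "scalar_field \<Rightarrow> scalar_field" where
  "dy f z = frechet_derivative f (at z) (0, 1)"

(* The metric E dx^2 + 2 F dx dy + G dy^2 on the coordinate domain U. *)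
definition riemannian_metric_on ::
  "point set \<Rightarrow> scalar_field \<Rightarrow> scalar_field \<Rightarrow> scalar_field \<Rightarrow> bool" where
  "riemannian_metric_on U E F G \<longleftrightarrow>
     smooth_on U E \<and> smooth_on U F \<and> smooth_on U G \<and>
     (\<forall>z\<in>U. \<forall>a b. (a, b) \<noteq> (0, 0) \<longrightarrow> E z * a^2 + 2 * F z * a * b + G z * b^2 > 0)"

context
  fixes E F G :: scalar_field
begin

definition metric_det :: scalar_field where
  "metric_det z = E z * G z - (F z)^2"

(* christoffel_kij is the Christoffel symbol \<Gamma>^k_ij of the Levi-Civita connection. *)

definition christoffel_111 :: scalar_field where
  "christoffel_111 z = (G z * dx E z - 2 * F z * dx F z + F z * dy E z) / (2 * metric_det z)"

definition christoffel_112 :: scalar_field where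
  "christoffel_112 z = (G z * dy E z - F z * dx G z) / (2 * metric_det z)"

definition christoffel_122 :: scalar_field where
  "christoffel_122 z = (2 * G z * dy F z - G z * dx G z - F z * dy G z) / (2 * metric_det z)"

definition christoffel_211 :: scalar_field where
  "christoffel_211 z = (2 * E z * dx F z - E z * dy E z - F z * dx E z) / (2 * metric_det z)"

definition christoffel_212 :: scalar_field where
  "christoffel_212 z = (E z * dx G z - F z * dy E z) / (2 * metric_det z)"

definition christoffel_222 :: scalar_field where
  "christoffel_222 z = (E z * dy G z - 2 * F z * dy F z + F z * dx G z) / (2 * metric_det z)"

definition geodesic_on :: "real set \<Rightarrow> (real \<Rightarrow> point) \<Rightarrow> bool" where
  "geodesic_on J \<gamma> \<longleftrightarrow> smooth_on J \<gamma> \<and>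
     (let x = (\<lambda>t. fst (\<gamma> t)); y = (\<lambda>t. snd (\<gamma> t)) in
      \<forall>t\<in>J.
        deriv (deriv x) t + christoffel_111 (\<gamma> t) * (deriv x t)^2
          + 2 * christoffel_112 (\<gamma> t) * deriv x t * deriv y t
          + christoffel_122 (\<gamma> t) * (deriv y t)^2 = 0 \<and>
        deriv (deriv y) t + christoffel_211 (\<gamma> t) * (deriv x t)^2
          + 2 * christoffel_212 (\<gamma> t) * deriv x t * deriv y t
          + christoffel_222 (\<gamma> t) * (deriv y t)^2 = 0)"

definition unparametrized_geodesic :: "point set \<Rightarrow> bool" where
  "unparametrized_geodesic L \<longleftrightarrow>
     (\<exists>J \<gamma>. open J \<and> connected J \<and> J \<noteq> {} \<and> geodesic_on J \<gamma> \<and>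
        (\<forall>t\<in>J. vector_derivative \<gamma> (at t) \<noteq> 0) \<and> L = \<gamma> ` J)"

end

section \<open>Foliations and 3-webs\<close>

(* The leaves of the foliation induced on the open set W by the foliation with set of leaves \<F>:
   a leaf may meet W in several pieces. *)
definition induced_leaves :: "point set \<Rightarrow> point set set \<Rightarrow> point set set" where
  "induced_leaves W \<F> = {path_component_set (L \<inter> W) z |L z. L \<in> \<F> \<and> z \<in> L \<inter> W}"

(* A one-dimensional foliation is given by its set of leaves: a partition of U into
   path-connected sets which near each point, in suitable smooth coordinates (s, t) with values
   in an open square, becomes the family of lines t = const. Path components (rather than
   components) are those of the intrinsic topology of a leaf, even when it accumulates on itself. *)
definition foliation_on :: "point set \<Rightarrow> point set set \<Rightarrow> bool" where
  "foliation_on U \<F> \<longleftrightarrow>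
     \<Union>\<F> = U \<and> disjoint \<F> \<and> (\<forall>L\<in>\<F>. L \<noteq> {} \<and> path_connected L) \<and>
     (\<forall>m\<in>U. \<exists>W \<phi>. m \<in> W \<and> W \<subseteq> U \<and>
        diffeomorphic_chart W ({-1<..<1} \<times> {-1<..<1} :: point set) \<phi> \<and>
        induced_leaves W \<F> = (\<lambda>c. {z\<in>W. snd (\<phi> z) = c}) ` {-1<..<1})"

definition leaf_tangent_space :: "point set set \<Rightarrow> point \<Rightarrow> point set" where
  "leaf_tangent_space \<F> m =
     {v. \<exists>L\<in>\<F>. \<exists>\<epsilon>>0. \<exists>\<gamma>. smooth_on {-\<epsilon><..<\<epsilon>} \<gamma> \<and> \<gamma> ` {-\<epsilon><..<\<epsilon>} \<subseteq> L \<and> \<gamma> 0 = m \<and>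
           (\<gamma> has_vector_derivative v) (at 0)}"

definition transverse_at :: "point \<Rightarrow> point set set \<Rightarrow> point set set \<Rightarrow> bool" where
  "transverse_at m \<F>1 \<F>2 \<longleftrightarrow>
     {v + w |v w. v \<in> leaf_tangent_space \<F>1 m \<and> w \<in> leaf_tangent_space \<F>2 m} = UNIV"

definition three_web_on ::
  "point set \<Rightarrow> point set set \<Rightarrow> point set set \<Rightarrow> point set set \<Rightarrow> bool" where
  "three_web_on U \<F>1 \<F>2 \<F>3 \<longleftrightarrow>
     foliation_on U \<F>1 \<and> foliation_on U \<F>2 \<and> foliation_on U \<F>3 \<and>
     (\<forall>m\<in>U. transverse_at m \<F>1 \<F>2 \<and> transverse_at m \<F>1 \<F>3 \<and> transverse_at m \<F>2 \<F>3)"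

definition geodesic_web ::
  "scalar_field \<Rightarrow> scalar_field \<Rightarrow> scalar_field \<Rightarrow>
     point set set \<Rightarrow> point set set \<Rightarrow> point set set \<Rightarrow> bool" where
  "geodesic_web E F G \<F>1 \<F>2 \<F>3 \<longleftrightarrow> (\<forall>L \<in> \<F>1 \<union> \<F>2 \<union> \<F>3. unparametrized_geodesic E F G L)"

definition local_first_integral :: "point set \<Rightarrow> point set set \<Rightarrow> scalar_field \<Rightarrow> bool" where
  "local_first_integral W \<F> u \<longleftrightarrow>
     smooth_on W u \<and> (\<forall>z\<in>W. frechet_derivative u (at z) \<noteq> (\<lambda>v. 0)) \<and>
     (\<forall>L \<in> induced_leaves W \<F>. u constant_on L)"

definition hexagonal_web_on ::
  "point set \<Rightarrow> point set set \<Rightarrow> point set set \<Rightarrow> point set set \<Rightarrow> bool" where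
  "hexagonal_web_on U \<F>1 \<F>2 \<F>3 \<longleftrightarrow>
     (\<forall>m\<in>U. \<exists>W u v w. open W \<and> m \<in> W \<and> W \<subseteq> U \<and>
        local_first_integral W \<F>1 u \<and> local_first_integral W \<F>2 v \<and> local_first_integral W \<F>3 w \<and>
        (\<forall>z\<in>W. u z + v z + w z = 0))"

definition carries_hexagonal_geodesic_3web ::
  "point set \<Rightarrow> scalar_field \<Rightarrow> scalar_field \<Rightarrow> scalar_field \<Rightarrow> bool" where
  "carries_hexagonal_geodesic_3web U E F G \<longleftrightarrow>
     (\<exists>\<F>1 \<F>2 \<F>3. three_web_on U \<F>1 \<F>2 \<F>3 \<and> geodesic_web E F G \<F>1 \<F>2 \<F>3 \<and>
        hexagonal_web_on U \<F>1 \<F>2 \<F>3)"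

section \<open>The geodesic flow and its cubic integrals\<close>

(* ((x, y), (p, q)) with (p, q) the momenta conjugate to (x, y). *)
type_synonym phase_point = "point \<times> (real \<times> real)"

definition geodesic_hamiltonian ::
  "scalar_field \<Rightarrow> scalar_field \<Rightarrow> scalar_field \<Rightarrow> phase_point \<Rightarrow> real" where
  "geodesic_hamiltonian E F G = (\<lambda>(z, (p, q)).
     (G z * p^2 - 2 * F z * p * q + E z * q^2) / (2 * (E z * G z - (F z)^2)))"

definition poisson_bracket ::
  "(phase_point \<Rightarrow> real) \<Rightarrow> (phase_point \<Rightarrow> real) \<Rightarrow> phase_point \<Rightarrow> real" where
  "poisson_bracket f h \<xi> =
     (let D = (\<lambda>k e. frechet_derivative k (at \<xi>) e);
          ex = ((1, 0), (0, 0)); ey = ((0, 1), (0, 0));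
          ep = ((0, 0), (1, 0)); eq = ((0, 0), (0, 1))
      in D f ex * D h ep - D f ep * D h ex + D f ey * D h eq - D f eq * D h ey)"

definition cubic_first_integral_on ::
  "point set \<Rightarrow> scalar_field \<Rightarrow> scalar_field \<Rightarrow> scalar_field \<Rightarrow> (phase_point \<Rightarrow> real) \<Rightarrow> bool" where
  "cubic_first_integral_on U E F G I \<longleftrightarrow>
     smooth_on (U \<times> UNIV) I \<and>
     (\<exists>a b c d. smooth_on U a \<and> smooth_on U b \<and> smooth_on U c \<and> smooth_on U d \<and>
        (\<forall>z\<in>U. \<forall>p q. I (z, (p, q)) = a z * p^3 + b z * p^2 * q + c z * p * q^2 + d z * q^3)) \<and>
     (\<forall>\<xi>\<in>U \<times> UNIV. poisson_bracket I (geodesic_hamiltonian E F G) \<xi> = 0)"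

(* A direction [p : q] is the line spanned by (p, q). *)
definition real_roots_at :: "(phase_point \<Rightarrow> real) \<Rightarrow> point \<Rightarrow> (real \<times> real) set set" where
  "real_roots_at I z = {span {(p, q)} |p q. (p, q) \<noteq> (0, 0) \<and> I (z, (p, q)) = 0}"

(* As card is 0 on infinite sets, this excludes points at which the cubic form vanishes. *)
definition three_distinct_real_roots_on :: "point set \<Rightarrow> (phase_point \<Rightarrow> real) \<Rightarrow> bool" where
  "three_distinct_real_roots_on U I \<longleftrightarrow> (\<forall>z\<in>U. card (real_roots_at I z) = 3)"

end

theory Submission
  imports Defs
begin

text \<open>Let three foliations have first integrals \<open>u\<close>, \<open>v\<close>, \<open>w\<close> with \<open>u + v + w = 0\<close>, and view one-forms as
  functions on phase space by evaluating them on the velocity. The leaves are geodesics iff each symmetrised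
  covariant derivative \<open>\<nabla>du\<close>, \<open>\<nabla>dv\<close>, \<open>\<nabla>dw\<close> is divisible by \<open>du\<close>, \<open>dv\<close>, \<open>dw\<close>, and then the relation
  \<open>du + dv + dw = 0\<close> forces \<open>(det g / (du \<and> dv)\<^sup>2) du dv dw\<close> to be a first integral.

  Conversely a cubic with three distinct real roots factors smoothly, and its linear factors can be rescaled
  in exactly one way so that they sum to zero and the cubic is \<open>(det g / (\<alpha> \<and> \<beta>)\<^sup>2) \<alpha> \<beta> \<gamma>\<close>. For cubics
  of this shape, \<open>{I, H} = 0\<close> is equivalent to geodesy of the three kernels together with
  \<open>d\<alpha> = d\<beta> = 0\<close>, so that \<open>\<alpha>\<close>, \<open>\<beta>\<close>, \<open>\<gamma>\<close> are locally differentials of functions with sum zero.\<close>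

section \<open>Smooth functions\<close>

text \<open>Write \<open>D\<close> for the derivative along the flow. Geodesy gives
  \<open>D A = A * (p1 * A + q1 * B)\<close> and \<open>D B = B * (p2 * A + q2 * B)\<close>, and
  divisibility of \<open>D A + D B\<close> by \<open>A + B\<close> adds
  \<open>q1 + p2 = p1 + q2\<close>. Hence \<open>D\<close> multiplies \<open>A * B * C\<close> by
  \<open>(2 * p1 + p2) * A + (q1 + 2 * q2) * B\<close>. The determinant \<open>J\<close> of two
  closed forms has as logarithmic derivative half of this multiplier plus the trace of the
  Christoffel symbols, and that trace is half the logarithmic derivative of det g. This is the
  origin of the factor det g / J^2. Without closedness a combination of the two curls is left over,
  with the independent forms \<open>A\<close>, \<open>B\<close> as coefficients, so a first integral
  forces both curls to vanish. On the geometric side a foliation is a set of whole leaves, which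
  must be path-connected curves. All three foliations are therefore built over one convex region of
  the (u, v) plane, in which every leaf is an open segment. Such a leaf is shown to be a geodesic by
  reparametrising it with two quadratures; the geodesic equation is never solved. Either direction
  may shrink the neighbourhood of the point.\<close>

lemma differentiable_imp_frechet:
  "f differentiable (at x) \<Longrightarrow> (f has_derivative frechet_derivative f (at x)) (at x)"
  using frechet_derivative_works by blast

lemma has_derivative_cong_open:
  assumes "open S" "x \<in> S" "\<And>y. y \<in> S \<Longrightarrow> f y = g y"
  shows "(f has_derivative D) (at x) \<longleftrightarrow> (g has_derivative D) (at x)"
  using assms by (metis has_derivative_transform_within_open)

lemma frechet_derivative_cong_open:
  assumes "open S" "x \<in> S" "\<And>y. y \<in> S \<Longrightarrow> f y = g y"
  shows "frechet_derivative f (at x) = frechet_derivative g (at x)"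
  unfolding frechet_derivative_def using has_derivative_cong_open[OF assms] by simp

lemma differentiable_cong_open:
  assumes "open S" "x \<in> S" "\<And>y. y \<in> S \<Longrightarrow> f y = g y"
  shows "f differentiable (at x) \<longleftrightarrow> g differentiable (at x)"
  unfolding differentiable_def using has_derivative_cong_open[OF assms] by simp

lemma higher_differentiable_on_cong:
  assumes "open S" "\<And>x. x \<in> S \<Longrightarrow> f x = g x"
  shows "higher_differentiable_on S f n \<longleftrightarrow> higher_differentiable_on S g n"
  using assms(2)
proof (induction n arbitrary: f g)
  case 0
  then show ?case by (simp cong: continuous_on_cong)
next
  case (Suc n)
  have "higher_differentiable_on S (\<lambda>x. frechet_derivative f (at x) v) n =
    higher_differentiable_on S (\<lambda>x. frechet_derivative g (at x) v) n" for v
    by (rule Suc.IH) (simp add: frechet_derivative_cong_open[OF assms(1) _ Suc.prems])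
  then show ?case using differentiable_cong_open[OF assms(1) _ Suc.prems] by auto
qed

lemma higher_differentiable_on_imp_continuous_on:
  "higher_differentiable_on S f n \<Longrightarrow> continuous_on S f"
  by (cases n) (auto intro!: continuous_at_imp_continuous_on differentiable_imp_continuous_within)

lemma higher_differentiable_on_SucD:
  "higher_differentiable_on S f (Suc n) \<Longrightarrow> higher_differentiable_on S f n"
proof (induction n arbitrary: f)
  case 0
  then show ?case using higher_differentiable_on_imp_continuous_on[OF 0] by simp
next
  case (Suc n)
  then show ?case by (metis higher_differentiable_on.simps(2))
qed

lemma higher_differentiable_on_subset:
  "higher_differentiable_on S f n \<Longrightarrow> T \<subseteq> S \<Longrightarrow> higher_differentiable_on T f n"
proof (induction n arbitrary: f)
  case 0
  then show ?case using continuous_on_subset by auto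
qed auto

lemma higher_differentiable_on_const: "higher_differentiable_on S (\<lambda>x. c) n"
  by (induction n arbitrary: c) auto

lemma higher_differentiable_on_bounded_linear:
  assumes "bounded_linear f" shows "higher_differentiable_on S f n"
proof (cases n)
  case 0
  then show ?thesis using assms by (simp add: linear_continuous_on)
next
  case (Suc m)
  have "frechet_derivative f (at x) = f" for x
    using assms bounded_linear_imp_has_derivative frechet_derivative_at by metis
  then show ?thesis using Suc assms
    by (auto simp: higher_differentiable_on_const bounded_linear_imp_differentiable)
qed

text \<open>The basis of all closure properties below: an explicit derivative formula, valid on
  \<open>S\<close> only, takes the place of \<open>frechet_derivative\<close>. Openness of
  \<open>S\<close> makes the higher derivatives insensitive to the values outside.\<close>

lemma higher_differentiable_on_SucI:
  assumes "open S" "\<And>x. x \<in> S \<Longrightarrow> (f has_derivative f' x) (at x)"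
    "\<And>v. higher_differentiable_on S (\<lambda>x. f' x v) n"
  shows "higher_differentiable_on S f (Suc n)"
proof -
  have "frechet_derivative f (at x) = f' x" if "x \<in> S" for x
    using assms(2)[OF that] frechet_derivative_at by metis
  then have "higher_differentiable_on S (\<lambda>x. frechet_derivative f (at x) v) n" for v
    using assms(3)[of v] higher_differentiable_on_cong[OF assms(1), of "\<lambda>x. frechet_derivative f
        (at x) v"] by auto
  then show ?thesis using assms(2) by (auto simp: differentiable_def)
qed

lemma higher_differentiable_on_add:
  assumes "open S" "higher_differentiable_on S f n" "higher_differentiable_on S g n"
  shows "higher_differentiable_on S (\<lambda>x. f x + g x) n"
  using assms(2,3)
proof (induction n arbitrary: f g)
  case 0
  then show ?case by (auto intro: continuous_intros)
next
  case (Suc n)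
  show ?case
  proof (rule higher_differentiable_on_SucI[OF assms(1)])
    fix x assume "x \<in> S"
    then show "((\<lambda>x. f x + g x) has_derivative
        (\<lambda>v. frechet_derivative f (at x) v + frechet_derivative g (at x) v)) (at x)"
      using Suc.prems by (auto intro!: has_derivative_add differentiable_imp_frechet)
  qed (use Suc in auto)
qed

lemma higher_differentiable_on_scaleR:
  fixes f :: "'a::real_normed_vector \<Rightarrow> real"
  assumes "open S" "higher_differentiable_on S f n" "higher_differentiable_on S g n"
  shows "higher_differentiable_on S (\<lambda>x. f x *\<^sub>R g x) n"
  using assms(2,3)
proof (induction n arbitrary: f g)
  case 0
  then show ?case by (auto intro: continuous_intros)
next
  case (Suc n)
  show ?case
  proof (rule higher_differentiable_on_SucI[OF assms(1)])
    fix x assume "x \<in> S"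
    then show "((\<lambda>x. f x *\<^sub>R g x) has_derivative
        (\<lambda>v. f x *\<^sub>R frechet_derivative g (at x) v + frechet_derivative f (at x) v *\<^sub>R g x)) (at x)"
      using Suc.prems by (auto intro!: has_derivative_scaleR differentiable_imp_frechet)
  next
    fix v
    show "higher_differentiable_on S (\<lambda>x. f x *\<^sub>R frechet_derivative g (at x) v
        + frechet_derivative f (at x) v *\<^sub>R g x) n"
      using Suc.prems higher_differentiable_on_SucD[OF Suc.prems(1)]
          higher_differentiable_on_SucD[OF Suc.prems(2)]
      by (intro higher_differentiable_on_add assms Suc.IH) auto
  qed
qed

lemma higher_differentiable_on_sum:
  assumes "open S" "finite A" "\<And>i. i \<in> A \<Longrightarrow> higher_differentiable_on S (f i) n"
  shows "higher_differentiable_on S (\<lambda>x. \<Sum>i\<in>A. f i x) n"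
  using assms(2,3)
proof (induction A rule: finite_induct)
  case (insert i A)
  then show ?case using higher_differentiable_on_add[OF assms(1), of "f i" n "\<lambda>x. \<Sum>i\<in>A. f i x"] by simp
qed (simp add: higher_differentiable_on_const)

lemma higher_differentiable_on_bounded_linear_compose:
  assumes "open S" "bounded_linear h" "higher_differentiable_on S f n"
  shows "higher_differentiable_on S (\<lambda>x. h (f x)) n"
  using assms(3)
proof (induction n arbitrary: f)
  case 0
  then show ?case using assms(2) by (simp add: bounded_linear.continuous_on)
next
  case (Suc n)
  show ?case
  proof (rule higher_differentiable_on_SucI[OF assms(1)])
    fix x assume "x \<in> S"
    then show "((\<lambda>x. h (f x)) has_derivative (\<lambda>v. h (frechet_derivative f (at x) v))) (at x)"
      using bounded_linear.has_derivative[OF assms(2) differentiable_imp_frechet[of f x]] Suc.prems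
          by simp
  qed (use Suc in auto)
qed

text \<open>The chain rule enters through the expansion of the inner derivative in a basis, which turns
  the derivative of a composition into a finite sum of products of compositions.\<close>
lemma higher_differentiable_on_compose:
  fixes g :: "'a::real_normed_vector \<Rightarrow> 'b::euclidean_space"
  assumes "open S" "open T" "g ` S \<subseteq> T"
    "higher_differentiable_on T f n" "higher_differentiable_on S g n"
  shows "higher_differentiable_on S (\<lambda>x. f (g x)) n"
  using assms(4,5)
proof (induction n arbitrary: f)
  case 0
  then show ?case using assms(3) continuous_on_compose2 by auto
next
  case (Suc n)
  show ?case
  proof (rule higher_differentiable_on_SucI[OF assms(1)])
    fix x assume x: "x \<in> S"
    have f: "(f has_derivative frechet_derivative f (at (g x))) (at (g x))"
      using Suc.prems(1) x assms(3) by (intro differentiable_imp_frechet) auto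
    have comp: "((\<lambda>x. f (g x)) has_derivative
        (\<lambda>v. frechet_derivative f (at (g x)) (frechet_derivative g (at x) v))) (at x)"
      using has_derivative_compose[OF differentiable_imp_frechet[of g x] f] Suc.prems(2) x by simp
    have exp: "frechet_derivative f (at (g x)) w =
        (\<Sum>i\<in>Basis. (w \<bullet> i) *\<^sub>R frechet_derivative f (at (g x)) i)" for w
    proof -
      have "frechet_derivative f (at (g x)) (\<Sum>i\<in>Basis. (w \<bullet> i) *\<^sub>R i) =
          (\<Sum>i\<in>Basis. (w \<bullet> i) *\<^sub>R frechet_derivative f (at (g x)) i)"
        by (simp only: linear_sum[OF has_derivative_linear[OF f]] linear_scale[OF
            has_derivative_linear[OF f]])
      then show ?thesis by (simp only: euclidean_representation)
    qed
    show "((\<lambda>x. f (g x)) has_derivative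
        (\<lambda>v. \<Sum>i\<in>Basis. (frechet_derivative g (at x) v \<bullet> i) *\<^sub>R frechet_derivative f (at (g x)) i))
            (at x)"
      by (rule has_derivative_eq_rhs[OF comp]) (rule ext, rule exp)
  next
    fix v
    show "higher_differentiable_on S (\<lambda>x. \<Sum>i\<in>Basis.
        (frechet_derivative g (at x) v \<bullet> i) *\<^sub>R frechet_derivative f (at (g x)) i) n"
      using Suc.prems higher_differentiable_on_SucD[OF Suc.prems(2)]
      by (intro higher_differentiable_on_sum higher_differentiable_on_scaleR Suc.IH
          higher_differentiable_on_bounded_linear_compose[OF _ bounded_linear_inner_left] assms) auto
  qed
qed

text \<open>The derivative of \<open>inverse\<close> is a constant times a product of two copies of
  \<open>inverse\<close>, so the induction hypothesis applies to it directly.\<close>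

lemma higher_differentiable_on_inverse:
  "higher_differentiable_on (- {0::real}) inverse n"
proof (induction n)
  case 0
  then show ?case by (auto intro!: continuous_intros)
next
  case (Suc n)
  show ?case
  proof (rule higher_differentiable_on_SucI)
    fix x :: real assume "x \<in> - {0}"
    then show "(inverse has_derivative (\<lambda>v. - v *\<^sub>R (inverse x *\<^sub>R inverse x))) (at x)"
      using has_derivative_inverse'[of x UNIV] by (simp add: mult_ac)
  next
    fix v :: real
    show "higher_differentiable_on (- {0}) (\<lambda>x. - v *\<^sub>R (inverse x *\<^sub>R inverse x)) n"
      by (intro higher_differentiable_on_scaleR higher_differentiable_on_const Suc.IH) auto
  qed auto
qed

lemma higher_differentiable_on_exp: "higher_differentiable_on UNIV (exp :: real \<Rightarrow> real) n"
proof (induction n)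
  case 0
  show ?case by (simp add: continuous_on_exp)
next
  case (Suc n)
  show ?case
  proof (rule higher_differentiable_on_SucI)
    fix x :: real
    show "(exp has_derivative (\<lambda>v. v *\<^sub>R exp x)) (at x)"
      by (rule has_derivative_eq_rhs[OF DERIV_exp[unfolded has_field_derivative_def]])
          (simp add: fun_eq_iff)
  next
    fix v :: real
    show "higher_differentiable_on UNIV (\<lambda>x::real. v *\<^sub>R exp x) n"
      using Suc.IH by (intro higher_differentiable_on_scaleR higher_differentiable_on_const) auto
  qed auto
qed

lemma smooth_on_cong:
  "open S \<Longrightarrow> (\<And>x. x \<in> S \<Longrightarrow> f x = g x) \<Longrightarrow> smooth_on S f \<longleftrightarrow> smooth_on S g"
  unfolding smooth_on_def using higher_differentiable_on_cong[of S f g] by blast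

lemma smooth_on_subset: "smooth_on S f \<Longrightarrow> T \<subseteq> S \<Longrightarrow> smooth_on T f"
  unfolding smooth_on_def using higher_differentiable_on_subset by blast

lemma smooth_on_imp_continuous_on: "smooth_on S f \<Longrightarrow> continuous_on S f"
  unfolding smooth_on_def using higher_differentiable_on_imp_continuous_on by blast

lemma smooth_on_imp_differentiable: "smooth_on S f \<Longrightarrow> x \<in> S \<Longrightarrow> f differentiable (at x)"
  unfolding smooth_on_def using higher_differentiable_on.simps(2) by blast

lemma smooth_on_frechet_derivative: "smooth_on S f \<Longrightarrow> smooth_on S (\<lambda>x. frechet_derivative f (at x) v)"
  unfolding smooth_on_def using higher_differentiable_on.simps(2) by blast

lemma smooth_on_has_derivative:
  "smooth_on S f \<Longrightarrow> x \<in> S \<Longrightarrow> (f has_derivative frechet_derivative f (at x)) (at x)"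
  by (simp add: differentiable_imp_frechet smooth_on_imp_differentiable)

text \<open>Bootstrapping for functions whose derivative is expressed through the function itself,
  such as inverse and implicit functions: each order of differentiability of \<open>f\<close> passes
  to \<open>f'\<close> and thereby yields the next order. The start, continuity, comes from
  differentiability.\<close>

lemma smooth_onI_bootstrap:
  assumes "open S" "\<And>x. x \<in> S \<Longrightarrow> (f has_derivative f' x) (at x)"
    "\<And>n v. higher_differentiable_on S f n \<Longrightarrow> higher_differentiable_on S (\<lambda>x. f' x v) n"
  shows "smooth_on S f"
proof -
  have "higher_differentiable_on S f n" for n
  proof (induction n)
    case 0
    have "continuous_on S f"
      using has_derivative_continuous[OF assms(2)] by (blast intro: continuous_at_imp_continuous_on)
    then show ?case by simp
  next
    case (Suc n)
    then show ?case using higher_differentiable_on_SucI[OF assms(1,2), of n] assms(3) by blast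
  qed
  then show ?thesis by (simp add: smooth_on_def)
qed

lemma smooth_on_const: "smooth_on S (\<lambda>x. c)"
  by (simp add: smooth_on_def higher_differentiable_on_const)

lemma smooth_on_bounded_linear: "bounded_linear f \<Longrightarrow> smooth_on S f"
  by (simp add: smooth_on_def higher_differentiable_on_bounded_linear)

lemma smooth_on_id: "smooth_on S (\<lambda>x. x)"
  by (simp add: smooth_on_bounded_linear bounded_linear_ident)

lemma smooth_on_add: "open S \<Longrightarrow> smooth_on S f \<Longrightarrow> smooth_on S g \<Longrightarrow> smooth_on S (\<lambda>x. f x + g x)"
  by (simp add: smooth_on_def higher_differentiable_on_add)

lemma smooth_on_scaleR:
  "open S \<Longrightarrow> smooth_on S f \<Longrightarrow> smooth_on S g \<Longrightarrow> smooth_on S (\<lambda>x. f x *\<^sub>R g x)"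
  by (simp add: smooth_on_def higher_differentiable_on_scaleR)

lemma smooth_on_mult:
  fixes f g :: "'a::real_normed_vector \<Rightarrow> real"
  shows "open S \<Longrightarrow> smooth_on S f \<Longrightarrow> smooth_on S g \<Longrightarrow> smooth_on S (\<lambda>x. f x * g x)"
  using smooth_on_scaleR[of S f g] by simp

lemma smooth_on_power:
  fixes f :: "'a::real_normed_vector \<Rightarrow> real"
  assumes "open S" "smooth_on S f" shows "smooth_on S (\<lambda>x. f x ^ n)"
  by (induction n) (simp_all add: smooth_on_const smooth_on_mult assms)

lemma smooth_on_bounded_linear_compose:
  "open S \<Longrightarrow> bounded_linear h \<Longrightarrow> smooth_on S f \<Longrightarrow> smooth_on S (\<lambda>x. h (f x))"
  by (simp add: smooth_on_def higher_differentiable_on_bounded_linear_compose)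

lemma smooth_on_minus: "open S \<Longrightarrow> smooth_on S f \<Longrightarrow> smooth_on S (\<lambda>x. - f x)"
  by (rule smooth_on_bounded_linear_compose[OF _ bounded_linear_minus[OF bounded_linear_ident]])

lemma smooth_on_diff: "open S \<Longrightarrow> smooth_on S f \<Longrightarrow> smooth_on S g \<Longrightarrow> smooth_on S (\<lambda>x. f x - g x)"
  using smooth_on_add[OF _ _ smooth_on_minus, of S f g] by simp

lemma smooth_on_fst: "open S \<Longrightarrow> smooth_on S f \<Longrightarrow> smooth_on S (\<lambda>x. fst (f x))"
  by (rule smooth_on_bounded_linear_compose[OF _ bounded_linear_fst])

lemma smooth_on_snd: "open S \<Longrightarrow> smooth_on S f \<Longrightarrow> smooth_on S (\<lambda>x. snd (f x))"
  by (rule smooth_on_bounded_linear_compose[OF _ bounded_linear_snd])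

lemma higher_differentiable_on_Pair:
  assumes "open S" "higher_differentiable_on S f n" "higher_differentiable_on S g n"
  shows "higher_differentiable_on S (\<lambda>x. (f x, g x)) n"
proof -
  have "bounded_linear (\<lambda>x. (x, 0))" "bounded_linear (\<lambda>x. (0, x))"
    by (auto intro!: bounded_linear_Pair bounded_linear_ident bounded_linear_zero)
  from higher_differentiable_on_add[OF assms(1)
      higher_differentiable_on_bounded_linear_compose[OF assms(1) this(1) assms(2)]
      higher_differentiable_on_bounded_linear_compose[OF assms(1) this(2) assms(3)]]
  show ?thesis by simp
qed

lemma smooth_on_Pair: "open S \<Longrightarrow> smooth_on S f \<Longrightarrow> smooth_on S g \<Longrightarrow> smooth_on S (\<lambda>x. (f x, g x))"
  by (simp add: smooth_on_def higher_differentiable_on_Pair)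

lemma smooth_on_compose:
  fixes g :: "'a::real_normed_vector \<Rightarrow> 'b::euclidean_space"
  shows "open S \<Longrightarrow> open T \<Longrightarrow> g ` S \<subseteq> T \<Longrightarrow> smooth_on T f \<Longrightarrow> smooth_on S g \<Longrightarrow> smooth_on S (\<lambda>x. f (g x))"
  by (simp add: smooth_on_def higher_differentiable_on_compose[of S T g f])

lemma smooth_on_exp: "open S \<Longrightarrow> smooth_on S f \<Longrightarrow> smooth_on S (\<lambda>x. exp (f x :: real))"
  by (rule smooth_on_compose[of S UNIV f exp]) (auto simp: smooth_on_def higher_differentiable_on_exp)

lemma smooth_on_divide:
  fixes f g :: "'a::real_normed_vector \<Rightarrow> real"
  assumes "open S" "smooth_on S f" "smooth_on S g" "\<forall>x\<in>S. g x \<noteq> 0"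
  shows "smooth_on S (\<lambda>x. f x / g x)"
proof -
  have "smooth_on S (\<lambda>x. inverse (g x))"
    using assms by (intro smooth_on_compose[of S "- {0}" g inverse])
      (auto simp: smooth_on_def higher_differentiable_on_inverse)
  then show ?thesis using smooth_on_mult[OF assms(1,2)] by (simp add: divide_inverse)
qed

lemmas smooth_intros = smooth_on_const smooth_on_id smooth_on_add smooth_on_scaleR smooth_on_mult
  smooth_on_power smooth_on_minus smooth_on_diff smooth_on_fst smooth_on_snd smooth_on_Pair
  smooth_on_exp smooth_on_divide

lemma smooth_on_dx: "smooth_on S f \<Longrightarrow> smooth_on S (dx f)"
  unfolding dx_def by (rule smooth_on_frechet_derivative)

lemma smooth_on_dy: "smooth_on S f \<Longrightarrow> smooth_on S (dy f)"
  unfolding dy_def by (rule smooth_on_frechet_derivative)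

lemma has_derivative_dx_dy:
  assumes "f differentiable (at z)"
  shows "(f has_derivative (\<lambda>v. dx f z * fst v + dy f z * snd v)) (at z)"
proof -
  have D: "(f has_derivative frechet_derivative f (at z)) (at z)"
    using assms by (rule differentiable_imp_frechet)
  have "frechet_derivative f (at z) v = dx f z * fst v + dy f z * snd v" for v
  proof -
    have "frechet_derivative f (at z) (fst v *\<^sub>R (1,0) + snd v *\<^sub>R (0,1)) =
      fst v *\<^sub>R frechet_derivative f (at z) (1,0) + snd v *\<^sub>R frechet_derivative f (at z) (0,1)"
      by (simp only: linear_add[OF has_derivative_linear[OF D]] linear_scale[OF
          has_derivative_linear[OF D]])
    moreover have "fst v *\<^sub>R (1,0) + snd v *\<^sub>R (0,1) = v"
      by (simp add: prod_eq_iff)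
    ultimately show ?thesis by (simp add: dx_def dy_def mult.commute)
  qed
  from has_derivative_eq_rhs[OF D ext[OF this]] show ?thesis .
qed

lemma dx_dy_eqI:
  assumes "(f has_derivative (\<lambda>v. a * fst v + b * snd v)) (at z)"
  shows "dx f z = a" "dy f z = b"
  unfolding dx_def dy_def frechet_derivative_at[OF assms, symmetric] by simp_all

section \<open>Inverse and implicit functions\<close>

text \<open>The inverse function theorem yields an inverse that is differentiable at every point of
  \<open>V\<close>, with no information on higher derivatives. Those are recovered by bootstrapping
  wherever a formula for the derivative of the inverse is at hand.\<close>

lemma smooth_local_inverse:
  fixes \<Phi> :: "'a::euclidean_space \<Rightarrow> 'a"
  assumes U: "open U" "x0 \<in> U" and \<Phi>: "smooth_on U \<Phi>" and inj: "inj (frechet_derivative \<Phi> (at x0))"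
  obtains U' V g where "open U'" "U' \<subseteq> U" "x0 \<in> U'" "open V" "\<Phi> x0 \<in> V" "homeomorphism U' V \<Phi> g"
    "\<And>y. y \<in> V \<Longrightarrow> g differentiable (at y)"
proof -
  define \<Phi>' where "\<Phi>' x = Blinfun (frechet_derivative \<Phi> (at x))" for x
  have \<Phi>': "blinfun_apply (\<Phi>' x) = frechet_derivative \<Phi> (at x)" if "x \<in> U" for x
    unfolding \<Phi>'_def
    by (rule bounded_linear_Blinfun_apply[OF has_derivative_bounded_linear[OF
        smooth_on_has_derivative[OF \<Phi> that]]])
  have der: "(\<Phi> has_derivative blinfun_apply (\<Phi>' x)) (at x)" if "x \<in> U" for x
    using smooth_on_has_derivative[OF \<Phi> that] \<Phi>'[OF that] by simp
  have cont: "continuous_on U \<Phi>'"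
  proof (rule continuous_on_blinfun_componentwise)
    fix i :: 'a assume "i \<in> Basis"
    have "continuous_on U (\<lambda>x. frechet_derivative \<Phi> (at x) i)"
      by (rule smooth_on_imp_continuous_on[OF smooth_on_frechet_derivative[OF \<Phi>]])
    then show "continuous_on U (\<lambda>x. blinfun_apply (\<Phi>' x) i)"
      by (rule continuous_on_eq) (simp add: \<Phi>')
  qed
  have lin: "linear (frechet_derivative \<Phi> (at x0))"
    by (rule has_derivative_linear[OF smooth_on_has_derivative[OF \<Phi> U(2)]])
  then obtain h where h: "linear h" "h \<circ> frechet_derivative \<Phi> (at x0) = id"
    using linear_injective_left_inverse inj by blast
  \<comment> \<open>An injective linear map of a Euclidean space has a linear left inverse
    \<open>h\<close>; composed with the derivative at \<open>x0\<close> it is the identity, which is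
    the form of invertibility that the inverse function theorem asks for.\<close>
  have "Blinfun h o\<^sub>L \<Phi>' x0 = id_blinfun"
  proof (rule blinfun_eqI)
    fix i
    have "h (frechet_derivative \<Phi> (at x0) i) = i" using fun_cong[OF h(2), of i] by simp
    then show "blinfun_apply (Blinfun h o\<^sub>L \<Phi>' x0) i = blinfun_apply id_blinfun i"
      using h(1) by (simp add: \<Phi>'[OF U(2)] bounded_linear_Blinfun_apply linear_conv_bounded_linear)
  qed
  from inverse_function_theorem[OF U(1) der cont U(2) this]
  obtain U' V g g' where "open U'" "U' \<subseteq> U" "x0 \<in> U'" "open V" "\<Phi> x0 \<in> V" "homeomorphism U' V \<Phi> g"
    "\<And>y. y \<in> V \<Longrightarrow> (g has_derivative (g' y)) (at y)" by metis
  then show ?thesis using that by (metis differentiableI)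
qed

text \<open>Bootstrapping in the case of an inverse map: its derivative at a point is the inverse
  Jacobian, a smooth function of the value of the map there.\<close>

lemma smooth_on_ode:
  fixes g :: "'a::real_normed_vector \<Rightarrow> 'b::euclidean_space"
  assumes "open S" "open T" "g ` S \<subseteq> T" "\<And>x. x \<in> S \<Longrightarrow> (g has_derivative (\<lambda>v. R v (g x))) (at x)"
    "\<And>v. smooth_on T (R v)"
  shows "smooth_on S g"
proof (rule smooth_onI_bootstrap[OF assms(1,4)])
  fix n v assume g: "higher_differentiable_on S g n"
  have "higher_differentiable_on T (R v) n" using assms(5) by (simp add: smooth_on_def)
  from higher_differentiable_on_compose[OF assms(1-3) this g]
  show "higher_differentiable_on S (\<lambda>x. R v (g x)) n" .
qed

lemma smooth_implicit_function:
  fixes P :: "'a::euclidean_space \<times> real \<Rightarrow> real"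
  assumes U: "open U" "z0 \<in> U" and P: "smooth_on (U \<times> UNIV) P" and P0: "P (z0, r0) = 0"
    and Pr: "frechet_derivative P (at (z0, r0)) (0, 1) \<noteq> 0"
  obtains W r where "open W" "z0 \<in> W" "W \<subseteq> U" "smooth_on W r" "r z0 = r0" "\<And>z. z \<in> W \<Longrightarrow> P (z, r z) = 0"
proof -
  \<comment> \<open>Keeping \<open>z\<close> and replacing the last coordinate by the value of
    \<open>P\<close> turns solving \<open>P (z, r) = 0\<close> into inverting
    \<open>\<Theta>\<close>. The derivative of \<open>\<Theta>\<close> is block triangular, so it is
    injective as soon as the partial derivative of \<open>P\<close> in the last coordinate is
    nonzero.\<close>
  define \<Theta> where "\<Theta> \<zeta> = (fst \<zeta>, P \<zeta>)" for \<zeta>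
  define DP where "DP \<zeta> = frechet_derivative P (at \<zeta>)" for \<zeta>
  have oU: "open (U \<times> (UNIV::real set))" using U(1) by (simp add: open_Times)
  have \<Theta>: "smooth_on (U \<times> UNIV) \<Theta>"
    unfolding \<Theta>_def by (intro smooth_intros oU P)
  have DP: "(P has_derivative DP \<zeta>) (at \<zeta>)" if "\<zeta> \<in> U \<times> UNIV" for \<zeta>
    unfolding DP_def by (rule smooth_on_has_derivative[OF P that])
  have DP_split: "DP \<zeta> (v, t) = DP \<zeta> (v, 0) + t * DP \<zeta> (0, 1)" if "\<zeta> \<in> U \<times> UNIV" for \<zeta> v t
  proof -
    have "DP \<zeta> ((v, 0) + t *\<^sub>R (0, 1)) = DP \<zeta> (v, 0) + t *\<^sub>R DP \<zeta> (0, 1)"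
      by (simp only: linear_add[OF has_derivative_linear[OF DP[OF that]]]
          linear_scale[OF has_derivative_linear[OF DP[OF that]]])
    then show ?thesis by simp
  qed
  have D\<Theta>: "frechet_derivative \<Theta> (at \<zeta>) = (\<lambda>w. (fst w, DP \<zeta> w))" if "\<zeta> \<in> U \<times> UNIV" for \<zeta>
    unfolding \<Theta>_def
    by (rule frechet_derivative_at[symmetric])
      (rule has_derivative_Pair[OF has_derivative_fst[OF has_derivative_ident] DP[OF that]])
  have z0: "(z0, r0) \<in> U \<times> UNIV" using U by simp
  have "inj (frechet_derivative \<Theta> (at (z0, r0)))"
  proof (rule injI)
    fix w w' assume "frechet_derivative \<Theta> (at (z0, r0)) w = frechet_derivative \<Theta> (at (z0, r0)) w'"
    then have e: "fst w = fst w'" "DP (z0, r0) (fst w, snd w) = DP (z0, r0) (fst w', snd w')"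
      unfolding prod.collapse by (simp_all add: D\<Theta>[OF z0])
    then have "(snd w - snd w') * DP (z0, r0) (0, 1) = 0"
      using DP_split[OF z0, of "fst w" "snd w"] DP_split[OF z0, of "fst w'" "snd w'"]
      by (simp add: algebra_simps)
    then show "w = w'" using Pr e(1) by (simp add: DP_def prod_eq_iff)
  qed
  from smooth_local_inverse[OF oU z0 \<Theta> this]
  obtain U' V g where U': "open U'" "U' \<subseteq> U \<times> UNIV" "(z0, r0) \<in> U'" and V: "open V" "\<Theta> (z0, r0) \<in> V"
    and hom: "homeomorphism U' V \<Theta> g" and dg: "\<And>y. y \<in> V \<Longrightarrow> g differentiable (at y)" by metis
  define r where "r z = snd (g (z, 0))" for z
  \<comment> \<open>The domain on which implicit differentiation has a nonzero denominator;
    \<open>W\<close> is cut down so that the graph of \<open>r\<close> stays inside it.\<close>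
  define \<Omega> where "\<Omega> = {\<zeta> \<in> U \<times> UNIV. DP \<zeta> (0, 1) \<noteq> 0}"
  have "continuous_on (U \<times> UNIV) (\<lambda>\<zeta>. DP \<zeta> (0, 1))"
    unfolding DP_def by (rule smooth_on_imp_continuous_on[OF smooth_on_frechet_derivative[OF P]])
  from continuous_open_preimage[OF this oU, of "- {0}"]
  have \<Omega>: "open \<Omega>" by (simp add: \<Omega>_def vimage_def Int_def open_Compl)
  define W0 where "W0 = (\<lambda>z. (z, 0::real)) -` V"
  define W where "W = {z \<in> W0. (z, r z) \<in> \<Omega>}"
  have W0: "open W0" unfolding W0_def by (intro open_vimage V continuous_intros)
  have gz: "fst (g (z, 0)) = z" "P (g (z, 0)) = 0" "g (z, 0) \<in> U'" if "z \<in> W0" for z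
  proof -
    have "(z, 0) \<in> V" using that by (simp add: W0_def)
    then have "\<Theta> (g (z, 0)) = (z, 0)" "g (z, 0) \<in> U'"
      using hom by (auto simp: homeomorphism_def)
    then show "fst (g (z, 0)) = z" "P (g (z, 0)) = 0" "g (z, 0) \<in> U'" by (simp_all add: \<Theta>_def)
  qed
  have gr: "g (z, 0) = (z, r z)" if "z \<in> W0" for z
    using gz(1)[OF that] by (simp add: r_def prod_eq_iff)
  have dr: "r differentiable (at z)" if "z \<in> W0" for z
  proof -
    have "(z, 0) \<in> V" using that by (simp add: W0_def)
    then obtain D where "(g has_derivative D) (at (z, 0))" using dg by (auto simp: differentiable_def)
    moreover have "((\<lambda>z. (z, 0::real)) has_derivative (\<lambda>v. (v, 0))) (at z)"
      by (intro derivative_intros)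
    ultimately have "((\<lambda>z. g (z, 0)) has_derivative (\<lambda>v. D (v, 0))) (at z)"
      using has_derivative_compose[of "\<lambda>z. (z, 0::real)" "\<lambda>v. (v, 0)" z UNIV g D] by simp
    then show ?thesis unfolding r_def using differentiableI has_derivative_snd by blast
  qed
  have r0: "z0 \<in> W0" "r z0 = r0"
  proof -
    have t: "\<Theta> (z0, r0) = (z0, 0)" by (simp add: \<Theta>_def P0)
    then show w: "z0 \<in> W0" using V by (simp add: W0_def)
    have "g (z0, 0) = (z0, r0)" using hom U'(3) t by (metis homeomorphism_apply1)
    then show "r z0 = r0" by (simp add: r_def)
  qed
  have contr: "continuous_on W0 r"
    using dr differentiable_imp_continuous_within continuous_at_imp_continuous_on by blast
  have W: "open W"
  proof -
    have "continuous_on W0 (\<lambda>z. (z, r z))" by (intro continuous_intros contr)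
    from continuous_open_preimage[OF this W0 \<Omega>] show ?thesis
      by (simp add: W_def vimage_def Int_def)
  qed
  have WU: "z \<in> U" "P (z, r z) = 0" if "z \<in> W0" for z
    using gz[OF that] gr[OF that] U'(2) by auto
  \<comment> \<open>Differentiating \<open>P (z, r z) = 0\<close> and solving for the derivative of
    \<open>r\<close>. The right-hand side is smooth in \<open>(z, r z)\<close>, which is what the
    bootstrap needs.\<close>
  have der: "(r has_derivative (\<lambda>v. - DP (z, r z) (v, 0) / DP (z, r z) (0, 1))) (at z)" if z:
      "z \<in> W" for z
  proof -
    have zW: "z \<in> W0" and z\<Omega>: "(z, r z) \<in> \<Omega>" using z by (auto simp: W_def)
    then have zU: "(z, r z) \<in> U \<times> UNIV" by (auto simp: \<Omega>_def)
    obtain r' where r': "(r has_derivative r') (at z)" using dr[OF zW] by (auto simp: differentiable_def)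
    have "((\<lambda>z. P (z, r z)) has_derivative (\<lambda>v. DP (z, r z) (v, r' v))) (at z)"
      using has_derivative_compose[OF has_derivative_Pair[OF has_derivative_ident r'] DP[OF zU]] by simp
    moreover have "((\<lambda>z. P (z, r z)) has_derivative (\<lambda>v. 0)) (at z)"
      using has_derivative_cong_open[OF W0 zW, of "\<lambda>z. P (z, r z)" "\<lambda>z. 0" "\<lambda>v. 0"] WU by simp
    ultimately have "DP (z, r z) (v, r' v) = 0" for v
      using has_derivative_unique by metis
    then have "DP (z, r z) (v, 0) + r' v * DP (z, r z) (0, 1) = 0" for v
      using DP_split[OF zU] by metis
    then have "r' v = - DP (z, r z) (v, 0) / DP (z, r z) (0, 1)" for v
      using z\<Omega> by (simp add: \<Omega>_def field_simps add_eq_0_iff)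
    from has_derivative_eq_rhs[OF r' ext[OF this]] show ?thesis .
  qed
  have smooth: "smooth_on W r"
  proof (rule smooth_onI_bootstrap[OF W der])
    fix n v assume r: "higher_differentiable_on W r n"
    have "smooth_on \<Omega> (\<lambda>\<zeta>. - DP \<zeta> (v, 0) / DP \<zeta> (0, 1))"
      unfolding DP_def
      by (intro smooth_intros smooth_on_frechet_derivative smooth_on_subset[OF P] \<Omega>)
          (auto simp: \<Omega>_def DP_def)
    then have 1: "higher_differentiable_on \<Omega> (\<lambda>\<zeta>. - DP \<zeta> (v, 0) / DP \<zeta> (0, 1)) n"
      by (simp add: smooth_on_def)
    have 2: "higher_differentiable_on W (\<lambda>z. (z, r z)) n"
      by (intro higher_differentiable_on_Pair W r higher_differentiable_on_bounded_linear
          bounded_linear_ident)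
    have "(\<lambda>z. (z, r z)) ` W \<subseteq> \<Omega>" by (auto simp: W_def)
    from higher_differentiable_on_compose[OF W \<Omega> this 1 2]
    show "higher_differentiable_on W (\<lambda>z. - DP (z, r z) (v, 0) / DP (z, r z) (0, 1)) n" .
  qed
  have "z0 \<in> W" using r0 Pr z0 by (simp add: W_def \<Omega>_def DP_def)
  then show ?thesis using that[OF W _ _ smooth r0(2)] WU by (auto simp: W_def)
qed

lemma cramer_2:
  fixes a b s t :: real
  assumes "ux * a + uy * b = s" "vx * a + vy * b = t" "ux * vy - uy * vx \<noteq> 0"
  shows "a = (vy * s - uy * t) / (ux * vy - uy * vx)" "b = (ux * t - vx * s) / (ux * vy - uy * vx)"
proof -
  have "a * (ux * vy - uy * vx) = vy * s - uy * t" "b * (ux * vy - uy * vx) = ux * t - vx * s"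
    by (simp_all add: algebra_simps flip: assms(1,2))
  then show "a = (vy * s - uy * t) / (ux * vy - uy * vx)" "b = (ux * t - vx * s) / (ux * vy - uy * vx)"
    using assms(3) by (simp_all add: eq_divide_eq)
qed

text \<open>Two functions with independent differentials are local coordinates. The inverse is
  smooth because Cramer's rule expresses its derivative through the first derivatives of
  \<open>u\<close> and \<open>v\<close> at its own value.\<close>

lemma smooth_plane_chart:
  fixes u v :: scalar_field
  assumes U: "open U" "m \<in> U" and uv: "smooth_on U u" "smooth_on U v"
    and J: "dx u m * dy v m - dy u m * dx v m \<noteq> 0"
  obtains W V g where "open W" "W \<subseteq> U" "m \<in> W" "open V" "homeomorphism W V (\<lambda>z. (u z, v z)) g"
    "smooth_on V g" "\<And>z. z \<in> W \<Longrightarrow> dx u z * dy v z - dy u z * dx v z \<noteq> 0"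
proof -
  define J where "J z = dx u z * dy v z - dy u z * dx v z" for z
  define U1 where "U1 = {z \<in> U. J z \<noteq> 0}"
  have "continuous_on U J"
    unfolding J_def by (intro smooth_on_imp_continuous_on smooth_intros smooth_on_dx smooth_on_dy U uv)
  from continuous_open_preimage[OF this U(1), of "- {0}"]
  have U1: "open U1" by (simp add: U1_def vimage_def Int_def open_Compl)
  have m: "m \<in> U1" using J U by (simp add: U1_def J_def)
  have uv1: "smooth_on U1 u" "smooth_on U1 v" using uv by (auto intro: smooth_on_subset simp: U1_def)
  let ?\<Phi> = "\<lambda>z. (u z, v z)"
  have \<Phi>: "smooth_on U1 ?\<Phi>" by (intro smooth_intros U1 uv1)
  have d: "(u has_derivative (\<lambda>w. dx u z * fst w + dy u z * snd w)) (at z)"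
    "(v has_derivative (\<lambda>w. dx v z * fst w + dy v z * snd w)) (at z)" if "z \<in> U1" for z
    using that by (auto intro!: has_derivative_dx_dy smooth_on_imp_differentiable[OF uv1(1)]
        smooth_on_imp_differentiable[OF uv1(2)])
  note d\<Phi> = has_derivative_Pair[OF d(1) d(2)]
  have cramer: "a = (dy v z * s - dy u z * t) / J z" "b = (dx u z * t - dx v z * s) / J z"
    if "dx u z * a + dy u z * b = s" "dx v z * a + dy v z * b = t" "J z \<noteq> 0" for a b s t z
    using cramer_2[OF that(1,2)] that(3) by (simp_all add: J_def)
  have Jm: "J m \<noteq> 0" using m by (simp add: U1_def)
  have inj: "inj (frechet_derivative ?\<Phi> (at m))"
  proof (rule injI)
    fix w w' assume "frechet_derivative ?\<Phi> (at m) w = frechet_derivative ?\<Phi> (at m) w'"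
    then have e: "dx u m * fst w + dy u m * snd w = dx u m * fst w' + dy u m * snd w'"
        "dx v m * fst w + dy v m * snd w = dx v m * fst w' + dy v m * snd w'"
      unfolding frechet_derivative_at[OF d\<Phi>[OF m m], symmetric] by simp_all
    show "w = w'"
      using cramer[OF e Jm] cramer[OF refl refl Jm, where a = "fst w'" and b = "snd w'"] by
          (simp add: prod_eq_iff)
  qed
  obtain W V g where W: "open W" "W \<subseteq> U1" "m \<in> W" and V: "open V" "?\<Phi> m \<in> V"
    and hom: "homeomorphism W V ?\<Phi> g" and dg: "\<And>y. y \<in> V \<Longrightarrow> g differentiable (at y)"
    by (rule smooth_local_inverse[OF U1 m \<Phi> inj], rule that)
  \<comment> \<open>The inverse of the Jacobian matrix of \<open>(u, v)\<close> at \<open>z\<close>,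
    applied to \<open>w\<close>.\<close>
  define R where "R w z = ((dy v z * fst w - dy u z * snd w) / J z,
      (dx u z * snd w - dx v z * fst w) / J z)"
    for w z
  have "smooth_on V g"
  proof (rule smooth_on_ode[OF V(1) W(1)])
    show "g ` V \<subseteq> W" using hom by (simp add: homeomorphism_def)
    show "smooth_on W (R w)" for w
      unfolding R_def J_def
      by (intro smooth_intros smooth_on_dx smooth_on_dy smooth_on_subset[OF uv1(1)]
          smooth_on_subset[OF uv1(2)] W)
        (use W in \<open>auto simp: U1_def J_def\<close>)
    fix y assume y: "y \<in> V"
    then obtain g' where g': "(g has_derivative g') (at y)" using dg[OF y]
        unfolding differentiable_def by blast
    have gy: "g y \<in> W" using hom y by (auto simp: homeomorphism_def)
    then have gU: "g y \<in> U1" using W by auto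
    have "((\<lambda>y. ?\<Phi> (g y)) has_derivative (\<lambda>w. (dx u (g y) * fst (g' w) + dy u (g y) * snd (g' w),
          dx v (g y) * fst (g' w) + dy v (g y) * snd (g' w)))) (at y)"
      using has_derivative_compose[OF g' d\<Phi>[OF gU gU]] .
    moreover have "((\<lambda>y. ?\<Phi> (g y)) has_derivative (\<lambda>w. w)) (at y)"
      using has_derivative_cong_open[OF V(1) y, of "\<lambda>y. ?\<Phi> (g y)" "\<lambda>y. y" "\<lambda>w. w"]
        homeomorphism_apply2[OF hom] by simp
    ultimately have eq: "(\<lambda>w. (dx u (g y) * fst (g' w) + dy u (g y) * snd (g' w),
          dx v (g y) * fst (g' w) + dy v (g y) * snd (g' w))) = (\<lambda>w. w)"
      by (rule has_derivative_unique)
    have e: "dx u (g y) * fst (g' w) + dy u (g y) * snd (g' w) = fst w"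
        "dx v (g y) * fst (g' w) + dy v (g y) * snd (g' w) = snd w" for w
      using fun_cong[OF eq, of w] by (simp_all add: prod_eq_iff)
    have "J (g y) \<noteq> 0" using gU by (simp add: U1_def)
    from cramer[OF e this] have "g' w = R w (g y)" for w
      by (simp add: R_def prod_eq_iff)
    then have "g' = (\<lambda>w. R w (g y))" by (rule ext)
    then show "(g has_derivative (\<lambda>w. R w (g y))) (at y)" using g' by simp
  qed
  then show ?thesis using that[OF W(1) _ W(3) V(1) hom] W(2) by (auto simp: U1_def J_def)
qed

section \<open>Mixed partial derivatives and closed one-forms\<close>

lemma has_real_derivative_dx_dy:
  assumes "f differentiable (at (x, y))"
  shows "((\<lambda>s. f (s, y)) has_real_derivative dx f (x, y)) (at x)"
    "((\<lambda>t. f (x, t)) has_real_derivative dy f (x, y)) (at y)"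
proof -
  have "((\<lambda>s. (s, y)) has_derivative (\<lambda>s. (s, 0))) (at x)" "((\<lambda>t. (x, t)) has_derivative (\<lambda>t.
      (0, t))) (at y)"
    by (auto intro!: derivative_intros)
  note this[THEN has_derivative_compose, OF has_derivative_dx_dy[OF assms]]
  then show "((\<lambda>s. f (s, y)) has_real_derivative dx f (x, y)) (at x)"
    "((\<lambda>t. f (x, t)) has_real_derivative dy f (x, y)) (at y)"
    by (simp_all add: has_field_derivative_def)
qed

text \<open>An increment of \<open>f\<close> in the second variable is the integral of
  \<open>dy f\<close>. Differentiating it in the first variable under the integral sign, and then in
  the upper limit, produces \<open>dx (dy f)\<close>; differentiating the increment itself in the
  same order produces \<open>dy (dx f)\<close>.\<close>

lemma mixed_partials:
  assumes "open U" "smooth_on U f" "z \<in> U"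
  shows "dx (dy f) z = dy (dx f) z"
proof -
  obtain x y where z: "z = (x, y)" by force
  obtain A B where AB: "open A" "open B" "x \<in> A" "y \<in> B" "A \<times> B \<subseteq> U"
    using assms(1,3) z by (auto elim: open_prod_elim)
  obtain a where a: "a > 0" "ball x a \<subseteq> A" using AB open_contains_ball by blast
  obtain b where b: "b > 0" "cball y b \<subseteq> B" using AB open_contains_cball by blast
  have in_U: "(s, t) \<in> U" if "s \<in> ball x a" "t \<in> {y - b..y + b}" for s t
    using that a b AB by (auto simp: subset_iff cball_def dist_real_def abs_le_iff)
  note sm = assms(2) smooth_on_dx[OF assms(2)] smooth_on_dy[OF assms(2)]
    smooth_on_dx[OF smooth_on_dy[OF assms(2)]]
  note diff = sm[THEN smooth_on_imp_differentiable]
  have cont: "continuous_on S (\<lambda>t. h (s, t))" if "continuous_on U h" "s \<in> ball x a" "S \<subseteq> {y - b..y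
      + b}" for h S s
    by (rule continuous_on_compose2[OF that(1)]) (use in_U that in \<open>auto intro!: continuous_intros\<close>)
  have ftc: "integral (cbox (y - b) t) (\<lambda>t. dy f (s, t)) = f (s, t) - f (s, y - b)"
    if "s \<in> ball x a" "t \<in> {y - b..y + b}" for s t
  proof -
    have "((\<lambda>t. dy f (s, t)) has_integral f (s, t) - f (s, y - b)) {y - b..t}"
    proof (rule fundamental_theorem_of_calculus)
      fix r assume "r \<in> {y - b..t}"
      then have "(s, r) \<in> U" using that by (intro in_U) auto
      from has_real_derivative_dx_dy(2)[OF diff(1)[OF this]]
      show "((\<lambda>t. f (s, t)) has_vector_derivative dy f (s, r)) (at r within {y - b..t})"
        by (simp add: has_real_derivative_iff_has_vector_derivative has_vector_derivative_at_within)
    qed (use that in auto)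
    then show ?thesis by (simp add: integral_unique)
  qed
  have eq: "dx f (x, t) - dx f (x, y - b) = integral {y - b..t} (\<lambda>t. dx (dy f) (x, t))"
    if t: "t \<in> {y - b..y + b}" for t
  proof -
    have "((\<lambda>s. integral (cbox (y - b) t) (\<lambda>t. dy f (s, t))) has_field_derivative
        integral (cbox (y - b) t) (\<lambda>t. dx (dy f) (x, t))) (at x within ball x a)"
    proof (rule leibniz_rule_field_derivative)
      fix s r assume "s \<in> ball x a" "r \<in> cbox (y - b) t"
      then have "(s, r) \<in> U" using t by (intro in_U) auto
      from has_real_derivative_dx_dy(1)[OF diff(3)[OF this]]
      show "((\<lambda>s. dy f (s, r)) has_field_derivative dx (dy f) (s, r)) (at s within ball x a)"
        by (rule has_field_derivative_at_within)
    next
      fix s assume "s \<in> ball x a"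
      then show "(\<lambda>t. dy f (s, t)) integrable_on cbox (y - b) t"
        using t by (intro integrable_continuous cont[OF smooth_on_imp_continuous_on[OF sm(3)]]) auto
    next
      show "continuous_on (ball x a \<times> cbox (y - b) t) (\<lambda>(s, t). dx (dy f) (s, t))"
        using t in_U by (auto intro!: continuous_on_subset[OF smooth_on_imp_continuous_on[OF sm(4)]])
    qed (use a in auto)
    then have "((\<lambda>s. integral (cbox (y - b) t) (\<lambda>t. dy f (s, t))) has_field_derivative
        integral (cbox (y - b) t) (\<lambda>t. dx (dy f) (x, t))) (at x)"
      using a by (simp add: at_within_open[of x "ball x a"])
    then have 1: "((\<lambda>s. f (s, t) - f (s, y - b)) has_field_derivative
        integral (cbox (y - b) t) (\<lambda>t. dx (dy f) (x, t))) (at x)"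
      by (rule has_field_derivative_transform_within_open[of _ _ _ "ball x a"]) (use a t ftc in auto)
    have "(x, t) \<in> U" "(x, y - b) \<in> U" using a b t by (auto intro!: in_U)
    note this[THEN diff(1), THEN has_real_derivative_dx_dy(1)]
    from DERIV_diff[OF this] 1 show ?thesis using DERIV_unique by fastforce
  qed
  have "((\<lambda>t. integral {y - b..t} (\<lambda>t. dx (dy f) (x, t))) has_real_derivative dx (dy f) (x, y))
      (at y within {y - b..y + b})"
    using a b by (intro integral_has_real_derivative cont[OF smooth_on_imp_continuous_on[OF sm(4)]]) auto
  then have "((\<lambda>t. integral {y - b..t} (\<lambda>t. dx (dy f) (x, t))) has_real_derivative dx (dy f) (x, y))
      (at y)"
    using b at_within_Icc_at[of "y - b" y "y + b"] by simp
  then have "((\<lambda>t. dx f (x, t) - dx f (x, y - b)) has_real_derivative dx (dy f) (x, y)) (at y)"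
    by (rule has_field_derivative_transform_within_open[of _ _ _ "{y - b<..<y + b}"]) (use b eq in auto)
  moreover have "((\<lambda>t. dx f (x, t) - dx f (x, y - b)) has_real_derivative dy (dx f) (x, y) - 0) (at y)"
    using assms(3) z by (intro DERIV_diff has_real_derivative_dx_dy(2) diff(2)) auto
  ultimately show ?thesis using z DERIV_unique by fastforce
qed

text \<open>The potential is the integral of the form along the straight segment from the centre.
  Closedness turns the derivative of the integrand into a total derivative in \<open>t\<close>, so
  that the integral collapses to the value of the form at the end point.\<close>

lemma poincare_lemma_ball:
  assumes a: "smooth_on (ball m e) a" and b: "smooth_on (ball m e) b" and "e > 0"
    and closed: "\<And>z. z \<in> ball m e \<Longrightarrow> dy a z = dx b z"
  obtains u where "smooth_on (ball m e) u" "\<And>z. z \<in> ball m e \<Longrightarrow> dx u z = a z"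
    "\<And>z. z \<in> ball m e \<Longrightarrow> dy u z = b z"
proof -
  let ?B = "ball m e"
  note ab = a[THEN smooth_on_imp_differentiable] b[THEN smooth_on_imp_differentiable]
  define c where "c z t = m + t *\<^sub>R (z - m)" for z :: point and t :: real
  have cB: "c z t \<in> ?B" if "z \<in> ?B" "t \<in> {0..1}" for z t
    using convexD_alt[OF convex_ball _ that(1), of m t] that \<open>e > 0\<close> by (simp add: c_def algebra_simps)
  \<comment> \<open>\<open>L z t v\<close> is the form at the point of parameter \<open>t\<close> of
    the segment, applied to \<open>v\<close>; \<open>DL\<close> is its derivative as the end point
    \<open>z\<close> moves in direction \<open>w\<close>; \<open>K\<close> is the full derivative of
    the integrand of \<open>u\<close>.\<close>
  define L where "L z t v = a (c z t) * fst v + b (c z t) * snd v" for z t v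
  define DL where "DL z t w v = (dx a (c z t) * (t * fst w) + dy a (c z t) * (t * snd w)) * fst v
      + (dx b (c z t) * (t * fst w) + dy b (c z t) * (t * snd w)) * snd v" for z t w v
  define u where "u z = integral (cbox 0 1) (\<lambda>t. L z t (z - m))" for z
  define K where "K z t = Blinfun (\<lambda>w. DL z t w (z - m) + L z t w)" for z t
  have K: "blinfun_apply (K z t) = (\<lambda>w. DL z t w (z - m) + L z t w)" for z t
  proof -
    have "linear (\<lambda>w. DL z t w (z - m) + L z t w)"
      by (rule linearI) (simp_all add: DL_def L_def algebra_simps)
    then show ?thesis unfolding K_def by (intro bounded_linear_Blinfun_apply)
        (simp add: linear_conv_bounded_linear)
  qed
  have cont_c: "continuous_on S (\<lambda>zt. c (fst zt) (snd zt))" for S unfolding c_def by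
      (intro continuous_intros)
  have cont: "continuous_on (?B \<times> cbox 0 1) (\<lambda>zt. h (c (fst zt) (snd zt)))" if
      "continuous_on ?B h" for h :: scalar_field
    by (rule continuous_on_compose2[OF that cont_c]) (use cB in auto)
  note contab = a b smooth_on_dx[OF a] smooth_on_dy[OF a] smooth_on_dx[OF b] smooth_on_dy[OF b]
  note contab' = contab[THEN smooth_on_imp_continuous_on, THEN cont]
  have Ld: "((\<lambda>z. L z t (z - m)) has_derivative blinfun_apply (K z t)) (at z)" if "z \<in> ?B"
      "t \<in> {0..1}" for z t
  proof -
    have c': "((\<lambda>z. c z t) has_derivative (\<lambda>w. t *\<^sub>R w)) (at z)"
      unfolding c_def by (auto intro!: derivative_eq_intros)
    note has_derivative_compose[OF c' has_derivative_dx_dy[OF ab(1)[OF cB[OF that]]]]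
      has_derivative_compose[OF c' has_derivative_dx_dy[OF ab(2)[OF cB[OF that]]]]
    note d = has_derivative_add[OF has_derivative_mult[OF this(1)] has_derivative_mult[OF this(2)],
        of "\<lambda>z. fst (z - m)" "\<lambda>w. fst w" "\<lambda>z. snd (z - m)" "\<lambda>w. snd w"]
    show ?thesis unfolding L_def K
      by (rule has_derivative_eq_rhs[OF d])
        (auto intro!: derivative_eq_intros simp: DL_def L_def algebra_simps)
  qed
  have contK: "continuous_on (?B \<times> cbox 0 1) (\<lambda>zt. blinfun_apply (K (fst zt) (snd zt)) w)" for w
    unfolding K DL_def L_def by (intro continuous_intros contab')
  have contK1: "continuous_on (cbox 0 1) (\<lambda>t. K z t)" if "z \<in> ?B" for z
  proof (rule continuous_on_blinfun_componentwise)
    fix i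
    have "continuous_on (cbox 0 1) (\<lambda>t. blinfun_apply (K (fst (z, t)) (snd (z, t))) i)"
      by (rule continuous_on_compose2[OF contK[of i], where f = "\<lambda>t. (z, t)"])
        (use that in \<open>auto intro: continuous_on_Pair continuous_on_const continuous_on_id\<close>)
    then show "continuous_on (cbox 0 1) (\<lambda>t. blinfun_apply (K z t) i)" by simp
  qed
  have du: "(u has_derivative (\<lambda>v. a z * fst v + b z * snd v)) (at z)" if z: "z \<in> ?B" for z
  proof -
    have A1: "((\<lambda>z. L z t (z - m)) has_derivative blinfun_apply (K x t)) (at x within ?B)"
      if "x \<in> ?B" "t \<in> cbox 0 1" for x t
      using Ld[of x t] that by (simp add: has_derivative_at_withinI)
    have A2: "(\<lambda>t. L x t (x - m)) integrable_on cbox 0 1" if x: "x \<in> ?B" for x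
    proof (rule integrable_continuous)
      have "continuous_on (?B \<times> cbox 0 1) (\<lambda>zt. L (fst zt) (snd zt) (fst zt - m))"
        unfolding L_def by (intro continuous_intros contab')
      moreover have "continuous_on (cbox 0 1) (\<lambda>t. (x, t))"
        by (intro continuous_on_Pair continuous_on_const continuous_on_id)
      moreover have "(\<lambda>t. (x, t)) ` cbox 0 1 \<subseteq> ?B \<times> cbox (0::real) 1" using x by auto
      ultimately have "continuous_on (cbox 0 1) (\<lambda>t. L (fst (x, t)) (snd (x, t)) (fst (x, t) - m))"
        by (rule continuous_on_compose2)
      then show "continuous_on (cbox 0 1) (\<lambda>t. L x t (x - m))" by (simp only: fst_conv snd_conv)
    qed
    have "continuous_on (?B \<times> cbox 0 1) (\<lambda>zt. K (fst zt) (snd zt))"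
      by (rule continuous_on_blinfun_componentwise) (rule contK)
    then have A3: "continuous_on (?B \<times> cbox 0 1) (\<lambda>(z, t). K z t)" by (simp only: case_prod_unfold)
    have "((\<lambda>z. integral (cbox 0 1) (\<lambda>t. L z t (z - m))) has_derivative
        blinfun_apply (integral (cbox 0 1) (K z))) (at z within ?B)"
      by (rule leibniz_rule[OF A1 A2 A3 z convex_ball])
    then have 1: "(u has_derivative blinfun_apply (integral (cbox 0 1) (K z))) (at z)"
      unfolding u_def[abs_def] using z by (simp add: at_within_open[of z ?B])
    have "blinfun_apply (integral (cbox 0 1) (K z)) v = a z * fst v + b z * snd v" for v
    proof -
      have "blinfun_apply (integral (cbox 0 1) (K z)) v = integral (cbox 0 1) (\<lambda>t. blinfun_apply
          (K z t) v)"
        using integral_linear[OF integrable_continuous[OF contK1[OF z]]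
            blinfun.bounded_linear_left[of v]]
        unfolding o_def by (rule sym)
      \<comment> \<open>The antiderivative in \<open>t\<close> is \<open>t * L z t v\<close>. Its
        derivative agrees with \<open>K z t\<close> only after \<open>dy a\<close> and
        \<open>dx b\<close> have been exchanged, and this is where closedness enters.\<close>
      also have "\<dots> = 1 * L z 1 v - 0 * L z 0 v"
        unfolding cbox_interval
      proof (rule integral_unique, rule fundamental_theorem_of_calculus)
        fix t :: real assume t: "t \<in> {0..1}"
        have c': "((\<lambda>t. c z t) has_derivative (\<lambda>h. h *\<^sub>R (z - m))) (at t)"
          unfolding c_def by (auto intro!: derivative_eq_intros)
        note d1 = has_derivative_compose[OF c' has_derivative_dx_dy[OF ab(1)[OF cB[OF z t]]]]
        note d2 = has_derivative_compose[OF c' has_derivative_dx_dy[OF ab(2)[OF cB[OF z t]]]]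
        have d: "((\<lambda>t. t * L z t v) has_derivative (\<lambda>h. h * blinfun_apply (K z t) v)) (at t)"
          unfolding L_def
          by (rule has_derivative_eq_rhs[OF has_derivative_mult[OF has_derivative_ident
                has_derivative_add[OF has_derivative_mult[OF d1 has_derivative_const]
                    has_derivative_mult[OF d2 has_derivative_const]]]])
            (simp add: K DL_def L_def closed[OF cB[OF z t]] algebra_simps fun_eq_iff)
        then show "((\<lambda>t. t * L z t v) has_vector_derivative blinfun_apply (K z t) v)
            (at t within {0..1})"
          by (simp add: has_vector_derivative_def has_derivative_at_withinI)
      qed simp
      also have "\<dots> = a z * fst v + b z * snd v" by (simp add: L_def c_def)
      finally show ?thesis .
    qed
    then have "blinfun_apply (integral (cbox 0 1) (K z)) = (\<lambda>v. a z * fst v + b z * snd v)" by (rule ext)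
    with 1 show ?thesis by simp
  qed
  have "smooth_on ?B u"
  proof (rule smooth_onI_bootstrap[OF open_ball du])
    fix n v
    have "smooth_on ?B (\<lambda>z. a z * fst v + b z * snd v)" by (intro smooth_intros a b open_ball)
    then show "higher_differentiable_on ?B (\<lambda>z. a z * fst v + b z * snd v) n" by
        (simp add: smooth_on_def)
  qed
  then show ?thesis using that[of u] dx_dy_eqI[OF du] by blast
qed

section \<open>The pointwise Killing equation\<close>

text \<open>The second assumption says that the quadratic form vanishes on the kernel vector
  \<open>(a2, - a1)\<close> of the form \<open>a\<close>. Hence \<open>a\<close> divides it, and the
  other factor is expanded in the basis \<open>a\<close>, \<open>b\<close>.\<close>

lemma quadratic_form_factor:
  fixes a1 a2 b1 b2 S11 S12 S22 :: real
  assumes "a1 * b2 - a2 * b1 \<noteq> 0" "S11 * a2^2 - S12 * a1 * a2 + S22 * a1^2 = 0"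
  obtains p q where "S11 = p * a1^2 + q * a1 * b1" "S12 = 2 * p * a1 * a2 + q * (a1 * b2 + a2 * b1)"
    "S22 = p * a2^2 + q * a2 * b2"
proof -
  define J where "J = a1 * b2 - a2 * b1"
  \<comment> \<open>On the kernel vector \<open>(b2, - b1)\<close> the form \<open>a\<close> takes
    the value \<open>J\<close> and \<open>b\<close> vanishes, so the value of the quadratic form
    there is \<open>p * J^2\<close>. Polarising at the kernel vectors of \<open>a\<close> and
    \<open>b\<close> gives \<open>q\<close> in the same way.\<close>
  define p where "p = (S11 * b2^2 - S12 * b1 * b2 + S22 * b1^2) / J^2"
  define q where "q = (S12 * (a1 * b2 + a2 * b1) - 2 * S11 * a2 * b2 - 2 * S22 * a1 * b1) / J^2"
  have J: "J \<noteq> 0" using assms(1) by (simp add: J_def)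
  have p: "p * J^2 = S11 * b2^2 - S12 * b1 * b2 + S22 * b1^2" and
    q: "q * J^2 = S12 * (a1 * b2 + a2 * b1) - 2 * S11 * a2 * b2 - 2 * S22 * a1 * b1"
    using J by (simp_all add: p_def q_def)
  have "J^2 * S11 = J^2 * (p * a1^2 + q * a1 * b1)"
    "J^2 * S12 = J^2 * (2 * p * a1 * a2 + q * (a1 * b2 + a2 * b1))"
    "J^2 * S22 = J^2 * (p * a2^2 + q * a2 * b2)"
    using p q assms(2) unfolding J_def by algebra+
  then show ?thesis using J that by simp
qed

text \<open>Pointwise core: \<open>Q\<^sub>a\<close>, \<open>Q\<^sub>b\<close> are the symmetrised covariant derivatives of two linear forms
  \<open>A\<close>, \<open>B\<close>, \<open>C = - A - B\<close>, and \<open>lx\<close>, \<open>ly\<close> is the logarithmic derivative of \<open>det g / J\<^sup>2\<close>.\<close>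
lemma killing_iff:
  fixes a1 a2 b1 b2 a1x a1y a2x a2y b1x b1y b2x b2y g111 g112 g122 g211 g212 g222 :: real
  defines "J \<equiv> a1 * b2 - a2 * b1"
  defines "Sa1 \<equiv> a1x - g111 * a1 - g211 * a2" and "Sb1 \<equiv> b1x - g111 * b1 - g211 * b2"
  defines "Sa2 \<equiv> a1y + a2x - 2 * g112 * a1 - 2 * g212 * a2"
    and "Sb2 \<equiv> b1y + b2x - 2 * g112 * b1 - 2 * g212 * b2"
  defines "Sa3 \<equiv> a2y - g122 * a1 - g222 * a2" and "Sb3 \<equiv> b2y - g122 * b1 - g222 * b2"
  defines "A \<equiv> (\<lambda>X Y. a1 * X + a2 * Y)" and "B \<equiv> (\<lambda>X Y. b1 * X + b2 * Y)"
  defines "Qa \<equiv> (\<lambda>X Y. Sa1 * X^2 + Sa2 * X * Y + Sa3 * Y^2)"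
    and "Qb \<equiv> (\<lambda>X Y. Sb1 * X^2 + Sb2 * X * Y + Sb3 * Y^2)"
  defines "lx \<equiv> 2 * (g111 + g212) - 2 * (a1x * b2 + a1 * b2x - a2x * b1 - a2 * b1x) / J"
    and "ly \<equiv> 2 * (g112 + g222) - 2 * (a1y * b2 + a1 * b2y - a2y * b1 - a2 * b1y) / J"
  defines "T \<equiv> (\<lambda>X Y. Qa X Y * B X Y * (- A X Y - B X Y) + A X Y * Qb X Y * (- A X Y - B X Y)
      + A X Y * B X Y * (- Qa X Y - Qb X Y) + A X Y * B X Y * (- A X Y - B X Y) * (lx * X + ly * Y))"
  assumes J: "J \<noteq> 0"
  shows "(\<forall>X Y. T X Y = 0) \<longleftrightarrow> Qa a2 (- a1) = 0 \<and> Qb b2 (- b1) = 0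
      \<and> Qa (a2 + b2) (- (a1 + b1)) + Qb (a2 + b2) (- (a1 + b1)) = 0 \<and> a1y = a2x \<and> b1y = b2x"
proof -
  \<comment> \<open>At the kernel vector of one of the three forms every summand of \<open>T\<close>
    that contains this form as a factor vanishes. What remains is the condition that its kernel be
    geodesic, times \<open>J^2\<close> up to sign.\<close>
  have Ta: "T a2 (- a1) = J^2 * - Qa a2 (- a1)" and Tb: "T b2 (- b1) = J^2 * - Qb b2 (- b1)"
    by (simp_all add: T_def A_def B_def J_def algebra_simps power2_eq_square)
  have "A (a2 + b2) (- (a1 + b1)) = J" "B (a2 + b2) (- (a1 + b1)) = - J"
    by (simp_all add: A_def B_def J_def algebra_simps)
  then have Tc: "T (a2 + b2) (- (a1 + b1))
      = J^2 * (Qa (a2 + b2) (- (a1 + b1)) + Qb (a2 + b2) (- (a1 + b1)))"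
    unfolding T_def by (simp add: algebra_simps power2_eq_square)
  \<comment> \<open>Once the three kernels are geodesic, all of \<open>T\<close> cancels except the
    product of the three forms with a combination of the curls \<open>a2x - a1y\<close> and
    \<open>b2x - b1y\<close>.\<close>
  have defect: "T X Y = A X Y * B X Y * (- A X Y - B X Y) * ((a2x - a1y) * B X Y -
      (b2x - b1y) * A X Y) / J"
    if qa: "Qa a2 (- a1) = 0" and qb: "Qb b2 (- b1) = 0"
    and qc: "Qa (a2 + b2) (- (a1 + b1)) + Qb (a2 + b2) (- (a1 + b1)) = 0" for X Y
  proof -
    obtain p1 q1 where pq1: "Sa1 = p1 * a1^2 + q1 * a1 * b1"
        "Sa2 = 2 * p1 * a1 * a2 + q1 * (a1 * b2 + a2 * b1)" "Sa3 = p1 * a2^2 + q1 * a2 * b2"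
      using quadratic_form_factor[of a1 b2 a2 b1 Sa1 Sa2 Sa3] J qa
      by (auto simp: J_def Qa_def algebra_simps)
    obtain p2 q2 where pq2: "Sb1 = q2 * b1^2 + p2 * b1 * a1"
        "Sb2 = 2 * q2 * b1 * b2 + p2 * (b1 * a2 + b2 * a1)" "Sb3 = q2 * b2^2 + p2 * b2 * a2"
      using quadratic_form_factor[of b1 a2 b2 a1 Sb1 Sb2 Sb3] J qb
      by (auto simp: J_def Qb_def algebra_simps)
    have QaAB: "Qa X Y = A X Y * (p1 * A X Y + q1 * B X Y)" for X Y
      unfolding Qa_def pq1 A_def B_def by algebra
    have QbAB: "Qb X Y = B X Y * (p2 * A X Y + q2 * B X Y)" for X Y
      unfolding Qb_def pq2 A_def B_def by algebra
    have "A (a2 + b2) (- (a1 + b1)) = J" "B (a2 + b2) (- (a1 + b1)) = - J"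
      by (simp_all add: A_def B_def J_def algebra_simps)
    then have "J^2 * (p1 - q1 - p2 + q2) = 0"
      using qc by (simp add: QaAB QbAB algebra_simps power2_eq_square)
    then have rel: "p2 = p1 - q1 + q2" using J by simp
    \<comment> \<open>The symmetrised derivatives determine only the sums \<open>a1y + a2x\<close>
      and \<open>b1y + b2x\<close>; the curls supply the missing differences. The resulting
      equations are kept doubled to avoid halves.\<close>
    define ka kb where "ka = a2x - a1y" and "kb = b2x - b1y"
    have a: "a1x = g111 * a1 + g211 * a2 + p1 * a1^2 + q1 * a1 * b1"
      "2 * a1y = 2 * g112 * a1 + 2 * g212 * a2 + 2 * p1 * a1 * a2 + q1 * (a1 * b2 + a2 * b1) - ka"
      "2 * a2x = 2 * g112 * a1 + 2 * g212 * a2 + 2 * p1 * a1 * a2 + q1 * (a1 * b2 + a2 * b1) + ka"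
      "a2y = g122 * a1 + g222 * a2 + p1 * a2^2 + q1 * a2 * b2"
      using pq1 unfolding Sa1_def Sa2_def Sa3_def ka_def by simp_all
    have b: "b1x = g111 * b1 + g211 * b2 + q2 * b1^2 + p2 * b1 * a1"
      "2 * b1y = 2 * g112 * b1 + 2 * g212 * b2 + 2 * q2 * b1 * b2 + p2 * (a1 * b2 + a2 * b1) - kb"
      "2 * b2x = 2 * g112 * b1 + 2 * g212 * b2 + 2 * q2 * b1 * b2 + p2 * (a1 * b2 + a2 * b1) + kb"
      "b2y = g122 * b1 + g222 * b2 + q2 * b2^2 + p2 * b2 * a2"
      using pq2 unfolding Sb1_def Sb2_def Sb3_def kb_def by (simp_all add: algebra_simps)
    have lx0: "J * lx = 2 * (J * (g111 + g212)) - 2 * (a1x * b2 + a1 * b2x - a2x * b1 - a2 * b1x)"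
      and ly0: "J * ly = 2 * (J * (g112 + g222)) - 2 * (a1y * b2 + a1 * b2y - a2y * b1 - a2 * b1y)"
      using J by (simp_all add: lx_def ly_def field_simps)
    have "2 * (a1x * b2 + a1 * b2x - a2x * b1 - a2 * b1x)
        = J * (2 * (g111 + g212) + 2 * p1 * a1 + q1 * b1 + p2 * a1 + 2 * q2 * b1) + (a1 * kb - b1 * ka)"
      using a b unfolding J_def by algebra
    then have lx: "J * lx = - (J * ((2 * p1 + p2) * a1 + (q1 + 2 * q2) * b1) + (a1 * kb - b1 * ka))"
      using lx0 by algebra
    have "2 * (a1y * b2 + a1 * b2y - a2y * b1 - a2 * b1y)
        = J * (2 * (g112 + g222) + 2 * p1 * a2 + q1 * b2 + p2 * a2 + 2 * q2 * b2) + (a2 * kb - b2 * ka)"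
      using a b unfolding J_def by algebra
    then have ly: "J * ly = - (J * ((2 * p1 + p2) * a2 + (q1 + 2 * q2) * b2) + (a2 * kb - b2 * ka))"
      using ly0 by algebra
    have L: "J * (lx * X + ly * Y) = - J * ((2 * p1 + p2) * A X Y + (q1 + 2 * q2) * B X Y)
        + (ka * B X Y - kb * A X Y)"
      using lx ly unfolding A_def B_def by algebra
    have "J * T X Y = A X Y * B X Y * (- A X Y - B X Y) * (ka * B X Y - kb * A X Y)"
      unfolding T_def QaAB QbAB using L rel by algebra
    then show ?thesis
      using J by (simp add: ka_def kb_def field_simps)
  qed
  show ?thesis
  proof
    assume T: "\<forall>X Y. T X Y = 0"
    then have q: "Qa a2 (- a1) = 0" "Qb b2 (- b1) = 0"
        "Qa (a2 + b2) (- (a1 + b1)) + Qb (a2 + b2) (- (a1 + b1)) = 0"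
      using Ta Tb Tc J by auto
    \<comment> \<open>Two vectors at which none of the three forms vanishes and at which
      \<open>(A, B)\<close> is \<open>(J, J)\<close> and \<open>(2 * J, J)\<close>. They give two
      independent linear equations for the curls.\<close>
    have AB: "A (b2 - a2) (a1 - b1) = J" "B (b2 - a2) (a1 - b1) = J"
      "A (2 * b2 - a2) (a1 - 2 * b1) = 2 * J" "B (2 * b2 - a2) (a1 - 2 * b1) = J"
      by (simp_all add: A_def B_def J_def algebra_simps)
    have "(a2x - a1y) * J - (b2x - b1y) * J = 0"
      using defect[OF q, of "b2 - a2" "a1 - b1"] T J unfolding AB by simp
    moreover have "(a2x - a1y) * J - (b2x - b1y) * (2 * J) = 0"
      using defect[OF q, of "2 * b2 - a2" "a1 - 2 * b1"] T J unfolding AB by simp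
    ultimately have "((a2x - a1y) - (b2x - b1y)) * J = 0" "((a2x - a1y) - 2 * (b2x - b1y)) * J = 0"
      by (simp_all add: algebra_simps)
    then have "a1y = a2x" "b1y = b2x" using J by simp_all
    then show "Qa a2 (- a1) = 0 \<and> Qb b2 (- b1) = 0
      \<and> Qa (a2 + b2) (- (a1 + b1)) + Qb (a2 + b2) (- (a1 + b1)) = 0 \<and> a1y = a2x \<and> b1y = b2x"
      using q by simp
  qed (auto simp: defect)
qed

section \<open>Poisson brackets with the geodesic Hamiltonian, in terms of velocities\<close>

lemma poisson_bracket_mult:
  assumes "f differentiable (at \<xi>)" "g differentiable (at \<xi>)"
  shows "poisson_bracket (\<lambda>\<xi>. f \<xi> * g \<xi>) h \<xi> = f \<xi> * poisson_bracket g h \<xi> + g \<xi> * poisson_bracket f h \<xi>"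
proof -
  have "frechet_derivative (\<lambda>\<xi>. f \<xi> * g \<xi>) (at \<xi>)
      = (\<lambda>v. f \<xi> * frechet_derivative g (at \<xi>) v + frechet_derivative f (at \<xi>) v * g \<xi>)"
    by (rule frechet_derivative_at[symmetric],
        rule has_derivative_mult[OF differentiable_imp_frechet[OF assms(1)]
            differentiable_imp_frechet[OF assms(2)]])
  then show ?thesis by (simp add: poisson_bracket_def Let_def algebra_simps)
qed

lemma poisson_bracket_add:
  assumes "f differentiable (at \<xi>)" "g differentiable (at \<xi>)"
  shows "poisson_bracket (\<lambda>\<xi>. f \<xi> + g \<xi>) h \<xi> = poisson_bracket f h \<xi> + poisson_bracket g h \<xi>"
proof -
  have "frechet_derivative (\<lambda>\<xi>. f \<xi> + g \<xi>) (at \<xi>)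
      = (\<lambda>v. frechet_derivative f (at \<xi>) v + frechet_derivative g (at \<xi>) v)"
    by (rule frechet_derivative_at[symmetric],
        rule has_derivative_add[OF differentiable_imp_frechet[OF assms(1)]
            differentiable_imp_frechet[OF assms(2)]])
  then show ?thesis by (simp add: poisson_bracket_def Let_def algebra_simps)
qed

lemma poisson_bracket_cong:
  assumes "open S" "\<xi> \<in> S" "\<And>\<eta>. \<eta> \<in> S \<Longrightarrow> f \<eta> = g \<eta>"
  shows "poisson_bracket f h \<xi> = poisson_bracket g h \<xi>"
  using frechet_derivative_cong_open[OF assms] by (simp add: poisson_bracket_def)

text \<open>The components of the momentum raised with the inverse metric, that is, the velocity of
  the geodesic flow. In these variables one-forms stay linear forms with the same coefficients, and
  the Christoffel symbols enter as in the geodesic equation.\<close>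

definition velocity_x :: "scalar_field \<Rightarrow> scalar_field \<Rightarrow> scalar_field \<Rightarrow> phase_point \<Rightarrow> real" where
  "velocity_x E F G = (\<lambda>(z, (p, q)). (G z * p - F z * q) / metric_det E F G z)"

definition velocity_y :: "scalar_field \<Rightarrow> scalar_field \<Rightarrow> scalar_field \<Rightarrow> phase_point \<Rightarrow> real" where
  "velocity_y E F G = (\<lambda>(z, (p, q)). (E z * q - F z * p) / metric_det E F G z)"

text \<open>The covariant derivative of the form \<open>\<alpha> dx + \<beta> dy\<close>, evaluated
  twice on \<open>(X, Y)\<close>. Only its symmetric part survives, so the coefficient of
  \<open>X * Y\<close> collects both mixed entries.\<close>

definition sym_cov_deriv ::
  "scalar_field \<Rightarrow> scalar_field \<Rightarrow> scalar_field \<Rightarrow> scalar_field \<Rightarrow> scalar_field \<Rightarrow> point \<Rightarrow> real \<Rightarrow> real \<Rightarrow>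
      real" where
  "sym_cov_deriv E F G \<alpha> \<beta> z X Y =
     (dx \<alpha> z - christoffel_111 E F G z * \<alpha> z - christoffel_211 E F G z * \<beta> z) * X^2
     + (dy \<alpha> z + dx \<beta> z - 2 * christoffel_112 E F G z * \<alpha> z - 2 * christoffel_212 E F G z * \<beta> z) * X * Y
     + (dy \<beta> z - christoffel_122 E F G z * \<alpha> z - christoffel_222 E F G z * \<beta> z) * Y^2"

lemma momentum_velocity:
  assumes "metric_det E F G z \<noteq> 0"
  shows "E z * velocity_x E F G (z, (p, q)) + F z * velocity_y E F G (z, (p, q)) = p" (is ?G1)
    "F z * velocity_x E F G (z, (p, q)) + G z * velocity_y E F G (z, (p, q)) = q" (is ?G2)
proof -
  have "E z * (G z * p - F z * q) + F z * (E z * q - F z * p) = metric_det E F G z * p"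
    "F z * (G z * p - F z * q) + G z * (E z * q - F z * p) = metric_det E F G z * q"
    by (simp_all add: metric_det_def algebra_simps power2_eq_square)
  then show ?G1
    ?G2
    using assms by (simp_all add: velocity_x_def velocity_y_def field_simps)
qed

lemma has_derivative_base:
  assumes "(f has_derivative D) (at z)"
  shows "((\<lambda>\<xi>. f (fst \<xi>)) has_derivative (\<lambda>w. D (fst w))) (at (z, \<pi>))"
  by (rule has_derivative_compose[of fst fst _ _ f D]) (use assms in \<open>auto intro!: derivative_intros\<close>)

context
  fixes E F G :: scalar_field and z :: point and p q :: real
  assumes diff: "E differentiable (at z)" "F differentiable (at z)" "G differentiable (at z)"
    and det: "metric_det E F G z \<noteq> 0"
begin

abbreviation (input) "vx \<equiv> velocity_x E F G (z, (p, q))"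
abbreviation (input) "vy \<equiv> velocity_y E F G (z, (p, q))"

lemma E_has_derivative: "((\<lambda>\<xi>. E (fst \<xi>)) has_derivative (\<lambda>w. dx E z * fst (fst w) + dy E z * snd
    (fst w))) (at (z, (p, q)))"
  and F_has_derivative: "((\<lambda>\<xi>. F (fst \<xi>)) has_derivative (\<lambda>w. dx F z * fst (fst w) + dy F z * snd
      (fst w))) (at (z, (p, q)))"
  and G_has_derivative: "((\<lambda>\<xi>. G (fst \<xi>)) has_derivative (\<lambda>w. dx G z * fst (fst w) + dy G z * snd
      (fst w))) (at (z, (p, q)))"
  by (intro has_derivative_base[OF has_derivative_dx_dy] diff)+

lemma p_has_derivative: "((\<lambda>\<xi>. fst (snd \<xi>)) has_derivative (\<lambda>w. fst (snd w))) (at (z, (p, q)))"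
  and q_has_derivative: "((\<lambda>\<xi>. snd (snd \<xi>)) has_derivative (\<lambda>w. snd (snd w))) (at (z, (p, q)))"
  by (auto intro!: derivative_intros)

text \<open>The quotient rule with the value \<open>X\<close> of the quotient substituted: a single
  power of the denominator remains, which keeps the later identities of low degree.\<close>

lemma quotient_derivative_eq:
  fixes N D X N' D' :: real
  assumes "N = X * D" "D \<noteq> 0"
  shows "(N' * D - N * D') / (D * D) = (N' - X * D') / D"
  using assms by (simp add: field_simps)

lemma velocity_has_derivative:
  shows "(velocity_x E F G has_derivative (\<lambda>w. (G z * fst (snd w) - F z * snd (snd w)
      - G z * vx * (dx E z * fst (fst w) + dy E z * snd (fst w))
      + (F z * vx - G z * vy) * (dx F z * fst (fst w) + dy F z * snd (fst w))
      + F z * vy * (dx G z * fst (fst w) + dy G z * snd (fst w))) / metric_det E F G z))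
      (at (z, (p, q)))" (is ?G1)
    and "(velocity_y E F G has_derivative (\<lambda>w. (E z * snd (snd w) - F z * fst (snd w)
      - E z * vy * (dx G z * fst (fst w) + dy G z * snd (fst w))
      + (F z * vy - E z * vx) * (dx F z * fst (fst w) + dy F z * snd (fst w))
      + F z * vx * (dx E z * fst (fst w) + dy E z * snd (fst w))) / metric_det E F G z))
      (at (z, (p, q)))" (is ?G2)
    and "(geodesic_hamiltonian E F G has_derivative (\<lambda>w. vx * fst (snd w) + vy * snd (snd w)
      - ((dx E z * fst (fst w) + dy E z * snd (fst w)) * vx^2
         + 2 * (dx F z * fst (fst w) + dy F z * snd (fst w)) * vx * vy
         + (dx G z * fst (fst w) + dy G z * snd (fst w)) * vy^2) / 2)) (at (z, (p, q)))" (is ?G3)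
proof -
  define X Y where "X = vx" and "Y = vy"
  \<comment> \<open>Eliminating the momenta in favour of the velocities turns the comparisons of
    derivatives into polynomial identities over the common denominator.\<close>
  have pq: "p = E z * X + F z * Y" "q = F z * X + G z * Y"
    using momentum_velocity[where E=E and F=F and G=G, OF det] by (simp_all add: X_def Y_def)
  have D: "E z * G z - F z * F z \<noteq> 0" using det by (simp add: metric_det_def power2_eq_square)
  have eq: "velocity_x E F G = (\<lambda>\<xi>. (G (fst \<xi>) * fst (snd \<xi>) - F (fst \<xi>) * snd (snd \<xi>))
      / (E (fst \<xi>) * G (fst \<xi>) - F (fst \<xi>) * F (fst \<xi>)))"
    "velocity_y E F G = (\<lambda>\<xi>. (E (fst \<xi>) * snd (snd \<xi>) - F (fst \<xi>) * fst (snd \<xi>))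
      / (E (fst \<xi>) * G (fst \<xi>) - F (fst \<xi>) * F (fst \<xi>)))"
    "geodesic_hamiltonian E F G = (\<lambda>\<xi>. ((1/2) * (G (fst \<xi>) * (fst (snd \<xi>) * fst (snd \<xi>))
       - (F (fst \<xi>) * (fst (snd \<xi>) * snd (snd \<xi>)) + F (fst \<xi>) * (fst (snd \<xi>) * snd (snd \<xi>)))
       + E (fst \<xi>) * (snd (snd \<xi>) * snd (snd \<xi>))))
      / (E (fst \<xi>) * G (fst \<xi>) - F (fst \<xi>) * F (fst \<xi>)))"
    by (auto simp: velocity_x_def velocity_y_def geodesic_hamiltonian_def metric_det_def power2_eq_square
        divide_simps fun_eq_iff algebra_simps)
  note det' = has_derivative_diff[OF has_derivative_mult[OF E_has_derivative G_has_derivative]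
      has_derivative_mult[OF F_has_derivative F_has_derivative]]
  note der = has_derivative_divide'[OF
      has_derivative_diff[OF has_derivative_mult[OF G_has_derivative p_has_derivative]
          has_derivative_mult[OF F_has_derivative q_has_derivative]] det']
    has_derivative_divide'[OF
      has_derivative_diff[OF has_derivative_mult[OF E_has_derivative q_has_derivative]
          has_derivative_mult[OF F_has_derivative p_has_derivative]] det']
    has_derivative_divide'[OF has_derivative_mult[OF has_derivative_const[of "1/2"] has_derivative_add[OF
      has_derivative_diff[OF has_derivative_mult[OF G_has_derivative
          has_derivative_mult[OF p_has_derivative p_has_derivative]]
        has_derivative_add[OF has_derivative_mult[OF F_has_derivative
            has_derivative_mult[OF p_has_derivative q_has_derivative]]
           has_derivative_mult[OF F_has_derivative
               has_derivative_mult[OF p_has_derivative q_has_derivative]]]]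
      has_derivative_mult[OF E_has_derivative
          has_derivative_mult[OF q_has_derivative q_has_derivative]]]] det']
  show ?G1
    unfolding X_def[symmetric] Y_def[symmetric] unfolding eq
    apply (rule has_derivative_eq_rhs[OF der(1)])
    using D apply simp
    apply (rule ext)
    apply (subst quotient_derivative_eq[where X = X])
    subgoal by (simp add: pq algebra_simps)
    subgoal using D by simp
    subgoal by (rule arg_cong2[where f="(/)"])
        (simp_all add: pq metric_det_def power2_eq_square algebra_simps)
    done
  show ?G2
    unfolding X_def[symmetric] Y_def[symmetric] unfolding eq
    apply (rule has_derivative_eq_rhs[OF der(2)])
    using D apply simp
    apply (rule ext)
    apply (subst quotient_derivative_eq[where X = Y])
    subgoal by (simp add: pq algebra_simps)
    subgoal using D by simp
    subgoal by (rule arg_cong2[where f="(/)"])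
        (simp_all add: pq metric_det_def power2_eq_square algebra_simps)
    done
  show ?G3
    unfolding X_def[symmetric] Y_def[symmetric] unfolding eq
    apply (rule has_derivative_eq_rhs[OF der(3)])
    using D apply simp
    apply (rule ext)
    \<comment> \<open>The value of the Hamiltonian in terms of velocities: half of the squared
      length.\<close>
    apply (subst quotient_derivative_eq[where X = "(E z * X^2 + 2 * F z * X * Y + G z * Y^2) / 2"])
    subgoal by (simp add: pq algebra_simps power2_eq_square)
    subgoal using D by simp
    using D by (simp add: pq divide_eq_eq) (simp add: field_simps power2_eq_square)
qed

text \<open>Hamilton's equations: the momentum derivatives of the Hamiltonian are the velocities,
  and its position derivatives are minus half of the differentiated metric evaluated on the
  velocity.\<close>

lemma poisson_bracket_hamiltonian:
  assumes "(f has_derivative D) (at (z, (p, q)))"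
  shows "poisson_bracket f (geodesic_hamiltonian E F G) (z, (p, q))
    = D ((1, 0), (0, 0)) * vx + D ((0, 1), (0, 0)) * vy
      + (D ((0, 0), (1, 0)) * (dx E z * vx^2 + 2 * dx F z * vx * vy + dx G z * vy^2)
      + D ((0, 0), (0, 1)) * (dy E z * vx^2 + 2 * dy F z * vx * vy + dy G z * vy^2)) / 2"
  by (simp add: poisson_bracket_def Let_def frechet_derivative_at[OF assms, symmetric]
      frechet_derivative_at[OF velocity_has_derivative(3), symmetric] algebra_simps add_divide_distrib)

text \<open>The geodesic equation: along the flow the velocities change by minus the quadratic
  expression in the Christoffel symbols.\<close>

lemma poisson_bracket_velocity:
  shows "poisson_bracket (velocity_x E F G) (geodesic_hamiltonian E F G) (z, (p, q))
     = - (christoffel_111 E F G z * vx^2 + 2 * christoffel_112 E F G z * vx * vy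
         + christoffel_122 E F G z * vy^2)"
   and "poisson_bracket (velocity_y E F G) (geodesic_hamiltonian E F G) (z, (p, q))
     = - (christoffel_211 E F G z * vx^2 + 2 * christoffel_212 E F G z * vx * vy
         + christoffel_222 E F G z * vy^2)"
  unfolding poisson_bracket_hamiltonian[OF velocity_has_derivative(1)]
    poisson_bracket_hamiltonian[OF velocity_has_derivative(2)]
    christoffel_111_def christoffel_112_def christoffel_122_def
    christoffel_211_def christoffel_212_def christoffel_222_def
  using det by (simp_all add: divide_simps) (simp_all add: algebra_simps power2_eq_square)

lemma poisson_bracket_base:
  assumes "f differentiable (at z)"
  shows "poisson_bracket (\<lambda>\<xi>. f (fst \<xi>)) (geodesic_hamiltonian E F G) (z, (p, q)) = dx f z * vx
      + dy f z * vy"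
  unfolding poisson_bracket_hamiltonian[OF has_derivative_base[OF has_derivative_dx_dy[OF assms]]]
      by simp

text \<open>By the Leibniz rule the coefficients contribute their derivatives along the velocity and
  the velocities contribute the Christoffel terms; together they form the covariant
  derivative.\<close>

lemma poisson_bracket_linear:
  assumes "a differentiable (at z)" "b differentiable (at z)"
  shows "poisson_bracket (\<lambda>\<xi>. a (fst \<xi>) * velocity_x E F G \<xi> + b (fst \<xi>) * velocity_y E F G \<xi>)
      (geodesic_hamiltonian E F G) (z, (p, q)) = sym_cov_deriv E F G a b z vx vy"
proof -
  have d: "(\<lambda>\<xi>. a (fst \<xi>)) differentiable (at (z, (p, q)))" "(\<lambda>\<xi>. b (fst \<xi>)) differentiable (at (z,
      (p, q)))"
    "velocity_x E F G differentiable (at (z, (p, q)))" "velocity_y E F G differentiable (at (z, (p, q)))"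
    using has_derivative_base[OF has_derivative_dx_dy[OF assms(1)]]
      has_derivative_base[OF has_derivative_dx_dy[OF assms(2)]] velocity_has_derivative(1,2)
    by (auto simp: differentiable_def)
  show ?thesis
    by (simp add: poisson_bracket_add poisson_bracket_mult differentiable_mult d
        poisson_bracket_velocity poisson_bracket_base assms sym_cov_deriv_def)
      (simp add: algebra_simps power2_eq_square)
qed

end

section \<open>The Killing cubic of a pair of one-forms\<close>

lemma dx_dy_arith:
  assumes "f differentiable (at z)" "g differentiable (at z)"
  shows "dx (\<lambda>z. f z + g z) z = dx f z + dx g z" "dy (\<lambda>z. f z + g z) z = dy f z + dy g z"
    and "dx (\<lambda>z. f z - g z) z = dx f z - dx g z" "dy (\<lambda>z. f z - g z) z = dy f z - dy g z"
    and "dx (\<lambda>z. f z * g z) z = f z * dx g z + dx f z * g z" "dy (\<lambda>z. f z * g z) z = f z * dy g z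
        + dy f z * g z"
    and "g z \<noteq> 0 \<Longrightarrow> dx (\<lambda>z. f z / g z) z = (dx f z * g z - f z * dx g z) / (g z * g z)"
    and "g z \<noteq> 0 \<Longrightarrow> dy (\<lambda>z. f z / g z) z = (dy f z * g z - f z * dy g z) / (g z * g z)"
  by (simp_all add: dx_def dy_def frechet_derivative_at[symmetric, OF has_derivative_add[OF assms[THEN differentiable_imp_frechet]]]
      frechet_derivative_at[symmetric, OF has_derivative_diff[OF assms[THEN differentiable_imp_frechet]]]
      frechet_derivative_at[symmetric, OF has_derivative_mult[OF assms[THEN differentiable_imp_frechet]]]
      frechet_derivative_at[symmetric, OF has_derivative_divide'[OF assms[THEN differentiable_imp_frechet]]])

definition killing_cubic ::
  "scalar_field \<Rightarrow> scalar_field \<Rightarrow> scalar_field \<Rightarrow> scalar_field \<Rightarrow> scalar_field \<Rightarrow> scalar_field \<Rightarrow> scalar_field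
    \<Rightarrow> phase_point \<Rightarrow> real" where
  "killing_cubic E F G a1 a2 b1 b2 = (\<lambda>\<xi>.
     metric_det E F G (fst \<xi>) / (a1 (fst \<xi>) * b2 (fst \<xi>) - a2 (fst \<xi>) * b1 (fst \<xi>))^2 *
     ((a1 (fst \<xi>) * velocity_x E F G \<xi> + a2 (fst \<xi>) * velocity_y E F G \<xi>) *
      (b1 (fst \<xi>) * velocity_x E F G \<xi> + b2 (fst \<xi>) * velocity_y E F G \<xi>) *
      ((- a1 (fst \<xi>) - b1 (fst \<xi>)) * velocity_x E F G \<xi> + (- a2 (fst \<xi>) - b2
          (fst \<xi>)) * velocity_y E F G \<xi>)))"

text \<open>The prefactor of the cubic is nonzero and its logarithmic derivative is
  \<open>lx\<close>, \<open>ly\<close>, so the bracket is the polynomial \<open>T\<close> of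
  \<open>killing_iff\<close> up to a nonzero factor. The velocities run through the whole plane as
  the momenta do.\<close>

lemma killing_cubic_first_integral_iff:
  fixes E F G a1 a2 b1 b2 :: scalar_field
  assumes diff: "E differentiable (at z)" "F differentiable (at z)" "G differentiable (at z)"
      "a1 differentiable (at z)" "a2 differentiable (at z)" "b1 differentiable (at z)"
          "b2 differentiable (at z)"
    and det: "metric_det E F G z \<noteq> 0" and J: "a1 z * b2 z - a2 z * b1 z \<noteq> 0"
  shows "(\<forall>p q. poisson_bracket (killing_cubic E F G a1 a2 b1 b2) (geodesic_hamiltonian E F G) (z,
      (p, q)) = 0) \<longleftrightarrow>
      sym_cov_deriv E F G a1 a2 z (a2 z) (- a1 z) = 0 \<and> sym_cov_deriv E F G b1 b2 z (b2 z) (- b1 z) = 0 \<and>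
      sym_cov_deriv E F G a1 a2 z (a2 z + b2 z) (- (a1 z + b1 z))
        + sym_cov_deriv E F G b1 b2 z (a2 z + b2 z) (- (a1 z + b1 z)) = 0 \<and>
      dy a1 z = dx a2 z \<and> dy b1 z = dx b2 z"
proof -
  define D where "D z = E z * G z - F z * F z" for z
  define j where "j z = a1 z * b2 z - a2 z * b1 z" for z
  define f where "f z = D z / (j z * j z)" for z
  let ?X = "velocity_x E F G" and ?Y = "velocity_y E F G" and ?H = "geodesic_hamiltonian E F G"
  define A where "A = (\<lambda>\<xi>. a1 (fst \<xi>) * ?X \<xi> + a2 (fst \<xi>) * ?Y \<xi>)"
  define B where "B = (\<lambda>\<xi>. b1 (fst \<xi>) * ?X \<xi> + b2 (fst \<xi>) * ?Y \<xi>)"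
  define C where "C = (\<lambda>\<xi>. (- a1 (fst \<xi>) - b1 (fst \<xi>)) * ?X \<xi> + (- a2 (fst \<xi>) - b2 (fst \<xi>)) * ?Y \<xi>)"
  have D0: "D z \<noteq> 0" "j z \<noteq> 0" using det J by (simp_all add: D_def j_def metric_det_def power2_eq_square)
  have dD: "D differentiable (at z)" "j differentiable (at z)"
    unfolding D_def[abs_def] j_def[abs_def] by (intro differentiable_diff differentiable_mult diff)+
  have djj: "(\<lambda>z. j z * j z) differentiable (at z)" by (intro differentiable_mult dD)
  have df: "f differentiable (at z)"
    unfolding f_def[abs_def] using D0 by (intro differentiable_divide dD djj) auto
  have dc: "(\<lambda>z. - a1 z) differentiable (at z)" "(\<lambda>z. - a2 z) differentiable (at z)"
    using diff by (auto intro: differentiable_minus)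
  define lx where "lx = 2 * (christoffel_111 E F G z + christoffel_212 E F G z)
      - 2 * (dx a1 z * b2 z + a1 z * dx b2 z - dx a2 z * b1 z - a2 z * dx b1 z) / j z"
  define ly where "ly = 2 * (christoffel_112 E F G z + christoffel_222 E F G z)
      - 2 * (dy a1 z * b2 z + a1 z * dy b2 z - dy a2 z * b1 z - a2 z * dy b1 z) / j z"
  \<comment> \<open>The logarithmic derivative of the metric determinant is twice the trace of the
    Christoffel symbols.\<close>
  have Dx: "dx D z = D z * (2 * (christoffel_111 E F G z + christoffel_212 E F G z))"
    "dy D z = D z * (2 * (christoffel_112 E F G z + christoffel_222 E F G z))"
    unfolding D_def[abs_def] using D0(1)
    by (simp_all add: dx_dy_arith diff differentiable_mult christoffel_111_def christoffel_212_def
        christoffel_112_def christoffel_222_def metric_det_def power2_eq_square D_def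
            add_divide_distrib[symmetric])
      (simp_all add: field_simps)
  have jx: "dx j z = dx a1 z * b2 z + a1 z * dx b2 z - dx a2 z * b1 z - a2 z * dx b1 z"
    "dy j z = dy a1 z * b2 z + a1 z * dy b2 z - dy a2 z * b1 z - a2 z * dy b1 z"
    unfolding j_def[abs_def] by (simp_all add: dx_dy_arith diff differentiable_mult)
  have quot: "(D z * u * (j z * j z) - D z * (2 * (j z * v))) / (j z * j z * (j z * j z))
      = D z * (u - 2 * v / j z) / (j z * j z)" for u v
    using D0 by (simp add: field_simps)
  have fx: "dx f z = f z * lx" "dy f z = f z * ly"
    unfolding f_def[abs_def] lx_def ly_def
    using D0 by (simp_all add: dx_dy_arith dD djj Dx quot flip: jx)
  have base: "(\<lambda>\<xi>. h (fst \<xi>)) differentiable (at (z, (p, q)))" if "h differentiable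
      (at z)" for h :: scalar_field and p q
    using has_derivative_base[OF has_derivative_dx_dy[OF that]] by (rule differentiableI)
  note vel = velocity_has_derivative(1,2)[OF diff(1-3) det, THEN differentiableI]
  note dd = dx_dy_arith(3,4)[OF dc(1) diff(6)] dx_dy_arith(3,4)[OF dc(2) diff(7)]
  have dm: "dx (\<lambda>z. - h z) z = - dx h z" "dy (\<lambda>z. - h z) z = - dy h z" if "h differentiable
      (at z)" for h :: scalar_field
    using dx_dy_arith(3,4)[of "\<lambda>z. 0" z h] that by (simp_all add: dx_def dy_def)
  have dABC: "A differentiable (at (z, (p, q)))" "B differentiable (at (z, (p, q)))"
      "C differentiable (at (z, (p, q)))" for p q
    unfolding A_def B_def C_def
    by (intro differentiable_add differentiable_mult differentiable_diff differentiable_minus base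
        diff vel)+
  let ?Qa = "sym_cov_deriv E F G a1 a2 z" and ?Qb = "sym_cov_deriv E F G b1 b2 z"
  have pA: "poisson_bracket A ?H (z, (p, q)) = ?Qa (?X (z, (p, q))) (?Y (z, (p, q)))"
    and pB: "poisson_bracket B ?H (z, (p, q)) = ?Qb (?X (z, (p, q))) (?Y (z, (p, q)))" for p q
    unfolding A_def B_def by (intro poisson_bracket_linear diff det)+
  have pC: "poisson_bracket C ?H (z, (p, q)) = - ?Qa (?X (z, (p, q))) (?Y (z, (p, q))) - ?Qb (?X (z,
      (p, q))) (?Y (z, (p, q)))" for p q
  proof -
    have "poisson_bracket C ?H (z, (p, q)) = sym_cov_deriv E F G (\<lambda>z. - a1 z - b1 z)
        (\<lambda>z. - a2 z - b2 z) z (?X (z, (p, q))) (?Y (z, (p, q)))"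
      unfolding C_def by (rule poisson_bracket_linear[OF diff(1-3) det])
          (intro differentiable_diff dc diff)+
    also have "\<dots> = - ?Qa (?X (z, (p, q))) (?Y (z, (p, q))) - ?Qb (?X (z, (p, q))) (?Y (z, (p, q)))"
      by (simp add: sym_cov_deriv_def dd dm diff) (simp add: algebra_simps)
    finally show ?thesis .
  qed
  define T where "T X Y = ?Qa X Y * (b1 z * X + b2 z * Y) * (- (a1 z * X + a2 z * Y) - (b1 z * X
      + b2 z * Y))
      + (a1 z * X + a2 z * Y) * ?Qb X Y * (- (a1 z * X + a2 z * Y) - (b1 z * X + b2 z * Y))
      + (a1 z * X + a2 z * Y) * (b1 z * X + b2 z * Y) * (- ?Qa X Y - ?Qb X Y)
      + (a1 z * X + a2 z * Y) * (b1 z * X + b2 z * Y) * (- (a1 z * X + a2 z * Y) - (b1 z * X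
          + b2 z * Y)) * (lx * X + ly * Y)"
    for X Y
  have K: "killing_cubic E F G a1 a2 b1 b2 = (\<lambda>\<xi>. f (fst \<xi>) * (A \<xi> * B \<xi> * C \<xi>))"
    by (simp add: killing_cubic_def f_def A_def B_def C_def D_def j_def metric_det_def power2_eq_square)
  have C': "C (z, (p, q)) = - (a1 z * ?X (z, (p, q)) + a2 z * ?Y (z, (p, q))) - (b1 z * ?X (z,
      (p, q)) + b2 z * ?Y (z, (p, q)))" for p q
    by (simp add: C_def algebra_simps)
  have pb: "poisson_bracket (killing_cubic E F G a1 a2 b1 b2) ?H (z, (p, q)) = f z * T (?X (z,
      (p, q))) (?Y (z, (p, q)))" for p q
    unfolding K
    by (simp add: poisson_bracket_mult dABC base df pA pB pC differentiable_mult
        poisson_bracket_base[OF diff(1-3) det df] fx C' T_def)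
      (simp add: A_def B_def algebra_simps)
  \<comment> \<open>Lowering the index of \<open>(X, Y)\<close> with the metric gives the momenta
    with this velocity.\<close>
  have vel_surj: "\<exists>p q. ?X (z, (p, q)) = X \<and> ?Y (z, (p, q)) = Y" for X Y
  proof (intro exI conjI)
    show "?X (z, (E z * X + F z * Y, F z * X + G z * Y)) = X" "?Y (z, (E z * X + F z * Y, F z * X
        + G z * Y)) = Y"
      using det by (simp_all add: velocity_x_def velocity_y_def divide_eq_eq)
        (simp_all add: metric_det_def power2_eq_square algebra_simps)
  qed
  have "f z \<noteq> 0" using D0 by (simp add: f_def)
  then have "(\<forall>p q. poisson_bracket (killing_cubic E F G a1 a2 b1 b2) ?H (z, (p, q)) = 0) \<longleftrightarrow>
      (\<forall>X Y. T X Y = 0)"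
    unfolding pb using vel_surj by (metis mult_eq_0_iff)
  also have "\<dots> \<longleftrightarrow> ?Qa (a2 z) (- a1 z) = 0 \<and> ?Qb (b2 z) (- b1 z) = 0 \<and>
      ?Qa (a2 z + b2 z) (- (a1 z + b1 z)) + ?Qb (a2 z + b2 z) (- (a1 z + b1 z)) = 0 \<and>
      dy a1 z = dx a2 z \<and> dy b1 z = dx b2 z"
    unfolding T_def lx_def ly_def j_def sym_cov_deriv_def
    by (rule killing_iff[OF J])
  finally show ?thesis .
qed

section \<open>Roots of binary cubics\<close>

lemma span_pair_eq_iff:
  fixes p q p' q' :: real
  assumes "(p, q) \<noteq> (0, 0)" "(p', q') \<noteq> (0, 0)"
  shows "span {(p, q)} = span {(p', q')} \<longleftrightarrow> p * q' = q * p'"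
proof
  assume "span {(p, q)} = span {(p', q')}"
  then have "(p, q) \<in> span {(p', q')}" using span_base[of "(p, q)" "{(p, q)}"] by simp
  then obtain k where "(p, q) = k *\<^sub>R (p', q')" by (auto simp: span_singleton)
  then show "p * q' = q * p'" by simp
next
  have sub: "span {(p, q)} \<subseteq> span {(p', q')}" if "(p', q') \<noteq> (0, 0)" "p * q'
      = q * p'" for p q p' q' :: real
  proof (rule span_minimal)
    have n: "p' * p' + q' * q' \<noteq> 0" using that(1) by (auto simp: sum_squares_eq_zero_iff)
    define k where "k = (p * p' + q * q') / (p' * p' + q' * q')"
    have "p * (p' * p' + q' * q') = (p * p' + q * q') * p'" "q * (p' * p' + q' * q') = (p * p'
        + q * q') * q'"
      using that(2) by algebra+
    then have "(p, q) = k *\<^sub>R (p', q')" using n by (simp add: k_def eq_divide_eq)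
    then show "{(p, q)} \<subseteq> span {(p', q')}" by (auto simp: span_singleton)
  qed (rule subspace_span)
  assume "p * q' = q * p'"
  then show "span {(p, q)} = span {(p', q')}"
    using sub[OF assms(2), of p q] sub[OF assms(1), of p' q'] by (simp add: mult.commute)
qed

lemma card_real_roots_product:
  assumes "k \<noteq> 0" "l1 * m2 - l2 * m1 \<noteq> 0" "l1 * n2 - l2 * n1 \<noteq> 0" "m1 * n2 - m2 * n1 \<noteq> (0::real)"
    and I: "\<And>p q. I (z, (p, q)) = k * ((l1 * p + l2 * q) * (m1 * p + m2 * q) * (n1 * p + n2 * q))"
  shows "card (real_roots_at I z) = 3"
proof -
  have nz: "(- l2, l1) \<noteq> (0, 0)" "(- m2, m1) \<noteq> (0, 0)" "(- n2, n1) \<noteq> (0, 0)"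
    using assms(2-4) by auto
  have root: "span {(p, q)} = span {(- l2, l1)}" if "l1 * p + l2 * q = 0" "(p, q) \<noteq> (0, 0)"
      "(- l2, l1) \<noteq> (0, 0)"
    for p q l1 l2 :: real
    unfolding span_pair_eq_iff[OF that(2,3)] using that(1) by (simp add: algebra_simps add_eq_0_iff)
  have "real_roots_at I z = {span {(- l2, l1)}, span {(- m2, m1)}, span {(- n2, n1)}}"
  proof
    show "real_roots_at I z \<subseteq> {span {(- l2, l1)}, span {(- m2, m1)}, span {(- n2, n1)}}"
      using assms(1) nz root by (fastforce simp: real_roots_at_def I)
    have "I (z, (- l2, l1)) = 0" "I (z, (- m2, m1)) = 0" "I (z, (- n2, n1)) = 0"
      by (simp_all add: I)
    then show "{span {(- l2, l1)}, span {(- m2, m1)}, span {(- n2, n1)}} \<subseteq> real_roots_at I z"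
      using nz unfolding real_roots_at_def by blast
  qed
  moreover have "span {(- l2, l1)} \<noteq> span {(- m2, m1)}" "span {(- l2, l1)} \<noteq> span {(- n2, n1)}"
    "span {(- m2, m1)} \<noteq> span {(- n2, n1)}"
    unfolding span_pair_eq_iff[OF nz(1,2)] span_pair_eq_iff[OF nz(1,3)] span_pair_eq_iff[OF nz(2,3)]
    using assms(2-4) by (auto simp: algebra_simps)
  ultimately show ?thesis by simp
qed

lemma three_root_vectors:
  assumes "card (real_roots_at I z) = 3"
  obtains p1 q1 p2 q2 p3 q3 where "p1 * q2 - q1 * p2 \<noteq> 0" "p1 * q3 - q1 * p3 \<noteq> 0" "p2 * q3 - q2 * p3 \<noteq> 0"
    "I (z, (p1, q1)) = 0" "I (z, (p2, q2)) = 0" "I (z, (p3, q3)) = 0"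
proof -
  obtain S1 S2 S3 where S: "real_roots_at I z = {S1, S2, S3}" "S1 \<noteq> S2" "S2 \<noteq> S3" "S1 \<noteq> S3"
    using assms card_3_iff by metis
  have ex: "\<exists>p q. (p, q) \<noteq> (0, 0) \<and> I (z, (p, q)) = 0 \<and> S = span {(p, q)}" if
      "S \<in> real_roots_at I z" for S
    using that by (auto simp: real_roots_at_def)
  obtain p1 q1 where 1: "(p1, q1) \<noteq> (0, 0)" "I (z, (p1, q1)) = 0" "S1 = span {(p1, q1)}"
    using ex[of S1] S by auto
  obtain p2 q2 where 2: "(p2, q2) \<noteq> (0, 0)" "I (z, (p2, q2)) = 0" "S2 = span {(p2, q2)}"
    using ex[of S2] S by auto
  obtain p3 q3 where 3: "(p3, q3) \<noteq> (0, 0)" "I (z, (p3, q3)) = 0" "S3 = span {(p3, q3)}"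
    using ex[of S3] S by auto
  have "p1 * q2 \<noteq> q1 * p2" "p2 * q3 \<noteq> q2 * p3" "p1 * q3 \<noteq> q1 * p3"
    using S(2-4) unfolding 1(3) 2(3) 3(3) span_pair_eq_iff[OF 1(1) 2(1)] span_pair_eq_iff[OF 2(1) 3(1)]
      span_pair_eq_iff[OF 1(1) 3(1)] by auto
  then show ?thesis using that[of p1 q2 q1 p2 q3 p3] 1(2) 2(2) 3(2) by simp
qed

text \<open>A form vanishing identically would have every direction \<open>[1 : t]\<close> as a
  root, and an infinite set of roots has \<open>card\<close> equal to 0.\<close>

lemma finite_roots_imp_nonzero:
  assumes "card (real_roots_at I z) = 3"
  obtains p q where "I (z, (p, q)) \<noteq> 0"
proof (rule ccontr)
  assume "\<not> thesis"
  then have "I (z, (p, q)) = 0" for p q using that by blast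
  then have "span {(1, t)} \<in> real_roots_at I z" for t
    unfolding real_roots_at_def by (intro CollectI exI[of _ 1] exI[of _ t]) simp
  then have "range (\<lambda>t::real. span {(1::real, t)}) \<subseteq> real_roots_at I z" by blast
  moreover have "inj (\<lambda>t::real. span {(1::real, t)})"
    by (rule injI) (subst (asm) span_pair_eq_iff, auto)
  then have "infinite (range (\<lambda>t::real. span {(1::real, t)}))"
    using finite_imageD infinite_UNIV_char_0 by blast
  ultimately have "infinite (real_roots_at I z)" using finite_subset by blast
  then show False using assms by simp
qed

text \<open>In the basis formed by two of its roots a binary cubic is \<open>S * T\<close> times a
  linear form in \<open>S\<close> and \<open>T\<close>. Two further roots annihilate this linear
  form.\<close>

lemma cubic_form_zero:
  fixes a b c d :: real
  defines "h \<equiv> (\<lambda>p q. a * p^3 + b * p^2 * q + c * p * q^2 + d * q^3)"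
  assumes "h p1 q1 = 0" "h p2 q2 = 0" "h p3 q3 = 0" "h p4 q4 = 0"
    and "p1 * q2 - q1 * p2 \<noteq> 0" "p1 * q3 - q1 * p3 \<noteq> 0" "p2 * q3 - q2 * p3 \<noteq> 0"
    "p1 * q4 - q1 * p4 \<noteq> 0" "p2 * q4 - q2 * p4 \<noteq> 0" "p3 * q4 - q3 * p4 \<noteq> 0"
  shows "h p q = 0"
proof -
  define w where "w = p1 * q2 - q1 * p2"
  \<comment> \<open>The coefficients \<open>c1\<close>, \<open>c2\<close> are three times the
    symmetric trilinear form of \<open>h\<close> with the first vector inserted twice and once.
    \<open>S\<close> and \<open>T\<close> are \<open>w\<close> times the coordinates in the basis of
    the first two vectors.\<close>
  define c1 where "c1 = 3 * a * p1^2 * p2 + b * (p1^2 * q2 + 2 * p1 * p2 * q1)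
      + c * (p2 * q1^2 + 2 * p1 * q1 * q2) + 3 * d * q1^2 * q2"
  define c2 where "c2 = 3 * a * p1 * p2^2 + b * (p2^2 * q1 + 2 * p1 * p2 * q2)
      + c * (p1 * q2^2 + 2 * p2 * q1 * q2) + 3 * d * q1 * q2^2"
  define S T where "S = (\<lambda>p q. p * q2 - q * p2)" and "T = (\<lambda>p q. p1 * q - q1 * p)"
  have expand: "w^3 * h p q = S p q * T p q * (c1 * S p q + c2 * T p q)" for p q
  proof -
    have "w^3 * h p q = S p q^3 * h p1 q1 + S p q^2 * T p q * c1 + S p q * T p q^2 * c2
        + T p q^3 * h p2 q2"
      unfolding h_def w_def c1_def c2_def S_def T_def by algebra
    then show ?thesis using assms(2,3) by (simp add: algebra_simps power2_eq_square)
  qed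
  have w: "w \<noteq> 0" using assms(6) by (simp add: w_def)
  have ST: "S p3 q3 \<noteq> 0" "T p3 q3 \<noteq> 0" "S p4 q4 \<noteq> 0" "T p4 q4 \<noteq> 0"
    using assms(7-10) by (auto simp: S_def T_def algebra_simps)
  have "c1 * S p3 q3 + c2 * T p3 q3 = 0" "c1 * S p4 q4 + c2 * T p4 q4 = 0"
    using expand[of p3 q3] expand[of p4 q4] assms(4,5) ST by auto
  moreover have "S p3 q3 * T p4 q4 - S p4 q4 * T p3 q3 = w * (p3 * q4 - q3 * p4)"
    unfolding S_def T_def w_def by algebra
  ultimately have "c1 * (w * (p3 * q4 - q3 * p4)) = 0" "c2 * (w * (p3 * q4 - q3 * p4)) = 0"
    by algebra+
  then have "c1 = 0" "c2 = 0" using w assms(11) by auto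
  then show ?thesis using expand[of p q] w by simp
qed

text \<open>The product of the three linear factors, scaled to agree with \<open>h\<close> in a
  fourth direction \<open>(ep, eq)\<close>, differs from \<open>h\<close> by a cubic with four
  roots, which is zero by \<open>cubic_form_zero\<close>.\<close>

lemma cubic_form_factor:
  fixes a b c d :: real
  defines "h \<equiv> (\<lambda>p q. a * p^3 + b * p^2 * q + c * p * q^2 + d * q^3)"
  defines "L \<equiv> (\<lambda>p1 q1 p q. p1 * q - q1 * p)"
  assumes zero: "h p1 q1 = 0" "h p2 q2 = 0" "h p3 q3 = 0"
    and indep: "p1 * q2 - q1 * p2 \<noteq> 0" "p1 * q3 - q1 * p3 \<noteq> 0" "p2 * q3 - q2 * p3 \<noteq> 0"
    and e: "L p1 q1 ep eq \<noteq> 0" "L p2 q2 ep eq \<noteq> 0" "L p3 q3 ep eq \<noteq> 0"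
  shows "h p q = h ep eq / (L p1 q1 ep eq * L p2 q2 ep eq * L p3 q3 ep eq)
      * (L p1 q1 p q * L p2 q2 p q * L p3 q3 p q)"
proof -
  define k where "k = h ep eq / (L p1 q1 ep eq * L p2 q2 ep eq * L p3 q3 ep eq)"
  define a' b' c' d' where "a' = a + k * (q1 * q2 * q3)" and "b' = b - k * (p1 * q2 * q3
      + q1 * p2 * q3 + q1 * q2 * p3)"
    and "c' = c + k * (p1 * p2 * q3 + p1 * q2 * p3 + q1 * p2 * p3)" and "d' = d - k * (p1 * p2 * p3)"
  have h': "a' * p^3 + b' * p^2 * q + c' * p * q^2 + d' * q^3 = h p q - k *
      (L p1 q1 p q * L p2 q2 p q * L p3 q3 p q)" for p q
    unfolding a'_def b'_def c'_def d'_def h_def L_def by algebra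
  have "a' * p^3 + b' * p^2 * q + c' * p * q^2 + d' * q^3 = 0"
  proof (rule cubic_form_zero[of a' p1 b' q1 c' d' p2 q2 p3 q3 ep eq])
    show "a' * p1^3 + b' * p1^2 * q1 + c' * p1 * q1^2 + d' * q1^3 = 0"
      "a' * p2^3 + b' * p2^2 * q2 + c' * p2 * q2^2 + d' * q2^3 = 0"
      "a' * p3^3 + b' * p3^2 * q3 + c' * p3 * q3^2 + d' * q3^3 = 0"
      unfolding h' using zero by (simp_all add: L_def)
    show "a' * ep^3 + b' * ep^2 * eq + c' * ep * eq^2 + d' * eq^3 = 0"
      unfolding h' k_def using e by simp
  qed (use indep e in \<open>auto simp: L_def\<close>)
  then show ?thesis unfolding h' k_def by simp
qed

lemma cubic_form_nonzero_imp_not_parallel: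
  fixes a b c d :: real
  defines "h \<equiv> (\<lambda>p q. a * p^3 + b * p^2 * q + c * p * q^2 + d * q^3)"
  assumes "h p1 q1 = 0" "h ep eq \<noteq> 0" "(p1, q1) \<noteq> (0, 0)"
  shows "p1 * eq - q1 * ep \<noteq> 0"
proof
  assume z: "p1 * eq - q1 * ep = 0"
  define n where "n = p1 * p1 + q1 * q1"
  define k where "k = ep * p1 + eq * q1"
  have n: "n \<noteq> 0" using assms(4) by (auto simp: n_def sum_squares_eq_zero_iff)
  have "n * ep = k * p1" "n * eq = k * q1" using z unfolding n_def k_def by algebra+
  then have "n^3 * h ep eq = k^3 * h p1 q1"
    unfolding h_def by algebra
  then show False using n assms(2,3) by simp
qed

section \<open>Smooth dependence of simple roots on the base point\<close>

lemma smooth_on_base: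
  fixes U :: "'a::euclidean_space set"
  assumes "open U" "smooth_on U f"
  shows "smooth_on (U \<times> UNIV) (\<lambda>\<xi>. f (fst \<xi>))"
  by (rule smooth_on_compose[where T = U and g = fst and f = f])
    (use assms in \<open>auto intro: open_Times smooth_on_bounded_linear bounded_linear_fst\<close>)

text \<open>Independence of the first root from the two others makes it simple, so the implicit
  function theorem continues it to nearby points.\<close>

lemma smooth_root:
  fixes a b c d :: scalar_field
  defines "h \<equiv> (\<lambda>z p q. a z * p^3 + b z * p^2 * q + c z * p * q^2 + d z * q^3)"
  assumes U: "open U" "z0 \<in> U" and abcd: "smooth_on U a" "smooth_on U b" "smooth_on U c" "smooth_on U d"
    and factor: "\<And>p q. h z0 p q = k * ((p1 * q - q1 * p) * (p2 * q - q2 * p) * (p3 * q - q3 * p))"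
    and k: "k \<noteq> 0" and indep: "p1 * q2 - q1 * p2 \<noteq> 0" "p1 * q3 - q1 * p3 \<noteq> 0"
  obtains W P Q where "open W" "z0 \<in> W" "W \<subseteq> U" "smooth_on W P" "smooth_on W Q" "P z0 = p1" "Q z0 = q1"
    "\<And>z. z \<in> W \<Longrightarrow> h z (P z) (Q z) = 0"
proof -
  \<comment> \<open>Directions near \<open>[p1 : q1]\<close> are reached by adding a multiple of the
    orthogonal vector \<open>(- q1, p1)\<close>. This avoids a case distinction on which homogeneous
    coordinate is nonzero.\<close>
  define H where "H \<zeta> = h (fst \<zeta>) (p1 - snd \<zeta> * q1) (q1 + snd \<zeta> * p1)" for \<zeta> :: "point \<times> real"
  have oU: "open (U \<times> (UNIV::real set))" using U by (simp add: open_Times)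
  have H: "smooth_on (U \<times> UNIV) H"
    unfolding H_def h_def by (intro smooth_intros smooth_on_base oU U abcd)
  have "((\<lambda>r. k * (r * (p1 * p1 + q1 * q1) * ((p2 * q1 - q2 * p1) + r * (p2 * p1 + q2 * q1))
      * ((p3 * q1 - q3 * p1) + r * (p3 * p1 + q3 * q1)))) has_real_derivative
      k * ((p1 * p1 + q1 * q1) * (p2 * q1 - q2 * p1) * (p3 * q1 - q3 * p1))) (at 0)"
    by (rule derivative_eq_intros refl)+ simp
  moreover have "H (z0, r) = k * (r * (p1 * p1 + q1 * q1) * ((p2 * q1 - q2 * p1) + r * (p2 * p1
      + q2 * q1))
      * ((p3 * q1 - q3 * p1) + r * (p3 * p1 + q3 * q1)))" for r
    unfolding H_def fst_conv snd_conv factor by algebra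
  ultimately have d1: "((\<lambda>r. H (z0, r)) has_real_derivative
      k * ((p1 * p1 + q1 * q1) * (p2 * q1 - q2 * p1) * (p3 * q1 - q3 * p1))) (at 0)"
    by simp
  have "((\<lambda>r::real. (z0, r)) has_derivative (\<lambda>r. (0, r))) (at 0)"
    by (auto intro!: derivative_intros)
  from has_derivative_compose[OF this, of H "frechet_derivative H (at (z0, 0))"]
  have "((\<lambda>r. H (z0, r)) has_derivative (\<lambda>r. frechet_derivative H (at (z0, 0)) (0, r))) (at 0)"
    using smooth_on_has_derivative[OF H, of "(z0, 0)"] U by simp
  from has_derivative_unique[OF this d1[unfolded has_field_derivative_def]]
  have "frechet_derivative H (at (z0, 0)) (0, 1) = k * ((p1 * p1 + q1 * q1) * (p2 * q1 - q2 * p1) *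
      (p3 * q1 - q3 * p1))"
    by (rule fun_cong[where x = 1, THEN trans]) simp
  moreover have "p1 * p1 + q1 * q1 \<noteq> 0" using indep(1) by (auto simp: sum_squares_eq_zero_iff)
  moreover have "p2 * q1 - q2 * p1 \<noteq> 0" "p3 * q1 - q3 * p1 \<noteq> 0"
    using indep by (auto simp: mult.commute)
  ultimately have Hr: "frechet_derivative H (at (z0, 0)) (0, 1) \<noteq> 0"
    using k by simp
  have H0: "H (z0, 0) = 0" unfolding H_def fst_conv snd_conv factor by simp
  obtain W r where W: "open W" "z0 \<in> W" "W \<subseteq> U" and r: "smooth_on W r" "r z0 = 0"
      and Hr0: "\<And>z. z \<in> W \<Longrightarrow> H (z, r z) = 0"
    by (rule smooth_implicit_function[OF U H H0 Hr], rule that)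
  show ?thesis
  proof (rule that[OF W, of "\<lambda>z. p1 - r z * q1" "\<lambda>z. q1 + r z * p1"])
    show "smooth_on W (\<lambda>z. p1 - r z * q1)" "smooth_on W (\<lambda>z. q1 + r z * p1)"
      by (intro smooth_intros W r)+
    show "h z (p1 - r z * q1) (q1 + r z * p1) = 0" if "z \<in> W" for z
      using Hr0[OF that] by (simp add: H_def)
  qed (use r in simp_all)
qed

section \<open>Geodesics along level curves\<close>

lemma smooth_on_deriv:
  fixes f :: "real \<Rightarrow> real"
  assumes "open I" "smooth_on I f"
  shows "smooth_on I (deriv f)" "t \<in> I \<Longrightarrow> (f has_real_derivative deriv f t) (at t)"
proof -
  have D: "(f has_real_derivative frechet_derivative f (at t) 1) (at t)" if "t \<in> I" for t
  proof -
    have d: "(f has_derivative frechet_derivative f (at t)) (at t)"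
      using assms(2) that by (rule smooth_on_has_derivative)
    have "frechet_derivative f (at t) h = frechet_derivative f (at t) 1 * h" for h
      using linear_scale[OF has_derivative_linear[OF d], of h 1] by simp
    then have "frechet_derivative f (at t) = (*) (frechet_derivative f (at t) 1)" by (rule ext)
    with d show ?thesis by (simp add: has_field_derivative_def)
  qed
  then have eq: "deriv f t = frechet_derivative f (at t) 1" if "t \<in> I" for t
    using that by (simp add: DERIV_imp_deriv)
  show "t \<in> I \<Longrightarrow> (f has_real_derivative deriv f t) (at t)" using D eq by simp
  show "smooth_on I (deriv f)"
    using smooth_on_frechet_derivative[OF assms(2), of 1] smooth_on_cong[OF assms(1) eq] by simp
qed

text \<open>The interval may be unbounded, so the antiderivative is the oriented integral from an
  interior base point \<open>s0\<close>, and the fundamental theorem is applied on compact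
  subintervals.\<close>

lemma smooth_on_real_antiderivative:
  fixes I :: "real set" and k :: "real \<Rightarrow> real"
  assumes I: "open I" "connected I" and k: "smooth_on I k"
  obtains K where "smooth_on I K" "\<And>t. t \<in> I \<Longrightarrow> (K has_real_derivative k t) (at t)"
proof (cases "I = {}")
  case True
  then show ?thesis using that[of k] k by simp
next
  case False
  then obtain s0 where s0: "s0 \<in> I" by blast
  define K where "K u = (LBINT y=ereal s0..ereal u. k y)" for u
  have K: "(K has_real_derivative k t) (at t)" if t: "t \<in> I" for t
  proof -
    have in_I: "min s0 t \<in> I" "max s0 t \<in> I" using s0 t by (auto simp: min_def max_def)
    obtain d1 d2 where d: "d1 > 0" "ball (min s0 t) d1 \<subseteq> I" "d2 > 0" "ball (max s0 t) d2 \<subseteq> I"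
      using I(1) in_I open_contains_ball by metis
    define a b where "a = min s0 t - d1 / 2" and "b = max s0 t + d2 / 2"
    have "a \<in> I" "b \<in> I" using d by (auto simp: a_def b_def dist_real_def subset_iff)
    then have ab: "{a..b} \<subseteq> I" using I(2) connected_contains_Icc by blast
    have "continuous_on {a..b} k" using smooth_on_imp_continuous_on[OF k] ab continuous_on_subset
        by blast
    then have "(K has_vector_derivative k t) (at t within {a..b})"
      unfolding K_def using d by (intro interval_integral_FTC2) (auto simp: a_def b_def)
    moreover have "at t within {a..b} = at t"
      using d by (intro at_within_Icc_at) (auto simp: a_def b_def)
    ultimately show ?thesis by (simp add: has_real_derivative_iff_has_vector_derivative)
  qed
  have "smooth_on I K"
  proof (rule smooth_onI_bootstrap[OF I(1)])
    show "(K has_derivative (\<lambda>v. k t * v)) (at t)" if "t \<in> I" for t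
      using K[OF that] by (simp add: has_field_derivative_def)
    fix n v
    have "smooth_on I (\<lambda>t. k t * v)" by (intro smooth_intros I k)
    then show "higher_differentiable_on I (\<lambda>t. k t * v) n" by (simp add: smooth_on_def)
  qed
  then show ?thesis using that K by blast
qed

text \<open>A positive derivative makes \<open>\<tau>\<close> strictly increasing, so there is one
  global inverse. It agrees with the local inverses of the inverse function theorem and is therefore
  differentiable; smoothness follows from its differential equation.\<close>

lemma smooth_real_inverse:
  fixes I :: "real set" and \<tau> \<tau>' :: "real \<Rightarrow> real"
  assumes I: "open I" "connected I" and \<tau>: "smooth_on I \<tau>"
    and der: "\<And>t. t \<in> I \<Longrightarrow> (\<tau> has_real_derivative \<tau>' t) (at t)" and pos: "\<And>t. t \<in> I \<Longrightarrow> \<tau>' t > 0"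
    and \<tau>': "smooth_on I \<tau>'"
  obtains \<rho> where "open (\<tau> ` I)" "connected (\<tau> ` I)" "\<rho> ` (\<tau> ` I) = I" "smooth_on (\<tau> ` I) \<rho>"
    "\<And>y. y \<in> \<tau> ` I \<Longrightarrow> (\<rho> has_real_derivative 1 / \<tau>' (\<rho> y)) (at y)"
proof -
  have less: "\<tau> s < \<tau> t" if "s \<in> I" "t \<in> I" "s < t" for s t
  proof (rule DERIV_pos_imp_increasing[OF that(3)])
    fix r assume "s \<le> r" "r \<le> t"
    then have "r \<in> I" using connected_contains_Icc[OF I(2) that(1,2)] by auto
    then show "\<exists>y. DERIV \<tau> r :> y \<and> y > 0" using der pos by blast
  qed
  have inj: "inj_on \<tau> I"
    by (rule inj_onI) (metis less linorder_neq_iff)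
  define \<rho> where "\<rho> = the_inv_into I \<tau>"
  have \<rho>: "\<rho> (\<tau> t) = t" if "t \<in> I" for t using the_inv_into_f_f[OF inj that] by (simp add: \<rho>_def)
  have loc: "\<exists>V. open V \<and> \<tau> t \<in> V \<and> V \<subseteq> \<tau> ` I \<and> \<rho> differentiable (at (\<tau> t))" if t: "t \<in> I" for t
  proof -
    have "frechet_derivative \<tau> (at t) = (*) (\<tau>' t)"
      using der[OF t] by (simp add: has_field_derivative_def frechet_derivative_at[symmetric])
    then have "inj (frechet_derivative \<tau> (at t))" using pos[OF t] by (auto intro: injI)
    then obtain U' V g where U': "open U'" "U' \<subseteq> I" "t \<in> U'" "open V" "\<tau> t \<in> V" "homeomorphism U' V \<tau> g"
      and dg: "\<And>y. y \<in> V \<Longrightarrow> g differentiable (at y)"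
      using smooth_local_inverse[OF I(1) t \<tau>] by metis
    have "V = \<tau> ` U'" using U'(6) by (simp add: homeomorphism_def)
    then have "V \<subseteq> \<tau> ` I" using U'(2) by blast
    moreover have "\<rho> y = g y" if "y \<in> V" for y
    proof -
      have "g y \<in> I" "\<tau> (g y) = y" using U'(2,6) that by (auto simp: homeomorphism_def)
      then show ?thesis using \<rho> by metis
    qed
    then have "\<rho> differentiable (at (\<tau> t))"
      using differentiable_cong_open[OF U'(4,5), of \<rho> g] dg[OF U'(5)] by simp
    ultimately show ?thesis using U' by blast
  qed
  have oJ: "open (\<tau> ` I)"
  proof (rule open_subopen[THEN iffD2], rule ballI)
    fix y assume "y \<in> \<tau> ` I"
    then obtain t where "t \<in> I" "y = \<tau> t" by blast
    then show "\<exists>V. open V \<and> y \<in> V \<and> V \<subseteq> \<tau> ` I" using loc[of t] by metis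
  qed
  have im: "\<rho> ` (\<tau> ` I) = I" using \<rho> by (force simp: image_image)
  have d\<rho>: "(\<rho> has_real_derivative 1 / \<tau>' (\<rho> y)) (at y)" if y: "y \<in> \<tau> ` I" for y
  proof -
    obtain t where t: "t \<in> I" "y = \<tau> t" using y by blast
    have "\<rho> differentiable (at y)" using loc[OF t(1)] t(2) by blast
    then obtain d where d: "(\<rho> has_real_derivative d) (at y)" by (auto simp: real_differentiable_def)
    then have "((\<lambda>s. \<rho> (\<tau> s)) has_real_derivative d * \<tau>' t) (at t)"
      using DERIV_chain2[of \<rho> d \<tau> t "\<tau>' t" UNIV] der[OF t(1)] t(2) by simp
    moreover have "((\<lambda>s. \<rho> (\<tau> s)) has_real_derivative 1) (at t)"
      by (rule has_field_derivative_transform_within_open[OF DERIV_ident I(1) t(1)]) (simp add: \<rho>)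
    ultimately have "d * \<tau>' t = 1" by (rule DERIV_unique)
    then have "d = 1 / \<tau>' (\<rho> y)" using pos[OF t(1)] \<rho>[OF t(1)] t(2) by (simp add: field_simps)
    with d show ?thesis by simp
  qed
  have "smooth_on (\<tau> ` I) \<rho>"
  proof (rule smooth_on_ode[OF oJ I(1)])
    show "\<rho> ` \<tau> ` I \<subseteq> I" using im by simp
    show "(\<rho> has_derivative (\<lambda>v. 1 / \<tau>' (\<rho> y) * v)) (at y)" if "y \<in> \<tau> ` I" for y
      using d\<rho>[OF that] unfolding has_field_derivative_def .
    show "smooth_on I (\<lambda>t. 1 / \<tau>' t * v)" for v
      by (intro smooth_intros I \<tau>') (use pos in force)
  qed
  moreover have "connected (\<tau> ` I)"
    by (intro connected_continuous_image smooth_on_imp_continuous_on \<tau> I)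
  ultimately show ?thesis using that oJ im d\<rho> by blast
qed

text \<open>Differentiating \<open>f (x s, y s) = c\<close> once and twice. The second derivative
  splits into the differential of \<open>f\<close> on the covariant acceleration and the covariant
  Hessian of \<open>f\<close> on the velocity; the Christoffel terms added on the two sides
  cancel.\<close>

lemma constant_along_curve:
  assumes U: "open U" "smooth_on U f" and J: "open J" "t \<in> J"
    and x: "\<And>s. s \<in> J \<Longrightarrow> (x has_real_derivative x1 s) (at s)" and y: "\<And>s. s \<in> J \<Longrightarrow> (y
        has_real_derivative y1 s) (at s)"
    and x1: "(x1 has_real_derivative x2) (at t)" and y1: "(y1 has_real_derivative y2) (at t)"
    and in_U: "\<And>s. s \<in> J \<Longrightarrow> (x s, y s) \<in> U" and const: "\<And>s. s \<in> J \<Longrightarrow> f (x s, y s) = c"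
  shows "dx f (x t, y t) * x1 t + dy f (x t, y t) * y1 t = 0"
    and "dx f (x t, y t) * (x2 + christoffel_111 E F G (x t, y t) * x1 t^2
        + 2 * christoffel_112 E F G (x t, y t) * x1 t * y1 t + christoffel_122 E F G (x t, y t) * y1 t^2)
      + dy f (x t, y t) * (y2 + christoffel_211 E F G (x t, y t) * x1 t^2
        + 2 * christoffel_212 E F G (x t, y t) * x1 t * y1 t + christoffel_222 E F G (x t, y t) * y1 t^2)
      = - sym_cov_deriv E F G (dx f) (dy f) (x t, y t) (x1 t) (y1 t)" (is ?G1)
proof -
  have chain: "((\<lambda>s. h (x s, y s)) has_real_derivative dx h (x s, y s) * x1 s + dy h
      (x s, y s) * y1 s) (at s)"
    if "smooth_on U h" "s \<in> J" for h s
  proof -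
    have d: "(h has_derivative (\<lambda>v. dx h (x s, y s) * fst v + dy h (x s, y s) * snd v)) (at (x s, y s))"
      using that in_U by (intro has_derivative_dx_dy smooth_on_imp_differentiable) auto
    show ?thesis unfolding has_field_derivative_def
      by (rule has_derivative_eq_rhs[OF has_derivative_compose[OF has_derivative_Pair[OF
              x[OF that(2), unfolded has_field_derivative_def]
                  y[OF that(2), unfolded has_field_derivative_def]] d]])
        (simp add: fun_eq_iff algebra_simps)
  qed
  have zero: "dx f (x s, y s) * x1 s + dy f (x s, y s) * y1 s = 0" if "s \<in> J" for s
  proof -
    have "((\<lambda>s. f (x s, y s)) has_real_derivative 0) (at s)"
      by (rule has_field_derivative_transform_within_open[OF DERIV_const J(1) that]) (simp add: const)
    then show ?thesis using chain[OF U(2) that] DERIV_unique by blast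
  qed
  then show "dx f (x t, y t) * x1 t + dy f (x t, y t) * y1 t = 0" using J by blast
  have "((\<lambda>s. dx f (x s, y s) * x1 s + dy f (x s, y s) * y1 s) has_real_derivative 0) (at t)"
    by (rule has_field_derivative_transform_within_open[OF DERIV_const J]) (simp add: zero)
  moreover have "((\<lambda>s. dx f (x s, y s) * x1 s + dy f (x s, y s) * y1 s) has_real_derivative
      (dx (dx f) (x t, y t) * x1 t + dy (dx f) (x t, y t) * y1 t) * x1 t + x2 * dx f (x t, y t)
      + ((dx (dy f) (x t, y t) * x1 t + dy (dy f) (x t, y t) * y1 t) * y1 t + y2 * dy f (x t, y t)))
          (at t)"
    by (rule DERIV_add[OF DERIV_mult[OF chain[OF smooth_on_dx[OF U(2)] J(2)] x1]
          DERIV_mult[OF chain[OF smooth_on_dy[OF U(2)] J(2)] y1]])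
  ultimately have "(dx (dx f) (x t, y t) * x1 t + dy (dx f) (x t, y t) * y1 t) * x1 t + x2 * dx f
      (x t, y t)
      + ((dx (dy f) (x t, y t) * x1 t + dy (dy f) (x t, y t) * y1 t) * y1 t + y2 * dy f (x t, y t)) = 0"
    using DERIV_unique by blast
  then show ?G1
    unfolding sym_cov_deriv_def by algebra
qed

lemma sym_cov_deriv_scale: "sym_cov_deriv E F G a b z (l * X) (l * Y)
    = l^2 * sym_cov_deriv E F G a b z X Y"
  by (simp add: sym_cov_deriv_def algebra_simps power2_eq_square)

lemma kernel_parallel:
  fixes a b X Y :: real
  assumes "a * X + b * Y = 0" "(a, b) \<noteq> (0, 0)"
  obtains l where "X = l * b" "Y = l * - a"
proof -
  have n: "a * a + b * b \<noteq> 0" using assms(2) by (auto simp: sum_squares_eq_zero_iff)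
  have "X * (a * a + b * b) = (X * b - Y * a) * b" "Y * (a * a + b * b) = (X * b - Y * a) * - a"
    using assms(1) by algebra+
  then show ?thesis using that[of "(X * b - Y * a) / (a * a + b * b)"] n by (simp add: field_simps)
qed

lemma smooth_on_christoffel:
  assumes "open U" "smooth_on U E" "smooth_on U F" "smooth_on U G" "\<forall>z\<in>U. metric_det E F G z \<noteq> 0"
  shows "smooth_on U (christoffel_111 E F G)" "smooth_on U (christoffel_112 E F G)" "smooth_on U
      (christoffel_122 E F G)"
    "smooth_on U (christoffel_211 E F G)" "smooth_on U (christoffel_212 E F G)" "smooth_on U
        (christoffel_222 E F G)"
proof -
  have "smooth_on U (metric_det E F G)"
    unfolding metric_det_def[abs_def] by (intro smooth_intros assms)
  then show "smooth_on U (christoffel_111 E F G)" "smooth_on U (christoffel_112 E F G)" "smooth_on U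
      (christoffel_122 E F G)"
    "smooth_on U (christoffel_211 E F G)" "smooth_on U (christoffel_212 E F G)" "smooth_on U
        (christoffel_222 E F G)"
    unfolding christoffel_111_def[abs_def] christoffel_112_def[abs_def] christoffel_122_def[abs_def]
      christoffel_211_def[abs_def] christoffel_212_def[abs_def] christoffel_222_def[abs_def]
    by (intro smooth_intros smooth_on_dx smooth_on_dy assms; use assms(5) in simp)+
qed

text \<open>The condition on \<open>f\<close> forces the covariant acceleration of a level curve
  into the kernel of the differential of \<open>f\<close>, that is, to be a multiple
  \<open>k\<close> of the velocity. A change of parameter removes this tangential
  acceleration.\<close>

lemma unparametrized_geodesicI:
  fixes I :: "real set" and x y :: "real \<Rightarrow> real"
  assumes U: "open U" and EFG: "smooth_on U E" "smooth_on U F" "smooth_on U G"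
    and det: "\<forall>z\<in>U. metric_det E F G z \<noteq> 0"
    and f: "smooth_on U f" "\<And>z. z \<in> U \<Longrightarrow> (dx f z, dy f z) \<noteq> (0, 0)"
    and cov: "\<And>z. z \<in> U \<Longrightarrow> sym_cov_deriv E F G (dx f) (dy f) z (dy f z) (- dx f z) = 0"
    and I: "open I" "connected I" "I \<noteq> {}" and xy: "smooth_on I x" "smooth_on I y"
    and in_U: "\<And>s. s \<in> I \<Longrightarrow> (x s, y s) \<in> U" and const: "\<And>s. s \<in> I \<Longrightarrow> f (x s, y s) = c"
    and regular: "\<And>s. s \<in> I \<Longrightarrow> (deriv x s, deriv y s) \<noteq> (0, 0)"
  shows "unparametrized_geodesic E F G ((\<lambda>s. (x s, y s)) ` I)"
proof -
  note x1 = smooth_on_deriv[OF I(1) xy(1)] and y1 = smooth_on_deriv[OF I(1) xy(2)]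
  note x2 = smooth_on_deriv[OF I(1) x1(1)] and y2 = smooth_on_deriv[OF I(1) y1(1)]
  let ?x1 = "deriv x" and ?y1 = "deriv y" and ?x2 = "deriv (deriv x)" and ?y2 = "deriv (deriv y)"
  define z where "z s = (x s, y s)" for s
  define ax where "ax s = ?x2 s + christoffel_111 E F G (z s) * ?x1 s^2
        + 2 * christoffel_112 E F G (z s) * ?x1 s * ?y1 s + christoffel_122 E F G (z s) * ?y1 s^2" for s
  define ay where "ay s = ?y2 s + christoffel_211 E F G (z s) * ?x1 s^2
        + 2 * christoffel_212 E F G (z s) * ?x1 s * ?y1 s + christoffel_222 E F G (z s) * ?y1 s^2" for s
  have zs: "smooth_on I z" unfolding z_def[abs_def] by (intro smooth_intros I xy)
  have zU: "z ` I \<subseteq> U" using in_U by (auto simp: z_def)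
  note chr = smooth_on_christoffel[OF U EFG det, THEN smooth_on_compose[OF I(1) U zU _ zs]]
  have ax: "smooth_on I ax" and ay: "smooth_on I ay"
    unfolding ax_def[abs_def] ay_def[abs_def] by (intro smooth_intros I x1 y1 x2 y2 chr)+
  have n: "?x1 s * ?x1 s + ?y1 s * ?y1 s \<noteq> 0" if "s \<in> I" for s
    using regular[OF that] by (auto simp: sum_squares_eq_zero_iff)
  \<comment> \<open>The factor is written as a Euclidean projection onto the velocity, whose squared
    length is nonzero; this exhibits \<open>k\<close> as a smooth function.\<close>
  define k where "k s = (ax s * ?x1 s + ay s * ?y1 s) / (?x1 s * ?x1 s + ?y1 s * ?y1 s)" for s
  have k: "smooth_on I k"
    unfolding k_def[abs_def] by (intro smooth_intros I x1 y1 ax ay) (use n in auto)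
  have acc: "ax s = k s * ?x1 s" "ay s = k s * ?y1 s" if s: "s \<in> I" for s
  proof -
    let ?fx = "dx f (z s)" and ?fy = "dy f (z s)"
    have c1: "?fx * ?x1 s + ?fy * ?y1 s = 0"
      unfolding z_def
      by (rule constant_along_curve(1)[OF U f(1) I(1) s x1(2) y1(2) x2(2)[OF s] y2(2)[OF s] in_U const])
    have c2: "?fx * ax s + ?fy * ay s = - sym_cov_deriv E F G (dx f) (dy f) (z s) (?x1 s) (?y1 s)"
      unfolding ax_def ay_def z_def
      by (rule constant_along_curve(2)[OF U f(1) I(1) s x1(2) y1(2) x2(2)[OF s] y2(2)[OF s] in_U const])
    have nz: "(?fx, ?fy) \<noteq> (0, 0)" using f(2) in_U[OF s] by (simp add: z_def)
    obtain l where l: "?x1 s = l * ?fy" "?y1 s = l * - ?fx"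
      using kernel_parallel[OF c1 nz] .
    have "sym_cov_deriv E F G (dx f) (dy f) (z s) (?x1 s) (?y1 s) = 0"
      unfolding l sym_cov_deriv_scale using cov in_U[OF s] by (simp add: z_def)
    then have "?fx * ax s + ?fy * ay s = 0"
      using c2 by simp
    then obtain l' where l': "ax s = l' * ?fy" "ay s = l' * - ?fx"
      using kernel_parallel[OF _ nz] by metis
    have "ax s * (?x1 s * ?x1 s + ?y1 s * ?y1 s) = (ax s * ?x1 s + ay s * ?y1 s) * ?x1 s"
      "ay s * (?x1 s * ?x1 s + ?y1 s * ?y1 s) = (ax s * ?x1 s + ay s * ?y1 s) * ?y1 s"
      unfolding l l' by (simp_all add: algebra_simps)
    then show "ax s = k s * ?x1 s" "ay s = k s * ?y1 s"
      using n[OF s] by (simp_all add: k_def eq_divide_eq)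
  qed
  \<comment> \<open>The new parameter must solve the second-order equation that
    \<open>\<tau>'' = k * \<tau>'\<close>. One integration gives \<open>K\<close>, a second one of
    \<open>exp K\<close> gives \<open>\<tau>\<close>, and \<open>\<rho>\<close> is the inverse of
    \<open>\<tau>\<close>.\<close>
  obtain K where K: "smooth_on I K" "\<And>t. t \<in> I \<Longrightarrow> (K has_real_derivative k t) (at t)"
    by (rule smooth_on_real_antiderivative[OF I(1,2) k], rule that)
  have eK: "smooth_on I (\<lambda>t. exp (K t))" by (intro smooth_intros I K)
  obtain \<tau> where \<tau>: "smooth_on I \<tau>" "\<And>t. t \<in> I \<Longrightarrow> (\<tau> has_real_derivative exp (K t)) (at t)"
    by (rule smooth_on_real_antiderivative[OF I(1,2) eK], rule that)
  obtain \<rho> where J: "open (\<tau> ` I)" "connected (\<tau> ` I)" "\<rho> ` (\<tau> ` I) = I" and \<rho>: "smooth_on (\<tau> ` I) \<rho>"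
    "\<And>r. r \<in> \<tau> ` I \<Longrightarrow> (\<rho> has_real_derivative 1 / exp (K (\<rho> r))) (at r)"
    using smooth_real_inverse[OF I(1,2) \<tau> _ eK] by (metis exp_gt_zero)
  let ?J = "\<tau> ` I"
  have \<rho>I: "\<rho> r \<in> I" if "r \<in> ?J" for r using J(3) that by blast
  define \<gamma> where "\<gamma> r = z (\<rho> r)" for r
  define v where "v s = exp (- K s)" for s
  have v: "(v has_real_derivative - k s * v s) (at s)" if "s \<in> I" for s
    unfolding v_def[abs_def] using K(2)[OF that] by (auto intro!: derivative_eq_intros)
  have d\<rho>: "(\<rho> has_real_derivative v (\<rho> r)) (at r)" if "r \<in> ?J" for r
    using \<rho>(2)[OF that] by (simp add: v_def exp_minus field_simps)
  have d1: "((\<lambda>r. h (\<rho> r)) has_real_derivative deriv h (\<rho> r) * v (\<rho> r)) (at r)"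
    if "smooth_on I h" "r \<in> ?J" for h r
    by (rule DERIV_chain2[OF smooth_on_deriv(2)[OF I(1) that(1) \<rho>I[OF that(2)]] d\<rho>[OF that(2)]])
  have d2: "deriv (deriv (\<lambda>r. h (\<rho> r))) r = (deriv (deriv h) (\<rho> r) - k (\<rho> r) * deriv h (\<rho> r)) * v
      (\<rho> r)^2"
    if h: "smooth_on I h" and r: "r \<in> ?J" for h r
  proof -
    note h1 = smooth_on_deriv[OF I(1) smooth_on_deriv(1)[OF I(1) h]]
    have "((\<lambda>r. deriv h (\<rho> r) * v (\<rho> r)) has_real_derivative
        (deriv (deriv h) (\<rho> r) * v (\<rho> r)) * v (\<rho> r) + (- k (\<rho> r) * v (\<rho> r)) * v (\<rho> r) * deriv h
            (\<rho> r)) (at r)"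
      by (rule DERIV_mult[OF DERIV_chain2[OF h1(2)[OF \<rho>I[OF r]] d\<rho>[OF r]] DERIV_chain2[OF
          v[OF \<rho>I[OF r]] d\<rho>[OF r]]])
    then have "((deriv (\<lambda>r. h (\<rho> r))) has_real_derivative
        (deriv (deriv h) (\<rho> r) * v (\<rho> r)) * v (\<rho> r) + (- k (\<rho> r) * v (\<rho> r)) * v (\<rho> r) * deriv h
            (\<rho> r)) (at r)"
      by (rule has_field_derivative_transform_within_open[OF _ J(1) r])
          (rule DERIV_imp_deriv[OF d1[OF h], symmetric])
    then show ?thesis by (simp add: DERIV_imp_deriv algebra_simps power2_eq_square)
  qed
  have \<gamma>s: "smooth_on ?J \<gamma>"
    unfolding \<gamma>_def[abs_def] by (rule smooth_on_compose[OF J(1) I(1) _ zs \<rho>(1)]) (use J(3) in blast)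
  have geo: "geodesic_on E F G ?J \<gamma>"
    unfolding geodesic_on_def Let_def
  proof (intro conjI \<gamma>s ballI)
    fix r assume r: "r \<in> ?J"
    note s = \<rho>I[OF r]
    have fs: "(\<lambda>t. fst (\<gamma> t)) = (\<lambda>t. x (\<rho> t))" "(\<lambda>t. snd (\<gamma> t)) = (\<lambda>t. y (\<rho> t))"
      by (simp_all add: \<gamma>_def z_def)
    have D1: "deriv (\<lambda>t. x (\<rho> t)) r = ?x1 (\<rho> r) * v (\<rho> r)" "deriv (\<lambda>t. y (\<rho> t)) r = ?y1 (\<rho> r) * v (\<rho> r)"
      using d1[OF xy(1) r] d1[OF xy(2) r] by (simp_all add: DERIV_imp_deriv)
    note acc[OF s, unfolded ax_def ay_def]
    then have "(?x2 (\<rho> r) - k (\<rho> r) * ?x1 (\<rho> r)) = - (christoffel_111 E F G (z (\<rho> r)) * ?x1 (\<rho> r)^2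
        + 2 * christoffel_112 E F G (z (\<rho> r)) * ?x1 (\<rho> r) * ?y1 (\<rho> r) + christoffel_122 E F G (z
            (\<rho> r)) * ?y1 (\<rho> r)^2)"
      "(?y2 (\<rho> r) - k (\<rho> r) * ?y1 (\<rho> r)) = - (christoffel_211 E F G (z (\<rho> r)) * ?x1 (\<rho> r)^2
        + 2 * christoffel_212 E F G (z (\<rho> r)) * ?x1 (\<rho> r) * ?y1 (\<rho> r) + christoffel_222 E F G (z
            (\<rho> r)) * ?y1 (\<rho> r)^2)"
      by (simp_all add: algebra_simps)
    note X2 = this
    show "deriv (deriv (\<lambda>t. fst (\<gamma> t))) r + christoffel_111 E F G (\<gamma> r) * (deriv (\<lambda>t. fst (\<gamma> t)) r)\<^sup>2
          + 2 * christoffel_112 E F G (\<gamma> r) * deriv (\<lambda>t. fst (\<gamma> t)) r * deriv (\<lambda>t. snd (\<gamma> t)) r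
          + christoffel_122 E F G (\<gamma> r) * (deriv (\<lambda>t. snd (\<gamma> t)) r)\<^sup>2 = 0"
      unfolding fs d2[OF xy(1) r] X2 D1 unfolding \<gamma>_def by (simp add: algebra_simps power2_eq_square)
    show "deriv (deriv (\<lambda>t. snd (\<gamma> t))) r + christoffel_211 E F G (\<gamma> r) * (deriv (\<lambda>t. fst (\<gamma> t)) r)\<^sup>2
          + 2 * christoffel_212 E F G (\<gamma> r) * deriv (\<lambda>t. fst (\<gamma> t)) r * deriv (\<lambda>t. snd (\<gamma> t)) r
          + christoffel_222 E F G (\<gamma> r) * (deriv (\<lambda>t. snd (\<gamma> t)) r)\<^sup>2 = 0"
      unfolding fs d2[OF xy(2) r] X2 D1 unfolding \<gamma>_def by (simp add: algebra_simps power2_eq_square)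
  qed
  have "vector_derivative \<gamma> (at r) \<noteq> 0" if r: "r \<in> ?J" for r
  proof -
    have "(\<gamma> has_vector_derivative (?x1 (\<rho> r) * v (\<rho> r), ?y1 (\<rho> r) * v (\<rho> r))) (at r)"
      unfolding \<gamma>_def[abs_def] z_def
      by (intro has_vector_derivative_Pair)
        (use d1[OF xy(1) r] d1[OF xy(2) r] in \<open>simp_all add:
            has_real_derivative_iff_has_vector_derivative\<close>)
    from vector_derivative_at[OF this] show ?thesis
      using regular[OF \<rho>I[OF r]] by (auto simp: v_def zero_prod_def)
  qed
  moreover have "(\<lambda>s. (x s, y s)) ` I = \<gamma> ` ?J"
  proof -
    have "\<gamma> ` ?J = z ` \<rho> ` ?J" by (simp only: \<gamma>_def image_image)
    then show ?thesis unfolding J(3) by (simp add: z_def)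
  qed
  ultimately show ?thesis
    unfolding unparametrized_geodesic_def
    by (intro exI[of _ ?J] exI[of _ \<gamma>] conjI J geo ballI) (use I(3) in auto)
qed

section \<open>Foliations by the level curves of a chart with convex image\<close>

locale foliation_chart =
  fixes U V :: "point set" and \<Phi> \<Psi> :: "point \<Rightarrow> point"
  assumes open_U: "open U" and open_V: "open V" and convex_V: "convex V"
    and hom: "homeomorphism U V \<Phi> \<Psi>" and smooth_\<Phi>: "smooth_on U \<Phi>" and smooth_\<Psi>: "smooth_on V \<Psi>"
begin

text \<open>Whole level sets serve as leaves. This is legitimate because horizontal slices of the
  convex image are segments, so that each level set is connected.\<close>

definition leaves :: "point set set" where
  "leaves = (\<lambda>c. {z\<in>U. snd (\<Phi> z) = c}) ` (snd ` V)"

lemma \<Phi>V: "z \<in> U \<Longrightarrow> \<Phi> z \<in> V" and \<Psi>U: "w \<in> V \<Longrightarrow> \<Psi> w \<in> U"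
  and \<Psi>\<Phi>: "z \<in> U \<Longrightarrow> \<Psi> (\<Phi> z) = z" and \<Phi>\<Psi>: "w \<in> V \<Longrightarrow> \<Phi> (\<Psi> w) = w"
  using hom by (auto simp: homeomorphism_def)

lemma path_connected_level:
  assumes "convex B" "B \<subseteq> V"
  shows "path_connected {z\<in>U. \<Phi> z \<in> B \<and> snd (\<Phi> z) = c}"
proof -
  have "{z\<in>U. \<Phi> z \<in> B \<and> snd (\<Phi> z) = c} = \<Psi> ` (B \<inter> snd -` {c})" (is "?L = ?R")
  proof
    show "?L \<subseteq> ?R"
    proof
      fix z assume "z \<in> ?L"
      then have "\<Phi> z \<in> B \<inter> snd -` {c}" "z = \<Psi> (\<Phi> z)" by (auto simp: \<Psi>\<Phi>)
      then show "z \<in> ?R" by blast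
    qed
    show "?R \<subseteq> ?L" using assms(2) by (auto simp: subset_iff \<Psi>U \<Phi>\<Psi>)
  qed
  moreover have "convex (B \<inter> snd -` {c})"
    by (intro convex_Int assms(1) convex_linear_vimage linear_snd) simp
  moreover have "continuous_on (B \<inter> snd -` {c}) \<Psi>"
    using smooth_on_imp_continuous_on[OF smooth_\<Psi>] assms(2) by (auto intro: continuous_on_subset)
  ultimately show ?thesis by (simp add: path_connected_continuous_image convex_imp_path_connected)
qed

text \<open>Near a point the required chart is \<open>\<Phi>\<close> restricted to the preimage of a
  small square and rescaled affinely to the unit square. The slices of the square are convex, so a
  leaf meets this preimage in at most one piece.\<close>

lemma foliation: "foliation_on U leaves"
  unfolding foliation_on_def
proof (intro conjI ballI)
  show "\<Union> leaves = U" using \<Phi>V by (auto simp: leaves_def)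
  show "disjoint leaves" by (auto simp: leaves_def disjoint_def)
next
  fix L assume "L \<in> leaves"
  then obtain w where w: "w \<in> V" "L = {z\<in>U. snd (\<Phi> z) = snd w}" by (auto simp: leaves_def)
  then have "\<Psi> w \<in> L" by (simp add: \<Psi>U \<Phi>\<Psi>)
  then show "L \<noteq> {}" by blast
  have "L = {z\<in>U. \<Phi> z \<in> V \<and> snd (\<Phi> z) = snd w}" using w \<Phi>V by auto
  then show "path_connected L" using path_connected_level[OF convex_V order_refl] by simp
next
  fix m assume m: "m \<in> U"
  obtain x y where xy: "\<Phi> m = (x, y)" by force
  obtain A A' where A: "open A" "open A'" "x \<in> A" "y \<in> A'" "A \<times> A' \<subseteq> V"
    using open_V \<Phi>V[OF m] xy by (auto elim: open_prod_elim)
  obtain d1 d2 where d: "d1 > 0" "ball x d1 \<subseteq> A" "d2 > 0" "ball y d2 \<subseteq> A'"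
    using A open_contains_ball by metis
  define e where "e = min d1 d2"
  define B where "B = {x - e<..<x + e} \<times> {y - e<..<y + e}"
  have e: "e > 0" using d by (simp add: e_def)
  have "{x - e<..<x + e} \<subseteq> ball x d1" "{y - e<..<y + e} \<subseteq> ball y d2"
    by (auto simp: e_def dist_real_def)
  then have BV: "B \<subseteq> V" using A d unfolding B_def by blast
  have B: "convex B" "open B" by (auto simp: B_def intro!: convex_Times open_Times)
  define W where "W = {z\<in>U. \<Phi> z \<in> B}"
  let ?Q = "{-1<..<1} \<times> {-1<..<1} :: point set"
  define \<phi> where "\<phi> z = ((fst (\<Phi> z) - x) / e, (snd (\<Phi> z) - y) / e)" for z
  define \<psi> where "\<psi> w = \<Psi> (x + e * fst w, y + e * snd w)" for w
  have oW: "open W"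
    using continuous_open_preimage[OF smooth_on_imp_continuous_on[OF smooth_\<Phi>] open_U B(2)]
    by (simp add: W_def vimage_def Int_def)
  have WU: "W \<subseteq> U" by (auto simp: W_def)
  have QB: "(x + e * fst w, y + e * snd w) \<in> B" if "w \<in> ?Q" for w
  proof -
    have "\<bar>fst w\<bar> < 1" "\<bar>snd w\<bar> < 1" using that by auto
    then have "\<bar>e * fst w\<bar> < e" "\<bar>e * snd w\<bar> < e" using e by (simp_all add: abs_mult)
    then show ?thesis unfolding B_def by (auto simp: abs_less_iff)
  qed
  have \<phi>Q: "\<phi> z \<in> ?Q" if "z \<in> W" for z
    using that e by (auto simp: W_def B_def \<phi>_def divide_simps mem_Times_iff)
  have \<psi>W: "\<psi> w \<in> W" if "w \<in> ?Q" for w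
    using QB[OF that] BV by (auto simp: \<psi>_def W_def \<Psi>U \<Phi>\<Psi> subset_iff)
  have \<psi>\<phi>: "\<psi> (\<phi> z) = z" if "z \<in> W" for z
    using that e by (auto simp: \<psi>_def \<phi>_def W_def \<Psi>\<Phi>)
  have \<phi>\<psi>: "\<phi> (\<psi> w) = w" if "w \<in> ?Q" for w
    using QB[OF that] BV e by (auto simp: \<psi>_def \<phi>_def \<Phi>\<Psi> subset_iff prod_eq_iff)
  have sm\<phi>: "smooth_on W \<phi>"
    unfolding \<phi>_def[abs_def] by (intro smooth_intros oW smooth_on_subset[OF smooth_\<Phi> WU]) (use e in auto)
  have oQ: "open ?Q" by (intro open_Times) auto
  have sm\<psi>: "smooth_on ?Q \<psi>"
    unfolding \<psi>_def[abs_def]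
  proof (rule smooth_on_compose[OF oQ open_V _ smooth_\<Psi>])
    show "(\<lambda>w. (x + e * fst w, y + e * snd w)) ` ?Q \<subseteq> V" using QB BV by blast
    show "smooth_on ?Q (\<lambda>w. (x + e * fst w, y + e * snd w))" by (intro smooth_intros oQ)
  qed
  have "homeomorphism W ?Q \<phi> \<psi>"
  proof (rule homeomorphismI)
    show "\<phi> ` W \<subseteq> ?Q" "\<psi> ` ?Q \<subseteq> W" using \<phi>Q \<psi>W by blast+
  qed (use \<psi>\<phi> \<phi>\<psi> smooth_on_imp_continuous_on[OF sm\<phi>] smooth_on_imp_continuous_on[OF sm\<psi>] in blast)+
  then have chart: "diffeomorphic_chart W ?Q \<phi>"
    unfolding diffeomorphic_chart_def using oW oQ sm\<phi> sm\<psi> by blast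
  have mW: "m \<in> W" using m e xy by (simp add: W_def B_def)
  have lvl: "{z\<in>U. snd (\<Phi> z) = c} \<inter> W = {z\<in>U. \<Phi> z \<in> B \<and> snd (\<Phi> z) = c}" for c
    by (auto simp: W_def)
  \<comment> \<open>A slice is path-connected, so the path component of any of its points is the
    whole slice and induced leaves are plain level sets.\<close>
  have comp: "path_component_set ({z\<in>U. snd (\<Phi> z) = c} \<inter> W) z = {z\<in>U. snd (\<Phi> z) = c} \<inter> W"
    if "z \<in> {z\<in>U. snd (\<Phi> z) = c} \<inter> W" for c z
    using iffD1[OF path_connected_component_set path_connected_level[OF B(1) BV, of c]] that
    unfolding lvl by blast
  have "induced_leaves W leaves = (\<lambda>c. {z \<in> W. snd (\<phi> z) = c}) ` {- 1<..<1}"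
  proof (intro equalityI subsetI)
    fix S assume "S \<in> induced_leaves W leaves"
    then obtain c z where z: "z \<in> {z\<in>U. snd (\<Phi> z) = c} \<inter> W" "S = {z\<in>U. snd (\<Phi> z) = c} \<inter> W"
      using comp by (force simp: induced_leaves_def leaves_def)
    have "S = {z \<in> W. snd (\<phi> z) = (c - y) / e}" unfolding z(2) using e by (auto simp: W_def \<phi>_def)
    moreover have "(c - y) / e \<in> {-1<..<1}" using \<phi>Q[of z] z(1) by (auto simp: \<phi>_def)
    ultimately show "S \<in> (\<lambda>c. {z \<in> W. snd (\<phi> z) = c}) ` {- 1<..<1}" by blast
  next
    fix S assume "S \<in> (\<lambda>c. {z \<in> W. snd (\<phi> z) = c}) ` {- 1<..<1}"
    then obtain c where c: "c \<in> {-1<..<1}" "S = {z \<in> W. snd (\<phi> z) = c}" by blast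
    have S: "S = {z\<in>U. snd (\<Phi> z) = y + e * c} \<inter> W"
      unfolding c(2) using e by (auto simp: W_def \<phi>_def field_simps)
    have w: "(0, c) \<in> ?Q" using c(1) by simp
    have z: "\<psi> (0, c) \<in> {z\<in>U. snd (\<Phi> z) = y + e * c} \<inter> W"
      using \<psi>W[OF w] QB[OF w] BV by (auto simp: \<psi>_def \<Phi>\<Psi> \<Psi>U subset_iff)
    have "y + e * c \<in> snd ` V" using QB[OF w] BV by force
    then have "{z\<in>U. snd (\<Phi> z) = y + e * c} \<in> leaves" by (simp add: leaves_def)
    then show "S \<in> induced_leaves W leaves"
      unfolding induced_leaves_def using z comp[OF z] S by blast
  qed
  then show "\<exists>W \<phi>. m \<in> W \<and> W \<subseteq> U \<and> diffeomorphic_chart W ({-1<..<1} \<times> {-1<..<1} :: point set) \<phi> \<and>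
        induced_leaves W leaves = (\<lambda>c. {z\<in>W. snd (\<phi> z) = c}) ` {-1<..<1}"
    using mW WU chart by blast
qed

lemma snd_constant_on_induced_leaves:
  assumes "L \<in> induced_leaves W leaves" shows "(\<lambda>z. snd (\<Phi> z)) constant_on L"
proof -
  obtain c z where L: "L = path_component_set ({z\<in>U. snd (\<Phi> z) = c} \<inter> W) z"
    using assms by (auto simp: induced_leaves_def leaves_def)
  have "path_component_set ({z\<in>U. snd (\<Phi> z) = c} \<inter> W) z \<subseteq> {z\<in>U. snd (\<Phi> z) = c} \<inter> W"
    by (rule path_component_subset)
  then have "snd (\<Phi> x) = c" if "x \<in> L" for x using that L by blast
  then show ?thesis unfolding constant_on_def by blast
qed

text \<open>In the chart a kernel vector becomes horizontal, \<open>(t, 0)\<close>. The straight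
  line in this direction, pulled back by \<open>\<Psi>\<close>, stays in the leaf and has the
  prescribed velocity.\<close>

lemma kernel_subset_tangent:
  assumes m: "m \<in> U" and w: "frechet_derivative (\<lambda>z. snd (\<Phi> z)) (at m) w = 0"
  shows "w \<in> leaf_tangent_space leaves m"
proof -
  have d\<Phi>: "(\<Phi> has_derivative frechet_derivative \<Phi> (at m)) (at m)"
    by (rule smooth_on_has_derivative[OF smooth_\<Phi> m])
  have d\<Psi>: "(\<Psi> has_derivative frechet_derivative \<Psi> (at (\<Phi> m))) (at (\<Phi> m))"
    by (rule smooth_on_has_derivative[OF smooth_\<Psi> \<Phi>V[OF m]])
  have "((\<lambda>z. \<Psi> (\<Phi> z)) has_derivative (\<lambda>v. frechet_derivative \<Psi> (at (\<Phi> m)) (frechet_derivative \<Phi>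
      (at m) v))) (at m)"
    by (rule has_derivative_compose[OF d\<Phi> d\<Psi>])
  moreover have "((\<lambda>z. \<Psi> (\<Phi> z)) has_derivative (\<lambda>v. v)) (at m)"
    using has_derivative_cong_open[OF open_U m, of "\<lambda>z. \<Psi> (\<Phi> z)" "\<lambda>z. z" "\<lambda>v. v"] \<Psi>\<Phi> by simp
  ultimately have id: "(\<lambda>v. frechet_derivative \<Psi> (at (\<Phi> m)) (frechet_derivative \<Phi> (at m) v)) = (\<lambda>v. v)"
    by (rule has_derivative_unique)
  have "frechet_derivative (\<lambda>z. snd (\<Phi> z)) (at m) = (\<lambda>v. snd (frechet_derivative \<Phi> (at m) v))"
    by (rule frechet_derivative_at[symmetric]) (rule has_derivative_snd[OF d\<Phi>])
  then have "snd (frechet_derivative \<Phi> (at m) w) = 0" using w by simp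
  then obtain t where t: "frechet_derivative \<Phi> (at m) w = (t, 0)" by (metis prod.collapse)
  obtain d where d: "d > 0" "ball (\<Phi> m) d \<subseteq> V" using open_V \<Phi>V[OF m] open_contains_ball by blast
  \<comment> \<open>The summand 1 keeps the denominator positive when \<open>t = 0\<close>; for
    parameters below \<open>e\<close> the segment stays in the ball of radius
    \<open>d\<close>.\<close>
  define e where "e = d / (1 + \<bar>t\<bar>)"
  have e: "e > 0" using d by (simp add: e_def add_pos_nonneg)
  define \<gamma> where "\<gamma> s = \<Psi> (\<Phi> m + s *\<^sub>R (t, 0))" for s :: real
  have inV: "\<Phi> m + s *\<^sub>R (t, 0) \<in> V" if "s \<in> {-e<..<e}" for s
  proof -
    have "\<bar>s\<bar> * \<bar>t\<bar> \<le> \<bar>s\<bar> * (1 + \<bar>t\<bar>)" by (simp add: mult_left_mono)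
    also have "\<dots> < e * (1 + \<bar>t\<bar>)" using that by (intro mult_strict_right_mono)
        (auto simp: add_pos_nonneg)
    also have "\<dots> = d" by (simp add: e_def add_nonneg_eq_0_iff)
    finally have "norm (s *\<^sub>R (t, 0::real)) < d" by (simp add: norm_Pair abs_mult)
    then have "dist (\<Phi> m + s *\<^sub>R (t, 0)) (\<Phi> m) < d" by (simp only: dist_norm add_diff_cancel_left')
    then have "\<Phi> m + s *\<^sub>R (t, 0) \<in> ball (\<Phi> m) d" by (metis mem_ball dist_commute)
    then show ?thesis using d(2) by blast
  qed
  have aff: "((\<lambda>s::real. \<Phi> m + s *\<^sub>R (t, 0::real)) has_derivative (\<lambda>s. s *\<^sub>R (t, 0))) (at 0)"
    by (auto intro!: derivative_eq_intros)
  have "((\<lambda>s. \<Psi> (\<Phi> m + s *\<^sub>R (t, 0))) has_derivative (\<lambda>s. frechet_derivative \<Psi> (at (\<Phi> m)) (s *\<^sub>R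
      (t, 0)))) (at 0)"
    by (rule has_derivative_compose[OF aff]) (use d\<Psi> in \<open>simp flip: zero_prod_def\<close>)
  moreover have "frechet_derivative \<Psi> (at (\<Phi> m)) (s *\<^sub>R (t, 0)) = s *\<^sub>R w" for s
    using linear_scale[OF has_derivative_linear[OF d\<Psi>], of s "(t, 0)"] fun_cong[OF id, of w] t by simp
  ultimately have vd: "(\<gamma> has_vector_derivative w) (at 0)"
    by (simp add: has_vector_derivative_def \<gamma>_def[abs_def])
  have sm: "smooth_on {-e<..<e} \<gamma>"
    unfolding \<gamma>_def[abs_def]
  proof (rule smooth_on_compose[OF open_greaterThanLessThan open_V _ smooth_\<Psi>])
    show "(\<lambda>s. \<Phi> m + s *\<^sub>R (t, 0)) ` {-e<..<e} \<subseteq> V" using inV by blast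
    show "smooth_on {-e<..<e} (\<lambda>s. \<Phi> m + s *\<^sub>R (t, 0))" by (intro smooth_intros) auto
  qed
  have L: "\<gamma> ` {-e<..<e} \<subseteq> {z\<in>U. snd (\<Phi> z) = snd (\<Phi> m)}"
    using inV by (auto simp: \<gamma>_def \<Psi>U \<Phi>\<Psi>)
  have Ll: "{z\<in>U. snd (\<Phi> z) = snd (\<Phi> m)} \<in> leaves"
    using \<Phi>V[OF m] by (simp add: leaves_def)
  have "\<gamma> 0 = m" by (simp add: \<gamma>_def \<Psi>\<Phi> m flip: zero_prod_def)
  then show ?thesis unfolding leaf_tangent_space_def using e sm L Ll vd by blast
qed

lemma geodesic_leaves:
  assumes EFG: "smooth_on U E" "smooth_on U F" "smooth_on U G" and det: "\<forall>z\<in>U. metric_det E F G z \<noteq> 0"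
    and f: "\<And>z. z \<in> U \<Longrightarrow> f z = snd (\<Phi> z)" "smooth_on U f" "\<And>z. z \<in> U \<Longrightarrow> (dx f z, dy f z) \<noteq> (0, 0)"
    and cov: "\<And>z. z \<in> U \<Longrightarrow> sym_cov_deriv E F G (dx f) (dy f) z (dy f z) (- dx f z) = 0"
    and L: "L \<in> leaves"
  shows "unparametrized_geodesic E F G L"
proof -
  obtain w where w: "w \<in> V" "L = {z\<in>U. snd (\<Phi> z) = snd w}" using L by (auto simp: leaves_def)
  \<comment> \<open>The horizontal slice of \<open>V\<close> through \<open>w\<close>. Convexity
    makes it an interval, so a single curve parametrises the leaf by the first chart
    coordinate.\<close>
  define I where "I = (\<lambda>s. (s, snd w)) -` V"
  have oI: "open I" unfolding I_def by (intro open_vimage open_V continuous_intros)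
  have cI: "connected I"
  proof -
    have "convex I" unfolding I_def convex_def
    proof (intro ballI allI impI)
      fix s t u v :: real assume *: "s \<in> (\<lambda>s. (s, snd w)) -` V" "t \<in> (\<lambda>s. (s, snd w)) -` V" "0 \<le> u"
          "0 \<le> v" "u + v = 1"
      then have "u *\<^sub>R (s, snd w) + v *\<^sub>R (t, snd w) \<in> V"
        by (intro convexD[OF convex_V]) auto
      moreover have "u * snd w + v * snd w = snd w" using * by (simp flip: distrib_right)
      ultimately show "u *\<^sub>R s + v *\<^sub>R t \<in> (\<lambda>s. (s, snd w)) -` V" by simp
    qed
    then show ?thesis by (rule convex_connected)
  qed
  have "fst w \<in> I" using w by (simp add: I_def)
  then have neI: "I \<noteq> {}" by blast
  have IV: "(s, snd w) \<in> V" if "s \<in> I" for s using that by (simp add: I_def)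
  define \<sigma> where "\<sigma> s = \<Psi> (s, snd w)" for s
  have \<sigma>: "smooth_on I \<sigma>"
    unfolding \<sigma>_def[abs_def]
    by (rule smooth_on_compose[OF oI open_V _ smooth_\<Psi>]) (use IV oI in \<open>auto intro!: smooth_intros\<close>)
  have xy: "smooth_on I (\<lambda>s. fst (\<sigma> s))" "smooth_on I (\<lambda>s. snd (\<sigma> s))"
    by (intro smooth_intros oI \<sigma>)+
  have \<sigma>U: "\<sigma> s \<in> U" "\<Phi> (\<sigma> s) = (s, snd w)" if "s \<in> I" for s using IV[OF that] by
      (simp_all add: \<sigma>_def \<Psi>U \<Phi>\<Psi>)
  \<comment> \<open>A vanishing velocity would give \<open>\<Phi> (\<sigma> s)\<close> derivative
    zero, although its first component is \<open>s\<close>.\<close>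
  have reg: "(deriv (\<lambda>s. fst (\<sigma> s)) s, deriv (\<lambda>s. snd (\<sigma> s)) s) \<noteq> (0, 0)" if s: "s \<in> I" for s
  proof
    assume "(deriv (\<lambda>s. fst (\<sigma> s)) s, deriv (\<lambda>s. snd (\<sigma> s)) s) = (0, 0)"
    then have "((\<lambda>s. fst (\<sigma> s)) has_vector_derivative 0) (at s)" "((\<lambda>s. snd
        (\<sigma> s)) has_vector_derivative 0) (at s)"
      using smooth_on_deriv(2)[OF oI xy(1) s] smooth_on_deriv(2)[OF oI xy(2) s]
      by (simp_all add: has_real_derivative_iff_has_vector_derivative)
    from has_vector_derivative_Pair[OF this]
    have "(\<sigma> has_derivative (\<lambda>h. 0)) (at s)" by (simp add: has_vector_derivative_def zero_prod_def)
    from has_derivative_compose[OF this smooth_on_has_derivative[OF smooth_\<Phi> \<sigma>U(1)[OF s]]]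
    have "((\<lambda>s. \<Phi> (\<sigma> s)) has_derivative (\<lambda>h. 0)) (at s)"
      using linear_0[OF has_derivative_linear[OF smooth_on_has_derivative[OF smooth_\<Phi> \<sigma>U(1)[OF s]]]]
          by simp
    moreover have "((\<lambda>s. \<Phi> (\<sigma> s)) has_derivative (\<lambda>h. (h, 0))) (at s)"
      by (rule has_derivative_cong_open[OF oI s \<sigma>U(2), THEN iffD2]) (auto intro!: derivative_eq_intros)
    ultimately have "(\<lambda>h::real. (0::point)) = (\<lambda>h. (h, 0))" by (rule has_derivative_unique)
    from fun_cong[OF this, of 1] show False by (simp add: zero_prod_def)
  qed
  have "(\<lambda>s. (fst (\<sigma> s), snd (\<sigma> s))) ` I = L"
  proof
    show "(\<lambda>s. (fst (\<sigma> s), snd (\<sigma> s))) ` I \<subseteq> L" using \<sigma>U w(2) by auto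
    show "L \<subseteq> (\<lambda>s. (fst (\<sigma> s), snd (\<sigma> s))) ` I"
    proof
      fix z assume "z \<in> L"
      then have z: "z \<in> U" "(fst (\<Phi> z), snd w) = \<Phi> z" using w(2) by (auto simp: prod_eq_iff)
      then have "fst (\<Phi> z) \<in> I" and zs: "z = \<sigma> (fst (\<Phi> z))" using \<Phi>V by (auto simp: I_def \<sigma>_def \<Psi>\<Phi>)
      then have "\<sigma> (fst (\<Phi> z)) \<in> \<sigma> ` I" by blast
      then show "z \<in> (\<lambda>s. (fst (\<sigma> s), snd (\<sigma> s))) ` I" unfolding prod.collapse zs[symmetric] by simp
    qed
  qed
  moreover have "unparametrized_geodesic E F G ((\<lambda>s. (fst (\<sigma> s), snd (\<sigma> s))) ` I)"
  proof (rule unparametrized_geodesicI[OF open_U EFG det f(2,3) cov oI cI neI xy _ _ reg])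
    fix s assume s: "s \<in> I"
    show "(fst (\<sigma> s), snd (\<sigma> s)) \<in> U" using \<sigma>U(1)[OF s] by simp
    show "f (fst (\<sigma> s), snd (\<sigma> s)) = snd w" using \<sigma>U[OF s] by (simp add: f(1))
  qed
  ultimately show ?thesis by simp
qed

end

section \<open>From webs to cubic integrals\<close>

lemma riemannian_metric_on_det:
  assumes "riemannian_metric_on M E F G" "z \<in> M"
  shows "metric_det E F G z > 0"
proof -
  have pos: "(a, b) \<noteq> (0, 0) \<Longrightarrow> E z * a^2 + 2 * F z * a * b + G z * b^2 > 0" for a b
    using assms by (auto simp: riemannian_metric_on_def)
  have E: "E z > 0" using pos[of 1 0] by simp
  \<comment> \<open>The left-hand side is the value of the metric on the vector
    \<open>(- F z, E z)\<close>.\<close>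
  have "E z * metric_det E F G z > 0"
    using pos[of "- F z" "E z"] E by (simp add: metric_det_def algebra_simps power2_eq_square)
  then show ?thesis using E by (simp add: zero_less_mult_iff)
qed

lemma dx_dy_cong_open:
  assumes "open S" "z \<in> S" "\<And>y. y \<in> S \<Longrightarrow> f y = g y"
  shows "dx f z = dx g z" "dy f z = dy g z"
  using frechet_derivative_cong_open[OF assms] by (simp_all add: dx_def dy_def)

lemma sym_cov_deriv_cong:
  assumes "open S" "z \<in> S" "\<And>y. y \<in> S \<Longrightarrow> a y = a' y" "\<And>y. y \<in> S \<Longrightarrow> b y = b' y"
  shows "sym_cov_deriv E F G a b z = sym_cov_deriv E F G a' b' z"
  using dx_dy_cong_open[OF assms(1-3)] dx_dy_cong_open[OF assms(1,2,4)] assms(2-4)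
  by (simp add: sym_cov_deriv_def fun_eq_iff)

lemma sym_cov_deriv_add:
  assumes "a differentiable (at z)" "b differentiable (at z)" "a' differentiable (at z)"
      "b' differentiable (at z)"
  shows "sym_cov_deriv E F G (\<lambda>z. a z + a' z) (\<lambda>z. b z + b' z) z X Y
    = sym_cov_deriv E F G a b z X Y + sym_cov_deriv E F G a' b' z X Y"
  using assms by (simp add: sym_cov_deriv_def dx_dy_arith) (simp add: algebra_simps)

lemma dx_dy_minus_sum:
  assumes S: "open S" and u: "smooth_on S u" and v: "smooth_on S v"
    and w: "\<And>y. y \<in> S \<Longrightarrow> w y = - (u y + v y)" and z: "z \<in> S"
  shows "dx w z = - (dx u z + dx v z)" "dy w z = - (dy u z + dy v z)"
    and "sym_cov_deriv E F G (dx w) (dy w) z X Y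
      = - (sym_cov_deriv E F G (dx u) (dy u) z X Y + sym_cov_deriv E F G (dx v) (dy v) z X Y)" (is ?G1)
proof -
  have neg: "dx (\<lambda>y. - h y) y = - dx h y" "dy (\<lambda>y. - h y) y = - dy h y" if h: "h differentiable
      (at y)" for h :: scalar_field and y
  proof -
    have 0: "(\<lambda>y. 0) differentiable (at y)" by (rule differentiable_const)
    have 1: "dx (\<lambda>y. 0) y = 0" "dy (\<lambda>y. 0) y = 0" by (simp_all add: dx_def dy_def)
    show "dx (\<lambda>y. - h y) y = - dx h y" "dy (\<lambda>y. - h y) y = - dy h y"
      using dx_dy_arith(3,4)[OF 0 h] unfolding 1 by simp_all
  qed
  have deriv: "dx w y = - (dx u y + dx v y)" "dy w y = - (dy u y + dy v y)" if y: "y \<in> S" for y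
  proof -
    note d = smooth_on_imp_differentiable[OF u y] smooth_on_imp_differentiable[OF v y]
    have "dx w y = dx (\<lambda>y. - (u y + v y)) y" "dy w y = dy (\<lambda>y. - (u y + v y)) y"
      by (rule dx_dy_cong_open[OF S y], erule w)+
    then show "dx w y = - (dx u y + dx v y)" "dy w y = - (dy u y + dy v y)"
      unfolding neg[OF differentiable_add[OF d]] dx_dy_arith(1,2)[OF d] by simp_all
  qed
  then show "dx w z = - (dx u z + dx v z)" "dy w z = - (dy u z + dy v z)" using z by simp_all
  note d = smooth_on_imp_differentiable[OF smooth_on_dx[OF u] z] smooth_on_imp_differentiable[OF
      smooth_on_dy[OF u] z]
    smooth_on_imp_differentiable[OF smooth_on_dx[OF v] z] smooth_on_imp_differentiable[OF
        smooth_on_dy[OF v] z]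
  have "sym_cov_deriv E F G (dx w) (dy w) z X Y = sym_cov_deriv E F G (\<lambda>y. - (dx u y + dx v y))
      (\<lambda>y. - (dy u y + dy v y)) z X Y"
    using sym_cov_deriv_cong[OF S z deriv] by simp
  also have "\<dots> = - sym_cov_deriv E F G (\<lambda>y. dx u y + dx v y) (\<lambda>y. dy u y + dy v y) z X Y"
    by (simp only: sym_cov_deriv_def neg[OF differentiable_add[OF d(1,3)]] neg[OF
        differentiable_add[OF d(2,4)]])
      (simp add: algebra_simps)
  finally show ?G1
    by (simp only: sym_cov_deriv_add[OF d])
qed

lemma frechet_derivative_dx_dy:
  assumes "smooth_on U f" "z \<in> U"
  shows "frechet_derivative f (at z) v = dx f z * fst v + dy f z * snd v"
  using frechet_derivative_at[OF has_derivative_dx_dy[OF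
      smooth_on_imp_differentiable[OF assms]], symmetric] by simp

lemma smooth_cubic_product:
  fixes k l1 l2 m1 m2 n1 n2 :: scalar_field
  assumes U: "open U" and sm: "smooth_on U k" "smooth_on U l1" "smooth_on U l2" "smooth_on U m1"
      "smooth_on U m2"
      "smooth_on U n1" "smooth_on U n2"
    and I: "\<And>z p q. z \<in> U \<Longrightarrow> I (z, (p, q))
      = k z * ((l1 z * p + l2 z * q) * (m1 z * p + m2 z * q) * (n1 z * p + n2 z * q))"
  shows "smooth_on (U \<times> UNIV) I"
    and "\<exists>a b c d. smooth_on U a \<and> smooth_on U b \<and> smooth_on U c \<and> smooth_on U d \<and>
        (\<forall>z\<in>U. \<forall>p q. I (z, (p, q)) = a z * p^3 + b z * p^2 * q + c z * p * q^2 + d z * q^3)" (is ?G1)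
proof -
  have o: "open (U \<times> (UNIV::(real \<times> real) set))" using U by (simp add: open_Times)
  have "smooth_on (U \<times> UNIV) (\<lambda>\<xi>::phase_point. k (fst \<xi>) * ((l1 (fst \<xi>) * fst (snd \<xi>) + l2
      (fst \<xi>) * snd (snd \<xi>))
      * (m1 (fst \<xi>) * fst (snd \<xi>) + m2 (fst \<xi>) * snd (snd \<xi>)) * (n1 (fst \<xi>) * fst (snd \<xi>) + n2
          (fst \<xi>) * snd (snd \<xi>))))"
    by (intro smooth_intros smooth_on_base o U sm)
  then show "smooth_on (U \<times> UNIV) I"
    by (rule smooth_on_cong[OF o, THEN iffD1, rotated]) (auto simp: I)
  show ?G1
  proof (intro exI conjI)
    show "smooth_on U (\<lambda>z. k z * (l1 z * m1 z * n1 z))"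
      "smooth_on U (\<lambda>z. k z * (l1 z * m1 z * n2 z + l1 z * m2 z * n1 z + l2 z * m1 z * n1 z))"
      "smooth_on U (\<lambda>z. k z * (l1 z * m2 z * n2 z + l2 z * m1 z * n2 z + l2 z * m2 z * n1 z))"
      "smooth_on U (\<lambda>z. k z * (l2 z * m2 z * n2 z))"
      by (intro smooth_intros U sm)+
    show "\<forall>z\<in>U. \<forall>p q. I (z, (p, q)) = k z * (l1 z * m1 z * n1 z) * p^3
      + k z * (l1 z * m1 z * n2 z + l1 z * m2 z * n1 z + l2 z * m1 z * n1 z) * p^2 * q
      + k z * (l1 z * m2 z * n2 z + l2 z * m1 z * n2 z + l2 z * m2 z * n1 z) * p * q^2
      + k z * (l2 z * m2 z * n2 z) * q^3"
      by (simp add: I algebra_simps power2_eq_square power3_eq_cube)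
  qed
qed

text \<open>A leaf may return to \<open>W\<close> in many pieces, and \<open>f\<close> is known to
  be constant only on each path component. A short piece of the curve is path-connected and hence
  remains in a single component.\<close>

lemma curve_in_leaf:
  fixes J :: "real set"
  assumes W: "open W" and f: "local_first_integral W \<F> f" and L: "L \<in> \<F>"
    and J: "open J" "t \<in> J" and \<gamma>: "continuous_on J \<gamma>" "\<gamma> ` J \<subseteq> L" "\<gamma> t \<in> W"
  obtains J' where "open J'" "t \<in> J'" "J' \<subseteq> J" "\<gamma> ` J' \<subseteq> W" "\<And>s. s \<in> J' \<Longrightarrow> f (\<gamma> s) = f (\<gamma> t)"
proof -
  have "open {s \<in> J. \<gamma> s \<in> W}"
    using continuous_open_preimage[OF \<gamma>(1) J(1) W] by (simp add: vimage_def Int_def)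
  then obtain d where d: "d > 0" "ball t d \<subseteq> {s \<in> J. \<gamma> s \<in> W}"
    using J(2) \<gamma>(3) open_contains_ball by blast
  have sub: "\<gamma> ` ball t d \<subseteq> L \<inter> W" using d \<gamma>(2) by blast
  have "continuous_on (ball t d) \<gamma>" using \<gamma>(1) d by (blast intro: continuous_on_subset)
  then have "path_connected (\<gamma> ` ball t d)"
    by (intro path_connected_continuous_image convex_imp_path_connected convex_ball)
  then have comp: "\<gamma> ` ball t d \<subseteq> path_component_set (L \<inter> W) (\<gamma> t)"
    using sub d by (intro path_component_maximal) auto
  have "\<gamma> t \<in> L \<inter> W" using sub d by auto
  then have "path_component_set (L \<inter> W) (\<gamma> t) \<in> induced_leaves W \<F>"
    unfolding induced_leaves_def using L by blast
  then have "f constant_on path_component_set (L \<inter> W) (\<gamma> t)"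
    using f unfolding local_first_integral_def by blast
  then have const: "f (\<gamma> s) = f (\<gamma> t)" if "s \<in> ball t d" for s
    using comp that d unfolding constant_on_def by (metis centre_in_ball image_eqI subsetD)
  show ?thesis
  proof (rule that[of "ball t d"])
    show "ball t d \<subseteq> J" "\<gamma> ` ball t d \<subseteq> W" "t \<in> ball t d" using d sub by auto
  qed (use const in simp_all)
qed

lemma local_first_integral_nonzero:
  assumes "local_first_integral W \<F> f" "z \<in> W"
  shows "(dx f z, dy f z) \<noteq> (0, 0)"
proof
  assume z: "(dx f z, dy f z) = (0, 0)"
  have "smooth_on W f" using assms by (simp add: local_first_integral_def)
  then have "frechet_derivative f (at z) = (\<lambda>v. 0)"
    using frechet_derivative_dx_dy[of W f z] assms(2) z by (simp add: fun_eq_iff)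
  then show False using assms by (auto simp: local_first_integral_def)
qed

lemma leaf_tangent_kernel:
  assumes W: "open W" "z \<in> W" and f: "local_first_integral W \<F> f" and v: "v \<in> leaf_tangent_space \<F> z"
  shows "dx f z * fst v + dy f z * snd v = 0"
proof -
  obtain L e \<gamma> where *: "L \<in> \<F>" "e > 0" "smooth_on {-e<..<e} \<gamma>" "\<gamma> ` {-e<..<e} \<subseteq> L" "\<gamma> 0 = z"
    "(\<gamma> has_vector_derivative v) (at (0::real))"
    using v unfolding leaf_tangent_space_def by blast
  have 0: "0 \<in> {-e<..<e}" "\<gamma> 0 \<in> W" using *(2,5) W(2) by auto
  obtain J' where J': "open J'" "0 \<in> J'" "J' \<subseteq> {-e<..<e}" "\<gamma> ` J' \<subseteq> W" "\<And>s. s \<in> J' \<Longrightarrow> f (\<gamma> s) = f (\<gamma> 0)"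
    by (rule curve_in_leaf[OF W(1) f *(1) open_greaterThanLessThan 0(1)
        smooth_on_imp_continuous_on[OF *(3)] *(4) 0(2)], rule that)
  have sf: "smooth_on W f" using f by (simp add: local_first_integral_def)
  have "(f has_derivative (\<lambda>v. dx f z * fst v + dy f z * snd v)) (at (\<gamma> 0))"
    unfolding *(5) by (rule has_derivative_dx_dy[OF smooth_on_imp_differentiable[OF sf W(2)]])
  from has_derivative_compose[OF *(6)[unfolded has_vector_derivative_def] this]
  have "((\<lambda>s. f (\<gamma> s)) has_derivative (\<lambda>s. dx f z * fst (s *\<^sub>R v) + dy f z * snd (s *\<^sub>R v))) (at 0)" .
  moreover have "((\<lambda>s. f (\<gamma> s)) has_derivative (\<lambda>s. 0)) (at 0)"
    by (rule has_derivative_cong_open[OF J'(1,2), THEN iffD2, OF J'(5)], assumption, rule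
        has_derivative_const)
  ultimately have "(\<lambda>s. dx f z * fst (s *\<^sub>R v) + dy f z * snd (s *\<^sub>R v)) = (\<lambda>s. 0)" by (rule
      has_derivative_unique)
  from fun_cong[OF this, of 1] show ?thesis by simp
qed

text \<open>Along a geodesic the covariant acceleration vanishes, so constancy of \<open>f\<close>
  leaves only the Hessian term on the velocity. The velocity is a nonzero multiple of the kernel
  vector, and the Hessian is homogeneous of degree two.\<close>

lemma geodesic_leaf_sym_cov_deriv:
  assumes W: "open W" "z \<in> W" and f: "local_first_integral W \<F> f" and L: "L \<in> \<F>" "z \<in> L"
    and geo: "unparametrized_geodesic E F G L"
  shows "sym_cov_deriv E F G (dx f) (dy f) z (dy f z) (- dx f z) = 0"
proof -
  obtain J \<gamma> where J: "open J" and g: "geodesic_on E F G J \<gamma>" and reg: "\<And>t. t \<in> J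
      \<Longrightarrow> vector_derivative \<gamma> (at t) \<noteq> 0"
    and LJ: "L = \<gamma> ` J"
    using geo unfolding unparametrized_geodesic_def by blast
  obtain t where t: "t \<in> J" "z = \<gamma> t" using L(2) LJ by blast
  have sm: "smooth_on J \<gamma>" using g by (simp add: geodesic_on_def)
  define x y where "x s = fst (\<gamma> s)" and "y s = snd (\<gamma> s)" for s
  have xy: "smooth_on J x" "smooth_on J y" unfolding x_def[abs_def] y_def[abs_def] by
      (intro smooth_intros J sm)+
  note x1 = smooth_on_deriv[OF J xy(1)] and y1 = smooth_on_deriv[OF J xy(2)]
  note x2 = smooth_on_deriv(2)[OF J x1(1)] and y2 = smooth_on_deriv(2)[OF J y1(1)]
  have sub: "\<gamma> ` J \<subseteq> L" and tW: "\<gamma> t \<in> W" using LJ t W(2) by auto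
  obtain J' where J': "open J'" "t \<in> J'" "J' \<subseteq> J" "\<gamma> ` J' \<subseteq> W" "\<And>s. s \<in> J' \<Longrightarrow> f (\<gamma> s) = f (\<gamma> t)"
    by (rule curve_in_leaf[OF W(1) f L(1) J t(1) smooth_on_imp_continuous_on[OF sm] sub tW], rule that)
  have sf: "smooth_on W f" using f by (simp add: local_first_integral_def)
  have inW: "(x s, y s) \<in> W" and const: "f (x s, y s) = f (\<gamma> t)" if "s \<in> J'" for s
    using J'(4,5) that by (auto simp: x_def y_def)
  have in_J: "s \<in> J" if "s \<in> J'" for s using J'(3) that by blast
  note curve = W(1) sf J'(1,2) x1(2)[OF in_J] y1(2)[OF in_J] x2[OF t(1)] y2[OF t(1)] inW const
  have zt: "(x t, y t) = z" by (simp add: x_def y_def t)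
  have k: "dx f z * deriv x t + dy f z * deriv y t = 0"
    using constant_along_curve(1)[OF curve] unfolding zt .
  have acc: "deriv (deriv x) t + christoffel_111 E F G z * (deriv x t)^2
          + 2 * christoffel_112 E F G z * deriv x t * deriv y t + christoffel_122 E F G z *
              (deriv y t)^2 = 0"
    "deriv (deriv y) t + christoffel_211 E F G z * (deriv x t)^2
          + 2 * christoffel_212 E F G z * deriv x t * deriv y t + christoffel_222 E F G z *
              (deriv y t)^2 = 0"
    using g t(1) unfolding geodesic_on_def Let_def x_def[symmetric] y_def[symmetric] t(2) by auto
  have cov: "sym_cov_deriv E F G (dx f) (dy f) z (deriv x t) (deriv y t) = 0"
    using constant_along_curve(2)[where E = E and F = F and G = G, OF curve] unfolding zt acc by simp
  obtain l where l: "deriv x t = l * dy f z" "deriv y t = l * - dx f z"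
    using kernel_parallel[OF k local_first_integral_nonzero[OF f W(2)]] .
  have "(\<gamma> has_vector_derivative (deriv x t, deriv y t)) (at t)"
  proof -
    have "((\<lambda>s. (x s, y s)) has_vector_derivative (deriv x t, deriv y t)) (at t)"
      by (intro has_vector_derivative_Pair)
        (use x1(2)[OF t(1)] y1(2)[OF t(1)] in \<open>simp_all add:
            has_real_derivative_iff_has_vector_derivative\<close>)
    then show ?thesis by (simp add: x_def y_def)
  qed
  then have "(deriv x t, deriv y t) \<noteq> 0" using reg[OF t(1)] by (simp add: vector_derivative_at)
  then have "l \<noteq> 0" using l by (auto simp: zero_prod_def)
  then show ?thesis using cov unfolding l sym_cov_deriv_scale by simp
qed

text \<open>If the differentials were proportional, both tangent spaces would lie in the kernel of
  the differential of \<open>f\<close>. By transversality the gradient vector of \<open>f\<close>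
  would lie there too, although the differential of \<open>f\<close> takes on it the value of its
  squared length.\<close>

lemma transverse_imp_independent:
  assumes W: "open W" "z \<in> W" and f: "local_first_integral W \<F>1 f" and g: "local_first_integral W \<F>2 g"
    and tr: "transverse_at z \<F>1 \<F>2"
  shows "dx f z * dy g z - dy f z * dx g z \<noteq> 0"
proof
  assume J: "dx f z * dy g z - dy f z * dx g z = 0"
  obtain v w where vw: "(dx f z, dy f z) = v + w" "v \<in> leaf_tangent_space \<F>1 z"
      "w \<in> leaf_tangent_space \<F>2 z"
    using tr unfolding transverse_at_def by blast
  have v: "dx f z * fst v + dy f z * snd v = 0" by (rule leaf_tangent_kernel[OF W f vw(2)])
  have w: "dx g z * fst w + dy g z * snd w = 0" by (rule leaf_tangent_kernel[OF W g vw(3)])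
  obtain l where "fst w = l * dy g z" "snd w = l * - dx g z"
    using kernel_parallel[OF w local_first_integral_nonzero[OF g W(2)]] .
  then have "dx f z * fst w + dy f z * snd w = l * (dx f z * dy g z - dy f z * dx g z)" by
      (simp add: algebra_simps)
  then have "dx f z * fst w + dy f z * snd w = 0" using J by simp
  moreover have "dx f z * (fst v + fst w) + dy f z * (snd v + snd w) = dx f z * dx f z + dy f z * dy f z"
    unfolding fst_add[symmetric] snd_add[symmetric] vw(1)[symmetric] by simp
  ultimately have "dx f z * dx f z + dy f z * dy f z = 0" using v by (simp add: algebra_simps)
  then show False using local_first_integral_nonzero[OF f W(2)] by (simp add: sum_squares_eq_zero_iff)
qed

section \<open>The cubic integral of a web\<close>

lemma linear_form_velocity:
  "a * velocity_x E F G (z, (p, q)) + b * velocity_y E F G (z, (p, q))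
    = (a * G z - b * F z) / metric_det E F G z * p + (b * E z - a * F z) / metric_det E F G z * q"
  by (simp add: velocity_x_def velocity_y_def add_divide_distrib[symmetric]) (simp add: algebra_simps)

text \<open>Raising an index divides the determinant of a pair of forms by det g, so forms that are
  independent as functions of the velocity remain so as functions of the momenta.\<close>

lemma wedge_velocity:
  assumes "metric_det E F G z \<noteq> 0"
  shows "(a1 * G z - a2 * F z) / metric_det E F G z * ((b2 * E z - b1 * F z) / metric_det E F G z)
    - (a2 * E z - a1 * F z) / metric_det E F G z * ((b1 * G z - b2 * F z) / metric_det E F G z)
    = (a1 * b2 - a2 * b1) / metric_det E F G z"
proof -
  have "(a1 * G z - a2 * F z) * (b2 * E z - b1 * F z) - (a2 * E z - a1 * F z) * (b1 * G z - b2 * F z)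
      = (a1 * b2 - a2 * b1) * metric_det E F G z"
    by (simp add: metric_det_def algebra_simps power2_eq_square)
  then show ?thesis using assms by (simp add: diff_divide_distrib[symmetric])
qed

text \<open>Of the conditions in \<open>killing_cubic_first_integral_iff\<close>, closedness is the
  symmetry of second derivatives of \<open>u\<close> and \<open>v\<close>, and the other three say
  that the leaves are geodesics. The neighbourhood shrinks to one on which the functions
  \<open>u\<close>, \<open>v\<close>, \<open>w\<close> of the hexagonality condition exist.\<close>

lemma web_imp_cubic_integral:
  assumes metric: "riemannian_metric_on M E F G" and U: "open U" "m0 \<in> U" "U \<subseteq> M"
    and web: "carries_hexagonal_geodesic_3web U E F G"
  obtains W I where "open W" "m0 \<in> W" "W \<subseteq> U" "cubic_first_integral_on W E F G I"
      "three_distinct_real_roots_on W I"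
proof -
  obtain \<F>1 \<F>2 \<F>3 where three: "three_web_on U \<F>1 \<F>2 \<F>3" and geo: "geodesic_web E F G \<F>1 \<F>2 \<F>3"
    and hex: "hexagonal_web_on U \<F>1 \<F>2 \<F>3"
    using web unfolding carries_hexagonal_geodesic_3web_def by blast
  obtain W u v w where "open W \<and> m0 \<in> W \<and> W \<subseteq> U \<and> local_first_integral W \<F>1 u
      \<and> local_first_integral W \<F>2 v
      \<and> local_first_integral W \<F>3 w \<and> (\<forall>z\<in>W. u z + v z + w z = 0)"
    using bspec[OF hex[unfolded hexagonal_web_on_def] U(2)] by (elim exE) (rule that)
  then have W: "open W" "m0 \<in> W" "W \<subseteq> U" and u: "local_first_integral W \<F>1 u"
    and v: "local_first_integral W \<F>2 v" and w: "local_first_integral W \<F>3 w" and sum: "\<And>z. z \<in> W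
        \<Longrightarrow> u z + v z + w z = 0"
    by simp_all
  have su: "smooth_on W u" and sv: "smooth_on W v" and sw: "smooth_on W w"
    using u v w by (simp_all add: local_first_integral_def)
  have WM: "W \<subseteq> M" using W U by blast
  have EFG: "smooth_on W E" "smooth_on W F" "smooth_on W G"
    using metric by (auto simp: riemannian_metric_on_def intro: smooth_on_subset[OF _ WM])
  have det: "metric_det E F G z \<noteq> 0" if "z \<in> W" for z
    using riemannian_metric_on_det[OF metric, of z] WM that by auto
  have leaf: "\<exists>L\<in>\<F>. z \<in> L" if "\<F> \<in> {\<F>1, \<F>2, \<F>3}" "z \<in> W" for \<F> z
  proof -
    have "foliation_on U \<F>" using that(1) three by (auto simp: three_web_on_def)
    then have "\<Union>\<F> = U" by (simp add: foliation_on_def)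
    then show ?thesis using that(2) W(3) by blast
  qed
  have covf: "sym_cov_deriv E F G (dx f) (dy f) z (dy f z) (- dx f z) = 0"
    if \<F>: "\<F> \<in> {\<F>1, \<F>2, \<F>3}" and f: "local_first_integral W \<F> f" and z: "z \<in> W" for \<F> f z
  proof -
    obtain L where L: "L \<in> \<F>" "z \<in> L" using leaf[OF \<F> z] by blast
    have "unparametrized_geodesic E F G L" using geo \<F> L(1) by (auto simp: geodesic_web_def)
    then show ?thesis by (rule geodesic_leaf_sym_cov_deriv[OF W(1) z f L])
  qed
  define I where "I = killing_cubic E F G (dx u) (dy u) (dx v) (dy v)"
  have J: "dx u z * dy v z - dy u z * dx v z \<noteq> 0" if "z \<in> W" for z
  proof (rule transverse_imp_independent[OF W(1) that u v])
    show "transverse_at z \<F>1 \<F>2" using three W(3) that by (auto simp: three_web_on_def)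
  qed
  note sm = smooth_on_dx[OF su] smooth_on_dy[OF su] smooth_on_dx[OF sv] smooth_on_dy[OF sv]
  have pb: "poisson_bracket I (geodesic_hamiltonian E F G) (z, (p, q)) = 0" if z: "z \<in> W" for z p q
  proof -
    note diff = smooth_on_imp_differentiable[OF _ z]
    have w': "w y = - (u y + v y)" if "y \<in> W" for y using sum[OF that] by simp
    note dw = dx_dy_minus_sum[OF W(1) su sv w' z]
    have "sym_cov_deriv E F G (dx u) (dy u) z X Y + sym_cov_deriv E F G (dx v) (dy v) z X Y
        = - sym_cov_deriv E F G (dx w) (dy w) z X Y" for X Y
      by (simp add: dw(3))
    \<comment> \<open>The kernel vector belonging to \<open>w = - (u + v)\<close> has the opposite
      sign; the Hessian is even, so the sign drops out.\<close>
    moreover have "sym_cov_deriv E F G (dx w) (dy w) z (dy u z + dy v z) (- (dx u z + dx v z)) = 0"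
    proof -
      have "dy u z + dy v z = -1 * dy w z" "- (dx u z + dx v z) = -1 * - dx w z" by
          (simp_all add: dw(1,2))
      then show ?thesis using covf[OF _ w z] by (simp only: sym_cov_deriv_scale) simp
    qed
    ultimately have 3: "sym_cov_deriv E F G (dx u) (dy u) z (dy u z + dy v z) (- (dx u z + dx v z))
        + sym_cov_deriv E F G (dx v) (dy v) z (dy u z + dy v z) (- (dx u z + dx v z)) = 0" by simp
    have 1: "sym_cov_deriv E F G (dx u) (dy u) z (dy u z) (- dx u z) = 0" by (rule covf[OF _ u z]) simp
    have 2: "sym_cov_deriv E F G (dx v) (dy v) z (dy v z) (- dx v z) = 0" by (rule covf[OF _ v z]) simp
    have "\<forall>p q. poisson_bracket I (geodesic_hamiltonian E F G) (z, (p, q)) = 0"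
      unfolding I_def
      by (rule killing_cubic_first_integral_iff[OF diff[OF EFG(1)] diff[OF EFG(2)] diff[OF EFG(3)]
          diff[OF sm(1)] diff[OF sm(2)] diff[OF sm(3)] diff[OF sm(4)] det[OF z] J[OF z], THEN iffD2])
        (intro conjI 1 2 3 mixed_partials[OF W(1) su z, symmetric]
            mixed_partials[OF W(1) sv z, symmetric])
    then show ?thesis by blast
  qed
  let ?D = "metric_det E F G"
  have sD: "smooth_on W ?D" unfolding metric_det_def[abs_def] by (intro smooth_intros W EFG)
  \<comment> \<open>The coefficients of \<open>p\<close> and \<open>q\<close> when the form
    \<open>a dx + b dy\<close> is evaluated on the velocity.\<close>
  define l1 l2 where "l1 a b z = (a z * G z - b z * F z) / ?D z" and "l2 a b z =
      (b z * E z - a z * F z) / ?D z"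
    for a b :: scalar_field and z
  have sl: "smooth_on W (l1 a b)" "smooth_on W (l2 a b)" if "smooth_on W a" "smooth_on W b" for a b
    unfolding l1_def[abs_def] l2_def[abs_def] by (intro smooth_intros W EFG sD that; use det in simp)+
  define k where "k z = ?D z / (dx u z * dy v z - dy u z * dx v z)^2" for z
  have k: "smooth_on W k"
    unfolding k_def[abs_def] by (intro smooth_intros W sD sm) (use J in simp)
  define c1 c2 where "c1 z = - dx u z - dx v z" and "c2 z = - dy u z - dy v z" for z
  have sc: "smooth_on W c1" "smooth_on W c2"
    unfolding c1_def[abs_def] c2_def[abs_def] by (intro smooth_intros W sm)+
  have I: "I (z, (p, q)) = k z * ((l1 (dx u) (dy u) z * p + l2 (dx u) (dy u) z * q) * (l1 (dx v)
      (dy v) z * p + l2 (dx v) (dy v) z * q)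
      * (l1 c1 c2 z * p + l2 c1 c2 z * q))" for z p q
    unfolding I_def killing_cubic_def k_def l1_def l2_def c1_def c2_def by
        (simp add: linear_form_velocity)
  note cub = smooth_cubic_product[OF W(1) k sl[OF sm(1,2)] sl[OF sm(3,4)] sl[OF sc] I]
  have "cubic_first_integral_on W E F G I"
    unfolding cubic_first_integral_on_def
  proof (intro conjI cub ballI)
    fix \<xi> :: phase_point assume "\<xi> \<in> W \<times> UNIV"
    then obtain z p q where \<xi>: "z \<in> W" "\<xi> = (z, (p, q))" by (auto simp: mem_Times_iff prod_eq_iff)
    show "poisson_bracket I (geodesic_hamiltonian E F G) \<xi> = 0" unfolding \<xi>(2) by (rule pb[OF \<xi>(1)])
  qed
  moreover have "three_distinct_real_roots_on W I"
    unfolding three_distinct_real_roots_on_def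
  proof
    fix z assume z: "z \<in> W"
    show "card (real_roots_at I z) = 3"
    proof (rule card_real_roots_product[OF _ _ _ _ I])
      show "k z \<noteq> 0" using det[OF z] J[OF z] by (simp add: k_def)
      show "l1 (dx u) (dy u) z * l2 (dx v) (dy v) z - l2 (dx u) (dy u) z * l1 (dx v) (dy v) z \<noteq> 0"
        unfolding l1_def l2_def wedge_velocity[OF det[OF z]] using J[OF z] det[OF z] by simp
      have "dx u z * c2 z - dy u z * c1 z = - (dx u z * dy v z - dy u z * dx v z)"
        "dx v z * c2 z - dy v z * c1 z = dx u z * dy v z - dy u z * dx v z"
        by (simp_all add: c1_def c2_def algebra_simps)
      then show "l1 (dx u) (dy u) z * l2 c1 c2 z - l2 (dx u) (dy u) z * l1 c1 c2 z \<noteq> 0"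
        "l1 (dx v) (dy v) z * l2 c1 c2 z - l2 (dx v) (dy v) z * l1 c1 c2 z \<noteq> 0"
        unfolding l1_def l2_def wedge_velocity[OF det[OF z]] using J[OF z] det[OF z] by simp_all
    qed
  qed
  ultimately show ?thesis by (rule that[OF W])
qed

section \<open>From cubic integrals to webs\<close>

text \<open>A linear change of the target coordinates. It lets one chart \<open>(u, v)\<close> serve
  all three foliations by moving a different function into the second slot.\<close>

lemma foliation_chart_linear:
  assumes "foliation_chart U V \<Phi> \<Psi>" and A: "bounded_linear A" "bounded_linear B"
    and AB: "\<And>w. A (B w) = w" "\<And>w. B (A w) = w"
  shows "foliation_chart U (B -` V) (\<lambda>z. A (\<Phi> z)) (\<lambda>w. \<Psi> (B w))"
proof -
  interpret foliation_chart U V \<Phi> \<Psi> by fact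
  have oBV: "open (B -` V)" by (intro open_vimage open_V linear_continuous_on A)
  have s1: "smooth_on U (\<lambda>z. A (\<Phi> z))" by (rule
      smooth_on_bounded_linear_compose[OF open_U A(1) smooth_\<Phi>])
  have s2: "smooth_on (B -` V) (\<lambda>w. \<Psi> (B w))"
    by (rule smooth_on_compose[OF oBV open_V _ smooth_\<Psi> smooth_on_bounded_linear[OF A(2)]]) auto
  show ?thesis
  proof
    show "convex (B -` V)" by (rule convex_linear_vimage[OF bounded_linear.linear[OF A(2)] convex_V])
    show "homeomorphism U (B -` V) (\<lambda>z. A (\<Phi> z)) (\<lambda>w. \<Psi> (B w))"
      by (rule homeomorphismI[OF smooth_on_imp_continuous_on[OF s1] smooth_on_imp_continuous_on[OF s2]])
        (auto simp: AB \<Psi>U \<Phi>V \<Psi>\<Phi> \<Phi>\<Psi>)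
  qed (fact open_U oBV s1 s2)+
qed

lemma transverse_atI:
  assumes "\<And>v. a1 * fst v + a2 * snd v = 0 \<Longrightarrow> v \<in> leaf_tangent_space \<F>1 m"
    and "\<And>v. b1 * fst v + b2 * snd v = 0 \<Longrightarrow> v \<in> leaf_tangent_space \<F>2 m"
    and J: "a1 * b2 - a2 * b1 \<noteq> 0"
  shows "transverse_at m \<F>1 \<F>2"
proof -
  have "\<exists>v w. x = v + w \<and> v \<in> leaf_tangent_space \<F>1 m \<and> w \<in> leaf_tangent_space \<F>2 m" for x :: point
  proof -
    \<comment> \<open>By Cramer's rule \<open>x\<close> is \<open>s\<close> times the kernel vector
      \<open>(- a2, a1)\<close> of the first form plus \<open>t\<close> times the kernel vector
      \<open>(b2, - b1)\<close> of the second.\<close>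
    define s where "s = (b1 * fst x + b2 * snd x) / (a1 * b2 - a2 * b1)"
    define t where "t = (a1 * fst x + a2 * snd x) / (a1 * b2 - a2 * b1)"
    have st: "s * (a1 * b2 - a2 * b1) = b1 * fst x + b2 * snd x" "t * (a1 * b2 - a2 * b1)
        = a1 * fst x + a2 * snd x"
      using J by (simp_all add: s_def t_def)
    have "(s * - a2 + t * b2) * (a1 * b2 - a2 * b1) = fst x * (a1 * b2 - a2 * b1)"
      "(s * a1 + t * - b1) * (a1 * b2 - a2 * b1) = snd x * (a1 * b2 - a2 * b1)"
      using st by algebra+
    then have "s * - a2 + t * b2 = fst x" "s * a1 + t * - b1 = snd x"
      using J by (simp_all only: mult_cancel_right) auto
    then have "x = (s * - a2, s * a1) + (t * b2, t * - b1)" by (simp add: prod_eq_iff)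
    moreover have "(s * - a2, s * a1) \<in> leaf_tangent_space \<F>1 m" by (rule assms(1)) simp
    moreover have "(t * b2, t * - b1) \<in> leaf_tangent_space \<F>2 m" by (rule assms(2)) simp
    ultimately show ?thesis by blast
  qed
  then show ?thesis unfolding transverse_at_def by auto
qed

context foliation_chart
begin

lemma leaves_local_first_integral:
  assumes f: "\<And>z. z \<in> U \<Longrightarrow> f z = snd (\<Phi> z)" "smooth_on U f" "\<And>z. z \<in> U \<Longrightarrow> (dx f z, dy f z) \<noteq> (0, 0)"
  shows "local_first_integral U leaves f"
  unfolding local_first_integral_def
proof (intro conjI ballI f(2))
  show "frechet_derivative f (at z) \<noteq> (\<lambda>v. 0)" if "z \<in> U" for z
    using f(3)[OF that] by (auto simp: dx_def dy_def)
  fix L assume L: "L \<in> induced_leaves U leaves"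
  then have LU: "L \<subseteq> U" unfolding induced_leaves_def using path_component_subset by blast
  obtain c where c: "\<And>x. x \<in> L \<Longrightarrow> snd (\<Phi> x) = c"
    using snd_constant_on_induced_leaves[OF L] unfolding constant_on_def by blast
  have "f x = c" if "x \<in> L" for x using f(1)[of x] c[OF that] LU that by auto
  then show "f constant_on L" unfolding constant_on_def by blast
qed

lemma kernel_leaf_tangent:
  assumes f: "\<And>z. z \<in> U \<Longrightarrow> f z = snd (\<Phi> z)" "smooth_on U f" and m: "m \<in> U"
    and v: "dx f m * fst v + dy f m * snd v = 0"
  shows "v \<in> leaf_tangent_space leaves m"
proof (rule kernel_subset_tangent[OF m])
  have "frechet_derivative (\<lambda>z. snd (\<Phi> z)) (at m) = frechet_derivative f (at m)"
    by (rule frechet_derivative_cong_open[OF open_U m]) (simp add: f(1))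
  then show "frechet_derivative (\<lambda>z. snd (\<Phi> z)) (at m) v = 0"
    using frechet_derivative_dx_dy[OF f(2) m] v by simp
qed

end

text \<open>The three roots at \<open>m0\<close> are simple and continue smoothly one by one. The
  scalar factor is the quotient of the cubic and the product of linear forms in a fixed direction
  \<open>(ep, eq)\<close> which is not a root at \<open>m0\<close>.\<close>

lemma smooth_cubic_factor:
  fixes a b c d :: scalar_field
  assumes U: "open U" "m0 \<in> U" and sm: "smooth_on U a" "smooth_on U b" "smooth_on U c" "smooth_on U d"
    and I: "\<And>z p q. z \<in> U \<Longrightarrow> I (z, (p, q)) = a z * p^3 + b z * p^2 * q + c z * p * q^2 + d z * q^3"
    and roots: "card (real_roots_at I m0) = 3"
  obtains W k P1 Q1 P2 Q2 P3 Q3 where "open W" "m0 \<in> W" "W \<subseteq> U"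
    "\<And>z p q. z \<in> W \<Longrightarrow> I (z, (p, q)) = k z * ((P1 z * q - Q1 z * p) * (P2 z * q - Q2 z * p) *
        (P3 z * q - Q3 z * p))"
    "smooth_on W k" "smooth_on W P1" "smooth_on W Q1" "smooth_on W P2" "smooth_on W Q2"
        "smooth_on W P3" "smooth_on W Q3"
    "\<And>z. z \<in> W \<Longrightarrow> k z \<noteq> 0" "\<And>z. z \<in> W \<Longrightarrow> P1 z * Q2 z - Q1 z * P2 z \<noteq> 0"
    "\<And>z. z \<in> W \<Longrightarrow> P1 z * Q3 z - Q1 z * P3 z \<noteq> 0" "\<And>z. z \<in> W \<Longrightarrow> P2 z * Q3 z - Q2 z * P3 z \<noteq> 0"
proof -
  obtain p1 q1 p2 q2 p3 q3 where ind: "p1 * q2 - q1 * p2 \<noteq> 0" "p1 * q3 - q1 * p3 \<noteq> 0"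
      "p2 * q3 - q2 * p3 \<noteq> 0"
    and zero: "I (m0, (p1, q1)) = 0" "I (m0, (p2, q2)) = 0" "I (m0, (p3, q3)) = 0"
    by (rule three_root_vectors[OF roots], rule that)
  obtain ep eq where e: "I (m0, (ep, eq)) \<noteq> 0" by (rule finite_roots_imp_nonzero[OF roots], rule that)
  note zero' = zero[unfolded I[OF U(2)]] and e' = e[unfolded I[OF U(2)]]
  have nz: "(p1, q1) \<noteq> (0, 0)" "(p2, q2) \<noteq> (0, 0)" "(p3, q3) \<noteq> (0, 0)" using ind by auto
  note Le = cubic_form_nonzero_imp_not_parallel[OF zero'(1) e' nz(1)]
    cubic_form_nonzero_imp_not_parallel[OF zero'(2) e' nz(2)]
        cubic_form_nonzero_imp_not_parallel[OF zero'(3) e' nz(3)]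
  define h where "h z p q = a z * p^3 + b z * p^2 * q + c z * p * q^2 + d z * q^3" for z p q
  define k0 where "k0 = h m0 ep eq / ((p1 * eq - q1 * ep) * (p2 * eq - q2 * ep) * (p3 * eq - q3 * ep))"
  have fac: "a m0 * p^3 + b m0 * p^2 * q + c m0 * p * q^2 + d m0 * q^3
      = k0 * ((p1 * q - q1 * p) * (p2 * q - q2 * p) * (p3 * q - q3 * p))" for p q
    unfolding k0_def h_def by (rule cubic_form_factor[OF zero' ind Le])
  have k0: "k0 \<noteq> 0" using e' Le by (simp add: k0_def h_def)
  \<comment> \<open>The continuation lemma treats the root listed first, so the factors are permuted
    to bring each root to the front.\<close>
  have fac2: "a m0 * p^3 + b m0 * p^2 * q + c m0 * p * q^2 + d m0 * q^3
      = k0 * ((p2 * q - q2 * p) * (p1 * q - q1 * p) * (p3 * q - q3 * p))"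
    and fac3: "a m0 * p^3 + b m0 * p^2 * q + c m0 * p * q^2 + d m0 * q^3
      = k0 * ((p3 * q - q3 * p) * (p1 * q - q1 * p) * (p2 * q - q2 * p))" for p q
    unfolding fac by (simp_all add: mult_ac)
  have ind': "p2 * q1 - q2 * p1 \<noteq> 0" "p3 * q1 - q3 * p1 \<noteq> 0" "p3 * q2 - q3 * p2 \<noteq> 0"
    using ind by (auto simp: mult.commute)
  obtain W1 P1 Q1 where W1: "open W1" "m0 \<in> W1" "W1 \<subseteq> U" "smooth_on W1 P1" "smooth_on W1 Q1" "P1 m0
      = p1" "Q1 m0 = q1"
    and r1: "\<And>z. z \<in> W1 \<Longrightarrow> a z * (P1 z)^3 + b z * (P1 z)^2 * Q1 z + c z * P1 z * (Q1 z)^2 + d z *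
        (Q1 z)^3 = 0"
    by (rule smooth_root[OF U sm fac k0 ind(1,2)], rule that)
  obtain W2 P2 Q2 where W2: "open W2" "m0 \<in> W2" "W2 \<subseteq> U" "smooth_on W2 P2" "smooth_on W2 Q2" "P2 m0
      = p2" "Q2 m0 = q2"
    and r2: "\<And>z. z \<in> W2 \<Longrightarrow> a z * (P2 z)^3 + b z * (P2 z)^2 * Q2 z + c z * P2 z * (Q2 z)^2 + d z *
        (Q2 z)^3 = 0"
    by (rule smooth_root[OF U sm fac2 k0 ind'(1) ind(3)], rule that)
  obtain W3 P3 Q3 where W3: "open W3" "m0 \<in> W3" "W3 \<subseteq> U" "smooth_on W3 P3" "smooth_on W3 Q3" "P3 m0
      = p3" "Q3 m0 = q3"
    and r3: "\<And>z. z \<in> W3 \<Longrightarrow> a z * (P3 z)^3 + b z * (P3 z)^2 * Q3 z + c z * P3 z * (Q3 z)^2 + d z *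
        (Q3 z)^3 = 0"
    by (rule smooth_root[OF U sm fac3 k0 ind'(2,3)], rule that)
  define W0 where "W0 = W1 \<inter> W2 \<inter> W3"
  have W0: "open W0" "m0 \<in> W0" "W0 \<subseteq> U" using W1 W2 W3 by (auto simp: W0_def)
  have s0: "smooth_on W0 P1" "smooth_on W0 Q1" "smooth_on W0 P2" "smooth_on W0 Q2" "smooth_on W0 P3"
      "smooth_on W0 Q3"
    using smooth_on_subset[OF W1(4), of W0] smooth_on_subset[OF W1(5), of W0]
        smooth_on_subset[OF W2(4), of W0]
      smooth_on_subset[OF W2(5), of W0] smooth_on_subset[OF W3(4), of W0]
          smooth_on_subset[OF W3(5), of W0]
    by (auto simp: W0_def)
  note sm0 = sm[THEN smooth_on_subset[OF _ W0(3)]]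
  have sh: "smooth_on W0 (\<lambda>z. h z ep eq)" unfolding h_def by (intro smooth_intros W0 sm0)
  define K where "K z = (P1 z * eq - Q1 z * ep) * (P2 z * eq - Q2 z * ep) *
      (P3 z * eq - Q3 z * ep)" for z
  have sK: "smooth_on W0 K" unfolding K_def[abs_def] by (intro smooth_intros W0 s0)
  \<comment> \<open>One smooth function whose nonvanishing encodes that the roots remain distinct
    and that the reference direction stays off the roots.\<close>
  define N where "N z = (P1 z * Q2 z - Q1 z * P2 z) * (P1 z * Q3 z - Q1 z * P3 z) *
      (P2 z * Q3 z - Q2 z * P3 z) * (h z ep eq * K z)" for z
  have sN: "smooth_on W0 N" unfolding N_def[abs_def] by (intro smooth_intros W0 s0 sh sK)
  define W where "W = {z \<in> W0. N z \<noteq> 0}"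
  have oW: "open W"
    using continuous_open_preimage[OF smooth_on_imp_continuous_on[OF sN] W0(1), of "- {0}"]
    by (simp add: W_def vimage_def Int_def open_Compl)
  have N0: "N m0 \<noteq> 0" using ind e' Le W1(6,7) W2(6,7) W3(6,7) by (simp add: N_def K_def h_def)
  have WW0: "W \<subseteq> W0" by (auto simp: W_def)
  have K: "K z \<noteq> 0" "h z ep eq \<noteq> 0" if "z \<in> W" for z using that by (auto simp: W_def N_def)
  show ?thesis
  proof (rule that[OF oW, of "\<lambda>z. h z ep eq / K z" P1 Q1 P2 Q2 P3 Q3])
    show "m0 \<in> W" using W0 N0 by (simp add: W_def)
    show "W \<subseteq> U" using WW0 W0 by blast
    show "smooth_on W (\<lambda>z. h z ep eq / K z)"
      by (intro smooth_intros oW smooth_on_subset[OF sh WW0] smooth_on_subset[OF sK WW0])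
          (use K in blast)
    show "smooth_on W P1" "smooth_on W Q1" "smooth_on W P2" "smooth_on W Q2" "smooth_on W P3"
        "smooth_on W Q3"
      by (intro s0[THEN smooth_on_subset] WW0)+
    fix z assume z: "z \<in> W"
    then have zW: "z \<in> W1" "z \<in> W2" "z \<in> W3" "z \<in> U" using WW0 W0 by (auto simp: W0_def)
    show "h z ep eq / K z \<noteq> 0" using K[OF z] by simp
    show i: "P1 z * Q2 z - Q1 z * P2 z \<noteq> 0" "P1 z * Q3 z - Q1 z * P3 z \<noteq> 0"
        "P2 z * Q3 z - Q2 z * P3 z \<noteq> 0"
      using z by (auto simp: W_def N_def)
    have k: "P1 z * eq - Q1 z * ep \<noteq> 0" "P2 z * eq - Q2 z * ep \<noteq> 0" "P3 z * eq - Q3 z * ep \<noteq> 0"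
      using K(1)[OF z] by (auto simp: K_def)
    fix p q
    show "I (z, (p, q)) = h z ep eq / K z * ((P1 z * q - Q1 z * p) * (P2 z * q - Q2 z * p) *
        (P3 z * q - Q3 z * p))"
      unfolding I[OF zW(4)] h_def K_def
      by (rule cubic_form_factor[OF r1[OF zW(1)] r2[OF zW(2)] r3[OF zW(3)] i k])
  qed
qed

text \<open>The leaves are the level curves of \<open>u\<close>, \<open>v\<close> and
  \<open>w = - (u + v)\<close>. Hexagonality then holds by construction, and the three covariant
  conditions make the leaves geodesics.\<close>

lemma geodesic_web_from_potentials:
  assumes W: "open W" "m \<in> W" and uv: "smooth_on W u" "smooth_on W v"
    and EFG: "smooth_on W E" "smooth_on W F" "smooth_on W G" and det: "\<And>z. z \<in> W
        \<Longrightarrow> metric_det E F G z \<noteq> 0"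
    and J: "dx u m * dy v m - dy u m * dx v m \<noteq> 0"
    and cov: "\<And>z. z \<in> W \<Longrightarrow> sym_cov_deriv E F G (dx u) (dy u) z (dy u z) (- dx u z) = 0"
      "\<And>z. z \<in> W \<Longrightarrow> sym_cov_deriv E F G (dx v) (dy v) z (dy v z) (- dx v z) = 0"
      "\<And>z. z \<in> W \<Longrightarrow> sym_cov_deriv E F G (dx u) (dy u) z (dy u z + dy v z) (- (dx u z + dx v z))
        + sym_cov_deriv E F G (dx v) (dy v) z (dy u z + dy v z) (- (dx u z + dx v z)) = 0"
  obtains U where "open U" "m \<in> U" "U \<subseteq> W" "carries_hexagonal_geodesic_3web U E F G"
proof -
  let ?\<Phi> = "\<lambda>z. (u z, v z)"
  obtain W' V g where W': "open W'" "W' \<subseteq> W" "m \<in> W'" and V: "open V" and hom: "homeomorphism W' V ?\<Phi> g"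
    and g: "smooth_on V g" and J': "\<And>z. z \<in> W' \<Longrightarrow> dx u z * dy v z - dy u z * dx v z \<noteq> 0"
    by (rule smooth_plane_chart[OF W uv J], rule that)
  have mV: "?\<Phi> m \<in> V" using hom W'(3) by (auto simp: homeomorphism_def)
  then obtain e where e: "e > 0" "ball (?\<Phi> m) e \<subseteq> V" using V open_contains_ball by blast
  \<comment> \<open>The ball is convex, and so are its preimages under linear maps. All three
    foliations can thus be built over the same \<open>U\<close> with connected leaves.\<close>
  define B where "B = ball (?\<Phi> m) e"
  define U where "U = {z \<in> W'. ?\<Phi> z \<in> B}"
  have B: "open B" "convex B" "B \<subseteq> V" "?\<Phi> m \<in> B" using e by (auto simp: B_def)
  have sW': "smooth_on W' ?\<Phi>" by (intro smooth_intros W' uv[THEN smooth_on_subset])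
  have oU: "open U"
    using continuous_open_preimage[OF smooth_on_imp_continuous_on[OF sW'] W'(1) B(1)]
    by (simp add: U_def vimage_def Int_def)
  have mU: "m \<in> U" and UW': "U \<subseteq> W'" using B W' by (auto simp: U_def)
  then have UW: "U \<subseteq> W" using W' by blast
  have gU: "g w \<in> U" "?\<Phi> (g w) = w" if "w \<in> B" for w
  proof -
    have "w \<in> V" using that B by blast
    then have "g w \<in> W'" and e: "?\<Phi> (g w) = w" using hom by (auto simp: homeomorphism_def)
    then show "g w \<in> U" "?\<Phi> (g w) = w" using that by (simp_all add: U_def)
  qed
  have gz: "g (?\<Phi> z) = z" "?\<Phi> z \<in> B" if "z \<in> U" for z
    using that hom by (auto simp: U_def homeomorphism_def)
  note uvU = uv[THEN smooth_on_subset[OF _ UW]] and EFGU = EFG[THEN smooth_on_subset[OF _ UW]]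
  have s\<Phi>: "smooth_on U ?\<Phi>" by (intro smooth_intros oU uvU)
  have gB: "smooth_on B g" by (rule smooth_on_subset[OF g B(3)])
  have C2: "foliation_chart U B ?\<Phi> g"
  proof
    show "homeomorphism U B ?\<Phi> g"
    proof (rule homeomorphismI[OF smooth_on_imp_continuous_on[OF s\<Phi>] smooth_on_imp_continuous_on[OF gB]])
      show "?\<Phi> ` U \<subseteq> B" "g ` B \<subseteq> U" using gz(2) gU(1) by blast+
    qed (use gz gU in blast)+
  qed (fact oU B s\<Phi> gB)+
  \<comment> \<open>These linear maps move \<open>u\<close> and \<open>- (u + v)\<close> into the
    second coordinate. Both are involutions and therefore serve as their own inverses.\<close>
  let ?A1 = "\<lambda>w::point. (snd w, fst w)" and ?A3 = "\<lambda>w::point. (fst w, - (fst w + snd w))"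
  have bl: "bounded_linear ?A1" "bounded_linear ?A3"
    by (intro bounded_linear_Pair bounded_linear_minus bounded_linear_add bounded_linear_fst
        bounded_linear_snd)+
  have C1: "foliation_chart U (?A1 -` B) (\<lambda>z. (v z, u z)) (\<lambda>w. g (?A1 w))"
    using foliation_chart_linear[OF C2 bl(1) bl(1)] by simp
  have C3: "foliation_chart U (?A3 -` B) (\<lambda>z. (u z, - (u z + v z))) (\<lambda>w. g (?A3 w))"
    using foliation_chart_linear[OF C2 bl(2) bl(2)] by simp
  define w where "w z = - (u z + v z)" for z
  have sw: "smooth_on U w" unfolding w_def[abs_def] by (intro smooth_intros oU uvU)
  note dw = dx_dy_minus_sum[OF oU uvU w_def]
  define \<F>1 where "\<F>1 = foliation_chart.leaves U (?A1 -` B) (\<lambda>z. (v z, u z))"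
  define \<F>2 where "\<F>2 = foliation_chart.leaves U B ?\<Phi>"
  define \<F>3 where "\<F>3 = foliation_chart.leaves U (?A3 -` B) (\<lambda>z. (u z, - (u z + v z)))"
  have detU: "\<forall>z\<in>U. metric_det E F G z \<noteq> 0" using det UW by blast
  have JU: "dx u z * dy v z - dy u z * dx v z \<noteq> 0" if "z \<in> U" for z using J' UW' that by blast
  have nz: "(dx u z, dy u z) \<noteq> (0, 0)" "(dx v z, dy v z) \<noteq> (0, 0)" "(dx w z, dy w z) \<noteq> (0, 0)" if z:
      "z \<in> U" for z
  proof -
    show "(dx u z, dy u z) \<noteq> (0, 0)" "(dx v z, dy v z) \<noteq> (0, 0)" using JU[OF z] by auto
    show "(dx w z, dy w z) \<noteq> (0, 0)"
    proof
      assume "(dx w z, dy w z) = (0, 0)"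
      then have "dx v z = - dx u z" "dy v z = - dy u z" using dw(1,2)[OF z] by simp_all
      then show False using JU[OF z] by simp
    qed
  qed
  have covw: "sym_cov_deriv E F G (dx w) (dy w) z (dy w z) (- dx w z) = 0" if z: "z \<in> U" for z
  proof -
    have zW: "z \<in> W" using z UW by blast
    have "dy w z = -1 * (dy u z + dy v z)" "- dx w z = -1 * - (dx u z + dx v z)" using dw(1,2)[OF z]
        by simp_all
    then show ?thesis
      unfolding dw(3)[OF z] by (simp only: sym_cov_deriv_scale distrib_left[symmetric] cov(3)[OF zW])
  qed
  have covU: "sym_cov_deriv E F G (dx u) (dy u) z (dy u z) (- dx u z) = 0"
      "sym_cov_deriv E F G (dx v) (dy v) z (dy v z) (- dx v z) = 0" if "z \<in> U" for z
    by (rule cov(1)[OF subsetD[OF UW that]], rule cov(2)[OF subsetD[OF UW that]])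
  have snd1: "u z = snd (v z, u z)" and snd2: "v z = snd (?\<Phi> z)" and snd3: "w z = snd (u z, - (u z
      + v z))" for z
    by (simp_all add: w_def)
  have fol: "foliation_on U \<F>1" "foliation_on U \<F>2" "foliation_on U \<F>3"
    unfolding \<F>1_def \<F>2_def \<F>3_def
    by (fact foliation_chart.foliation[OF C1] foliation_chart.foliation[OF C2]
        foliation_chart.foliation[OF C3])+
  have lfi: "local_first_integral U \<F>1 u" "local_first_integral U \<F>2 v" "local_first_integral U \<F>3 w"
  proof -
    show "local_first_integral U \<F>1 u" unfolding \<F>1_def
      by (rule foliation_chart.leaves_local_first_integral[OF C1 snd1 uvU(1) nz(1)])
    show "local_first_integral U \<F>2 v" unfolding \<F>2_def
      by (rule foliation_chart.leaves_local_first_integral[OF C2 snd2 uvU(2) nz(2)])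
    show "local_first_integral U \<F>3 w" unfolding \<F>3_def
      by (rule foliation_chart.leaves_local_first_integral[OF C3 snd3 sw nz(3)])
  qed
  have geo: "unparametrized_geodesic E F G L" if "L \<in> \<F>1 \<union> \<F>2 \<union> \<F>3" for L
    using that
  proof (elim UnE)
    assume L: "L \<in> \<F>1"
    show ?thesis
      by (rule foliation_chart.geodesic_leaves[OF C1 EFGU detU snd1 uvU(1) nz(1) covU(1) L[unfolded
          \<F>1_def]])
  next
    assume L: "L \<in> \<F>2"
    show ?thesis
      by (rule foliation_chart.geodesic_leaves[OF C2 EFGU detU snd2 uvU(2) nz(2) covU(2) L[unfolded
          \<F>2_def]])
  next
    assume L: "L \<in> \<F>3"
    show ?thesis
      by (rule foliation_chart.geodesic_leaves[OF C3 EFGU detU snd3 sw nz(3) covw L[unfolded \<F>3_def]])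
  qed
  have tr: "transverse_at z \<F>1 \<F>2" "transverse_at z \<F>1 \<F>3" "transverse_at z \<F>2 \<F>3" if z: "z \<in> U" for z
  proof -
    note k1 = foliation_chart.kernel_leaf_tangent[OF C1 snd1 uvU(1) z, folded \<F>1_def]
    note k2 = foliation_chart.kernel_leaf_tangent[OF C2 snd2 uvU(2) z, folded \<F>2_def]
    note k3 = foliation_chart.kernel_leaf_tangent[OF C3 snd3 sw z, folded \<F>3_def]
    show "transverse_at z \<F>1 \<F>2" by (rule transverse_atI[OF k1 k2 JU[OF z]])
    have "dx u z * dy w z - dy u z * dx w z = - (dx u z * dy v z - dy u z * dx v z)"
      "dx v z * dy w z - dy v z * dx w z = dx u z * dy v z - dy u z * dx v z"
      by (simp_all add: dw(1,2)[OF z] algebra_simps)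
    then have n: "dx u z * dy w z - dy u z * dx w z \<noteq> 0" "dx v z * dy w z - dy v z * dx w z \<noteq> 0"
      using JU[OF z] by simp_all
    show "transverse_at z \<F>1 \<F>3" by (rule transverse_atI[OF k1 k3 n(1)])
    show "transverse_at z \<F>2 \<F>3" by (rule transverse_atI[OF k2 k3 n(2)])
  qed
  have "three_web_on U \<F>1 \<F>2 \<F>3" unfolding three_web_on_def using fol tr by simp
  moreover have "geodesic_web E F G \<F>1 \<F>2 \<F>3" unfolding geodesic_web_def using geo by simp
  moreover have "hexagonal_web_on U \<F>1 \<F>2 \<F>3"
    unfolding hexagonal_web_on_def
    by (intro ballI exI[of _ U] exI[of _ u] exI[of _ v] exI[of _ w] conjI oU lfi) (simp_all add: w_def)
  ultimately have "carries_hexagonal_geodesic_3web U E F G"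
    unfolding carries_hexagonal_geodesic_3web_def by (intro exI conjI)
  then show ?thesis by (rule that[OF oU mU UW])
qed

text \<open>Any product of three pairwise independent linear forms is a killing cubic: the sum of the three
  forms is normalised to zero by the factors \<open>w\<^sub>2\<^sub>3\<close>, \<open>w\<^sub>3\<^sub>1\<close>, \<open>w\<^sub>1\<^sub>2\<close>, and the remaining
  common factor \<open>s\<close> is determined since the cubic has homogeneity \<open>- 1\<close> in it.\<close>
lemma killing_cubic_normal_form:
  fixes P1 Q1 P2 Q2 P3 Q3 k E F G :: real
  defines "D \<equiv> E * G - F^2"
  defines "c1 \<equiv> P1 * F - Q1 * E" and "c2 \<equiv> P2 * F - Q2 * E" and "c3 \<equiv> P3 * F - Q3 * E"
    and "d1 \<equiv> P1 * G - Q1 * F" and "d2 \<equiv> P2 * G - Q2 * F" and "d3 \<equiv> P3 * G - Q3 * F"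
  defines "w23 \<equiv> c2 * d3 - d2 * c3" and "w31 \<equiv> c3 * d1 - d3 * c1" and "w12 \<equiv> c1 * d2 - d1 * c2"
  defines "s \<equiv> D / (k * (w12 * w23 * w31))"
  assumes D: "D \<noteq> 0" and k: "k \<noteq> 0"
    and ind: "P1 * Q2 - Q1 * P2 \<noteq> 0" "P1 * Q3 - Q1 * P3 \<noteq> 0" "P2 * Q3 - Q2 * P3 \<noteq> 0"
  shows "w12 \<noteq> 0" "w23 \<noteq> 0" "w31 \<noteq> 0"
    and "(s * w23 * c1) * (s * w31 * d2) - (s * w23 * d1) * (s * w31 * c2) \<noteq> 0" (is ?G1)
    and "D / ((s * w23 * c1) * (s * w31 * d2) - (s * w23 * d1) * (s * w31 * c2))^2
      * ((s * w23 * c1 * X + s * w23 * d1 * Y) * (s * w31 * c2 * X + s * w31 * d2 * Y)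
        * ((- (s * w23 * c1) - s * w31 * c2) * X + (- (s * w23 * d1) - s * w31 * d2) * Y))
      = k * ((P1 * (F * X + G * Y) - Q1 * (E * X + F * Y)) * (P2 * (F * X + G * Y) - Q2 * (E * X
          + F * Y))
        * (P3 * (F * X + G * Y) - Q3 * (E * X + F * Y)))" (is ?G2)
proof -
  have "w12 = D * (P1 * Q2 - Q1 * P2)" "w23 = D * (P2 * Q3 - Q2 * P3)" "w31 = - (D *
      (P1 * Q3 - Q1 * P3))"
    unfolding w12_def w23_def w31_def c1_def c2_def c3_def d1_def d2_def d3_def D_def
    by (simp_all add: algebra_simps power2_eq_square)
  then show w: "w12 \<noteq> 0" "w23 \<noteq> 0" "w31 \<noteq> 0" using D ind by simp_all
  define N where "N = w12 * w23 * w31"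
  have N: "N \<noteq> 0" using w by (simp add: N_def)
  have s: "s \<noteq> 0" using D k N by (simp add: s_def N_def)
  \<comment> \<open>After the normalisation the cubic is \<open>D / (s * N)\<close> times the
    product of the original linear forms; this equation makes the factor equal to
    \<open>k\<close>.\<close>
  have ksN: "k * s * N = D" using k N by (simp add: s_def N_def)
  have J: "(s * w23 * c1) * (s * w31 * d2) - (s * w23 * d1) * (s * w31 * c2) = s^2 * N"
    unfolding N_def w12_def by (simp add: algebra_simps power2_eq_square)
  show ?G1
    unfolding J using s N by simp
  \<comment> \<open>Any three linear forms in two variables satisfy the relation that their sum with
    weights \<open>w23\<close>, \<open>w31\<close>, \<open>w12\<close> vanishes. These weights are
    thus the ones that make the rescaled forms sum to zero.\<close>
  have third: "- (s * w23 * c1) - s * w31 * c2 = s * w12 * c3" "- (s * w23 * d1) - s * w31 * d2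
      = s * w12 * d3"
    unfolding w12_def w23_def w31_def by (simp_all add: algebra_simps)
  have lin: "P1 * (F * X + G * Y) - Q1 * (E * X + F * Y) = c1 * X + d1 * Y"
    "P2 * (F * X + G * Y) - Q2 * (E * X + F * Y) = c2 * X + d2 * Y"
    "P3 * (F * X + G * Y) - Q3 * (E * X + F * Y) = c3 * X + d3 * Y"
    unfolding c1_def c2_def c3_def d1_def d2_def d3_def by (simp_all add: algebra_simps)
  have "D / (s^2 * N)^2 * ((s * w23 * c1 * X + s * w23 * d1 * Y) * (s * w31 * c2 * X + s * w31 * d2 * Y)
      * (s * w12 * c3 * X + s * w12 * d3 * Y))
    = D / (s^2 * N)^2 * (s^3 * N * ((c1 * X + d1 * Y) * (c2 * X + d2 * Y) * (c3 * X + d3 * Y)))"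
    unfolding N_def by (simp add: algebra_simps power3_eq_cube)
  also have "\<dots> = k * ((c1 * X + d1 * Y) * (c2 * X + d2 * Y) * (c3 * X + d3 * Y))"
    unfolding ksN[symmetric] using s N by (simp add: field_simps power2_eq_square power3_eq_cube)
  finally show ?G2
    unfolding J third lin .
qed

lemma cubic_integral_imp_web:
  assumes metric: "riemannian_metric_on M E F G" and U: "open U" "m0 \<in> U" "U \<subseteq> M"
    and I: "cubic_first_integral_on U E F G I" and roots: "three_distinct_real_roots_on U I"
  obtains W where "open W" "m0 \<in> W" "W \<subseteq> U" "carries_hexagonal_geodesic_3web W E F G"
proof -
  obtain a b c d where sm: "smooth_on U a" "smooth_on U b" "smooth_on U c" "smooth_on U d"
    and Iabcd: "\<forall>z\<in>U. \<forall>p q. I (z, (p, q)) = a z * p^3 + b z * p^2 * q + c z * p * q^2 + d z * q^3"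
    using I unfolding cubic_first_integral_on_def by (elim exE conjE) (rule that)
  have pbI: "poisson_bracket I (geodesic_hamiltonian E F G) \<xi> = 0" if "\<xi> \<in> U \<times> UNIV" for \<xi>
    using I that unfolding cubic_first_integral_on_def by (elim conjE) (rule bspec)
  have roots0: "card (real_roots_at I m0) = 3" using roots U by
      (simp add: three_distinct_real_roots_on_def)
  have Iabcd': "I (z, (p, q)) = a z * p^3 + b z * p^2 * q + c z * p * q^2 + d z * q^3" if
      "z \<in> U" for z p q
    using Iabcd that by simp
  obtain W k P1 Q1 P2 Q2 P3 Q3 where W: "open W" "m0 \<in> W" "W \<subseteq> U"
    and fac: "\<And>z p q. z \<in> W \<Longrightarrow> I (z, (p, q)) = k z * ((P1 z * q - Q1 z * p) * (P2 z * q - Q2 z * p) *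
        (P3 z * q - Q3 z * p))"
    and k: "smooth_on W k"
    and PQ: "smooth_on W P1" "smooth_on W Q1" "smooth_on W P2" "smooth_on W Q2" "smooth_on W P3"
        "smooth_on W Q3"
    and k0: "\<And>z. z \<in> W \<Longrightarrow> k z \<noteq> 0" and ind: "\<And>z. z \<in> W \<Longrightarrow> P1 z * Q2 z - Q1 z * P2 z \<noteq> 0"
    "\<And>z. z \<in> W \<Longrightarrow> P1 z * Q3 z - Q1 z * P3 z \<noteq> 0" "\<And>z. z \<in> W \<Longrightarrow> P2 z * Q3 z - Q2 z * P3 z \<noteq> 0"
    by (rule smooth_cubic_factor[where I = I, OF U(1,2) sm Iabcd' roots0], assumption, rule that)
  have WM: "W \<subseteq> M" using W U by blast
  have EFG: "smooth_on W E" "smooth_on W F" "smooth_on W G"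
    using metric by (auto simp: riemannian_metric_on_def intro: smooth_on_subset[OF _ WM])
  have det: "metric_det E F G z \<noteq> 0" if "z \<in> W" for z
    using riemannian_metric_on_det[OF metric, of z] WM that by auto
  define D where "D z = E z * G z - (F z)^2" for z
  \<comment> \<open>A factor \<open>P q - Q p\<close>, rewritten in velocities through
    \<open>p = E X + F Y\<close> and \<open>q = F X + G Y\<close>, has the coefficients
    \<open>P F - Q E\<close> of \<open>X\<close> and \<open>P G - Q F\<close> of
    \<open>Y\<close>.\<close>
  define c1 where "c1 z = P1 z * F z - Q1 z * E z" for z
  define c2 where "c2 z = P2 z * F z - Q2 z * E z" for z
  define c3 where "c3 z = P3 z * F z - Q3 z * E z" for z
  define d1 where "d1 z = P1 z * G z - Q1 z * F z" for z
  define d2 where "d2 z = P2 z * G z - Q2 z * F z" for z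
  define d3 where "d3 z = P3 z * G z - Q3 z * F z" for z
  define w23 where "w23 z = c2 z * d3 z - d2 z * c3 z" for z
  define w31 where "w31 z = c3 z * d1 z - d3 z * c1 z" for z
  define w12 where "w12 z = c1 z * d2 z - d1 z * c2 z" for z
  define s where "s z = D z / (k z * (w12 z * w23 z * w31 z))" for z
  note defs = D_def c1_def c2_def c3_def d1_def d2_def d3_def w23_def w31_def w12_def s_def
  have D0: "D z \<noteq> 0" if "z \<in> W" for z using det[OF that] by (simp add: D_def metric_det_def)
  have nf: "w12 z \<noteq> 0" "w23 z \<noteq> 0" "w31 z \<noteq> 0" if z: "z \<in> W" for z
    unfolding defs
    by (rule killing_cubic_normal_form(1-3)[OF D0[OF z, unfolded D_def] k0[OF z] ind(1)[OF z]
        ind(2)[OF z] ind(3)[OF z]])+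
  have sD: "smooth_on W D" unfolding D_def[abs_def] by (intro smooth_intros W EFG)
  have sc: "smooth_on W c1" "smooth_on W c2" "smooth_on W c3" "smooth_on W d1" "smooth_on W d2"
      "smooth_on W d3"
    unfolding c1_def[abs_def] c2_def[abs_def] c3_def[abs_def] d1_def[abs_def] d2_def[abs_def]
        d3_def[abs_def]
    by (intro smooth_intros W EFG PQ)+
  have sw: "smooth_on W w12" "smooth_on W w23" "smooth_on W w31"
    unfolding w12_def[abs_def] w23_def[abs_def] w31_def[abs_def] by (intro smooth_intros W sc)+
  have ss: "smooth_on W s"
    unfolding s_def[abs_def] by (intro smooth_intros W sD k sw) (use nf(1-3) k0 in simp)
  define a1 where "a1 z = s z * w23 z * c1 z" for z
  define a2 where "a2 z = s z * w23 z * d1 z" for z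
  define b1 where "b1 z = s z * w31 z * c2 z" for z
  define b2 where "b2 z = s z * w31 z * d2 z" for z
  have sab: "smooth_on W a1" "smooth_on W a2" "smooth_on W b1" "smooth_on W b2"
    unfolding a1_def[abs_def] a2_def[abs_def] b1_def[abs_def] b2_def[abs_def]
    by (intro smooth_intros W ss sw sc)+
  have J: "a1 z * b2 z - a2 z * b1 z \<noteq> 0" if z: "z \<in> W" for z
    unfolding a1_def a2_def b1_def b2_def defs
    by (rule killing_cubic_normal_form(4)[OF D0[OF z, unfolded D_def] k0[OF z] ind(1)[OF z]
        ind(2)[OF z] ind(3)[OF z]])
  have KI: "I (z, (p, q)) = killing_cubic E F G a1 a2 b1 b2 (z, (p, q))" if z: "z \<in> W" for z p q
  proof -
    define X where "X = velocity_x E F G (z, (p, q))"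
    define Y where "Y = velocity_y E F G (z, (p, q))"
    have pq: "E z * X + F z * Y = p" "F z * X + G z * Y = q"
      unfolding X_def Y_def by (rule momentum_velocity[OF det[OF z]])+
    show ?thesis
      unfolding fac[OF z] killing_cubic_def fst_conv metric_det_def X_def[symmetric] Y_def[symmetric]
        a1_def a2_def b1_def b2_def defs
      by (rule killing_cubic_normal_form(5)[OF D0[OF z, unfolded D_def] k0[OF z] ind(1)[OF z]
          ind(2)[OF z] ind(3)[OF z],
            of X Y, unfolded pq, symmetric])
  qed
  have pb: "\<forall>p q. poisson_bracket (killing_cubic E F G a1 a2 b1 b2) (geodesic_hamiltonian E F G) (z,
      (p, q)) = 0"
    if z: "z \<in> W" for z
  proof (intro allI)
    fix p q
    \<comment> \<open>The two cubics agree only over \<open>W\<close>; brackets depend on the germ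
      alone, and \<open>W \<times> UNIV\<close> is open.\<close>
    have "poisson_bracket I (geodesic_hamiltonian E F G) (z, (p, q))
        = poisson_bracket (killing_cubic E F G a1 a2 b1 b2) (geodesic_hamiltonian E F G) (z, (p, q))"
    proof (rule poisson_bracket_cong[of "W \<times> UNIV"])
      show "open (W \<times> (UNIV :: point set))" using W by (simp add: open_Times)
      show "I \<eta> = killing_cubic E F G a1 a2 b1 b2 \<eta>" if "\<eta> \<in> W \<times> UNIV" for \<eta>
        using that KI by (cases \<eta>) auto
    qed (use z in simp)
    then show "poisson_bracket (killing_cubic E F G a1 a2 b1 b2) (geodesic_hamiltonian E F G) (z,
        (p, q)) = 0"
      using pbI[of "(z, (p, q))"] W z by auto
  qed
  note diff = EFG[THEN smooth_on_imp_differentiable] sab[THEN smooth_on_imp_differentiable]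
  have kill: "sym_cov_deriv E F G a1 a2 z (a2 z) (- a1 z) = 0" "sym_cov_deriv E F G b1 b2 z (b2 z)
      (- b1 z) = 0"
      "sym_cov_deriv E F G a1 a2 z (a2 z + b2 z) (- (a1 z + b1 z))
        + sym_cov_deriv E F G b1 b2 z (a2 z + b2 z) (- (a1 z + b1 z)) = 0"
      "dy a1 z = dx a2 z" "dy b1 z = dx b2 z" if z: "z \<in> W" for z
    using killing_cubic_first_integral_iff[OF diff[OF z] det[OF z] J[OF z], THEN iffD1, OF pb[OF z]]
        by simp_all
  \<comment> \<open>On a ball the closed forms obtained from the bracket equation have
    potentials.\<close>
  obtain e where e: "e > 0" "ball m0 e \<subseteq> W" using W open_contains_ball by blast
  let ?B = "ball m0 e"
  have m0B: "m0 \<in> ?B" using e by simp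
  note sabB = sab[THEN smooth_on_subset[OF _ e(2)]] and EFGB = EFG[THEN smooth_on_subset[OF _ e(2)]]
  note inW = subsetD[OF e(2)]
  obtain u where u: "smooth_on ?B u" "\<And>z. z \<in> ?B \<Longrightarrow> dx u z = a1 z" "\<And>z. z \<in> ?B \<Longrightarrow> dy u z = a2 z"
    by (rule poincare_lemma_ball[OF sabB(1,2) e(1) kill(4)[OF inW]], assumption, rule that)
  obtain v where v: "smooth_on ?B v" "\<And>z. z \<in> ?B \<Longrightarrow> dx v z = b1 z" "\<And>z. z \<in> ?B \<Longrightarrow> dy v z = b2 z"
    by (rule poincare_lemma_ball[OF sabB(3,4) e(1) kill(5)[OF inW]], assumption, rule that)
  have covu: "sym_cov_deriv E F G (dx u) (dy u) z = sym_cov_deriv E F G a1 a2 z"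
    and covv: "sym_cov_deriv E F G (dx v) (dy v) z = sym_cov_deriv E F G b1 b2 z" if "z \<in> ?B" for z
    using sym_cov_deriv_cong[OF open_ball that u(2,3)] sym_cov_deriv_cong[OF open_ball that v(2,3)]
        by simp_all
  obtain U' where U': "open U'" "m0 \<in> U'" "U' \<subseteq> ?B" "carries_hexagonal_geodesic_3web U' E F G"
  proof (rule geodesic_web_from_potentials[OF open_ball m0B u(1) v(1) EFGB])
    show "dx u m0 * dy v m0 - dy u m0 * dx v m0 \<noteq> 0" using J[OF W(2)] m0B by (simp add: u v)
    fix z assume z: "z \<in> ?B"
    note zW = inW[OF z]
    show "metric_det E F G z \<noteq> 0" by (rule det[OF zW])
    show "sym_cov_deriv E F G (dx u) (dy u) z (dy u z) (- dx u z) = 0"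
      unfolding covu[OF z] u(2)[OF z] u(3)[OF z] by (rule kill(1)[OF zW])
    show "sym_cov_deriv E F G (dx v) (dy v) z (dy v z) (- dx v z) = 0"
      unfolding covv[OF z] v(2)[OF z] v(3)[OF z] by (rule kill(2)[OF zW])
    show "sym_cov_deriv E F G (dx u) (dy u) z (dy u z + dy v z) (- (dx u z + dx v z))
        + sym_cov_deriv E F G (dx v) (dy v) z (dy u z + dy v z) (- (dx u z + dx v z)) = 0"
      unfolding covu[OF z] covv[OF z] u(2)[OF z] u(3)[OF z] v(2)[OF z] v(3)[OF z] by
          (rule kill(3)[OF zW])
  qed (rule that)
  have "U' \<subseteq> U" using U'(3) e(2) W(3) by blast
  then show ?thesis by (rule that[OF U'(1,2) _ U'(4)])
qed

theorem theorem8: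
  fixes M :: "point set" and m0 :: point and E F G :: scalar_field
  assumes "open M" and "m0 \<in> M" and "riemannian_metric_on M E F G"
  shows "(\<exists>U. open U \<and> m0 \<in> U \<and> U \<subseteq> M \<and> carries_hexagonal_geodesic_3web U E F G) \<longleftrightarrow>
         (\<exists>U. open U \<and> m0 \<in> U \<and> U \<subseteq> M \<and>
            (\<exists>I. cubic_first_integral_on U E F G I \<and> three_distinct_real_roots_on U I))"
proof
  assume "\<exists>U. open U \<and> m0 \<in> U \<and> U \<subseteq> M \<and> carries_hexagonal_geodesic_3web U E F G"
  then obtain U where U: "open U" "m0 \<in> U" "U \<subseteq> M" and web: "carries_hexagonal_geodesic_3web U E F G"
    by (elim exE conjE) (rule that)
  obtain W I where W: "open W" "m0 \<in> W" "W \<subseteq> U" and I: "cubic_first_integral_on W E F G I"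
      "three_distinct_real_roots_on W I"
    by (rule web_imp_cubic_integral[OF assms(3) U web], rule that)
  show "\<exists>U. open U \<and> m0 \<in> U \<and> U \<subseteq> M \<and> (\<exists>I. cubic_first_integral_on U E F G I
      \<and> three_distinct_real_roots_on U I)"
    by (intro exI[of _ W] exI[of _ I] conjI W(1,2) I subset_trans[OF W(3) U(3)])
next
  assume "\<exists>U. open U \<and> m0 \<in> U \<and> U \<subseteq> M \<and> (\<exists>I. cubic_first_integral_on U E F G I
      \<and> three_distinct_real_roots_on U I)"
  then obtain U I where U: "open U" "m0 \<in> U" "U \<subseteq> M" and I: "cubic_first_integral_on U E F G I"
      "three_distinct_real_roots_on U I"
    by (elim exE conjE) (rule that)
  obtain W where W: "open W" "m0 \<in> W" "W \<subseteq> U" "carries_hexagonal_geodesic_3web W E F G"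
    by (rule cubic_integral_imp_web[OF assms(3) U I], rule that)
  show "\<exists>U. open U \<and> m0 \<in> U \<and> U \<subseteq> M \<and> carries_hexagonal_geodesic_3web U E F G"
    by (intro exI[of _ W] conjI W(1,2,4) subset_trans[OF W(3) U(3)])
qed

end
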